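(* Let $n\ge 1$ be an integer, let $\alpha>0$ and $1<q\le 1+\frac{\alpha}{n}$ be real numbers, and let $\mathbb S=(0,+\infty)\times\mathbb R^n$. Let $\mathcal L=\sum_{i,j=1}^n\frac{\partial}{\partial x_i}\left[a_{ij}(t,x)\frac{\partial}{\partial x_j}\right]$, where the $a_{ij}$ are measurable and locally bounded in $\mathbb S$, $a_{ij}=a_{ji}$ a.e. in $\mathbb S$, and $0\le\sum_{i,j=1}^n a_{ij}(t,x)\xi_i\xi_j\le A(t,x)|\xi|^2$ for all $\xi\in\mathbb R^n$ and almost all $(t,x)\in\mathbb S$, with $A$ a measurable, non-negative, locally bounded function in $\mathbb S$. Suppose there is a constant $c>0$ such that $$\operatorname*{ess\,sup}_{(t,x)\in(0,+\infty)\times\{R/2<|x|<R\}}A(t,x)\le cR^{2-\alpha}\quad\text{for all }R>1 .$$ Let $u$ be an entire weak solution in $\mathbb S$ of $u_t\ge\mathcal Lu+|u|^{q-1}u$ and let $v$ be an entire weak solution in $\mathbb S$ of $v_t\le\mathcal Lv+|v|^{q-1}v$, such that $u\ge v$ (a.e.) in $\mathbb S$. Then $u=v$ (a.e.) in $\mathbb S$.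
   Context: For a bounded domain $\Pi\subset\mathbb S$ and $\hat q=\max\{1,q\}$, $W^{\mathcal L,q}(\Pi)$ denotes the completion of (the functions of finite norm in) $C^\infty(\Pi)$ with respect to the norm $$\|w\|_{W^{\mathcal L,q}(\Pi)}=\int_\Pi|w_t|\,dt\,dx+\left[\int_\Pi\sum_{i,j=1}^n a_{ij}(t,x)\frac{\partial w}{\partial x_i}\frac{\partial w}{\partial x_j}\,dt\,dx\right]^{1/2}+\left[\int_\Pi|w|^{\hat q}\,dt\,dx\right]^{1/\hat q}.$$ A function $w$ belongs to $W^{\mathcal L,q}_{\mathrm{loc}}(\mathbb S)$ if it belongs to $W^{\mathcal L,q}(\Pi)$ for every bounded domain $\Pi\subset\mathbb S$. For elements of the completion, $w_t$ and the expressions $\sum a_{ij}\frac{\partial\varphi}{\partial x_i}\frac{\partial w}{\partial x_j}$, $\sum a_{ij}\frac{\partial w}{\partial x_i}\frac{\partial w}{\partial x_j}$ are understood as limits along approximating sequences of smooth functions. A measurable function $w$ on $\mathbb S$ is an entire weak solution of $w_t\ge\mathcal Lw+|w|^{q-1}w$ (respectively $w_t\le\mathcal Lw+|w|^{q-1}w$) in $\mathbb S$ if $w\in W^{\mathcal L,q}_{\mathrm{loc}}(\mathbb S)$ and, for every non-negative $\varphi\in C^\infty(\mathbb S)$ with compact support in $\mathbb S$, $$\int_{\mathbb S}\Big[w_t\varphi+\sum_{i,j=1}^n a_{ij}\frac{\partial\varphi}{\partial x_i}\frac{\partial w}{\partial x_j}-|w|^{q-1}w\,\varphi\Big]dt\,dx\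 \ge 0\quad(\text{respectively }\le 0).$$ No condition is imposed on the behaviour of solutions at $t=0$ or at infinity. *)

theory Defs
  imports "HOL-Analysis.Analysis" "HOL-Probability.Essential_Supremum"
begin

type_synonym 'n spacetime = "real \<times> (real, 'n) vec"

definition half_space :: "'n::finite spacetime set"
  where "half_space = {0<..} \<times> UNIV"

definition bounded_domain :: "'n::finite spacetime set \<Rightarrow> bool"
  where "bounded_domain D \<longleftrightarrow>
    open D \<and> connected D \<and> bounded D \<and> D \<noteq> {} \<and> D \<subseteq> half_space"

definition locally_bounded_on :: "'a::topological_space set \<Rightarrow> ('a \<Rightarrow> real) \<Rightarrow> bool"
  where "locally_bounded_on U f \<longleftrightarrow> (\<forall>K. compact K \<and> K \<subseteq> U \<longrightarrow> bounded (f ` K))"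


section \<open>Smooth functions\<close>

text \<open>On an open set, class \<open>C\<^sup>k\<close> is expressed through iterated directional derivatives.\<close>

fun Ck_on :: "nat \<Rightarrow> 'a::real_normed_vector set \<Rightarrow> ('a \<Rightarrow> real) \<Rightarrow> bool"
  where
    "Ck_on 0 U f \<longleftrightarrow> continuous_on U f"
  | "Ck_on (Suc k) U f \<longleftrightarrow>
      (\<forall>x\<in>U. f differentiable (at x)) \<and>
      (\<forall>h. Ck_on k U (\<lambda>x. frechet_derivative f (at x) h))"

definition smooth_on :: "'a::real_normed_vector set \<Rightarrow> ('a \<Rightarrow> real) \<Rightarrow> bool"
  where "smooth_on U f \<longleftrightarrow> (\<forall>k. Ck_on k U f)"

definition dt :: "('n::finite spacetime \<Rightarrow> real) \<Rightarrow> 'n spacetime \<Rightarrow> real"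
  where "dt f p = frechet_derivative f (at p) (1, 0)"

definition grad :: "('n::finite spacetime \<Rightarrow> real) \<Rightarrow> 'n spacetime \<Rightarrow> real ^ 'n"
  where "grad f p = (\<chi> i. frechet_derivative f (at p) (0, axis i 1))"

text \<open>The values of a test function outside the half-space are irrelevant.\<close>

definition test_function :: "('n::finite spacetime \<Rightarrow> real) \<Rightarrow> bool"
  where "test_function \<phi> \<longleftrightarrow>
    smooth_on half_space \<phi> \<and>
    compact (closure {p \<in> half_space. \<phi> p \<noteq> 0}) \<and>
    closure {p \<in> half_space. \<phi> p \<noteq> 0} \<subseteq> half_space"


section \<open>The function spaces\<close>

definition coeff_form ::
    "('n::finite \<Rightarrow> 'n \<Rightarrow> 'n spacetime \<Rightarrow> real) \<Rightarrow> 'n spacetime \<Rightarrow> real ^ 'n \<Rightarrow> real ^ 'n \<Rightarrow> real"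
  where "coeff_form a p \<xi> \<eta> = (\<Sum>i\<in>UNIV. \<Sum>j\<in>UNIV. a i j p * \<xi> $ i * \<eta> $ j)"

definition W_finite ::
    "('n::finite \<Rightarrow> 'n \<Rightarrow> 'n spacetime \<Rightarrow> real) \<Rightarrow> real \<Rightarrow> 'n spacetime set \<Rightarrow>
      ('n spacetime \<Rightarrow> real) \<Rightarrow> bool"
  where "W_finite a q D w \<longleftrightarrow>
    integrable (lebesgue_on D) (\<lambda>p. \<bar>dt w p\<bar>) \<and>
    integrable (lebesgue_on D) (\<lambda>p. coeff_form a p (grad w p) (grad w p)) \<and>
    integrable (lebesgue_on D) (\<lambda>p. \<bar>w p\<bar> powr max 1 q)"

definition W_norm ::
    "('n::finite \<Rightarrow> 'n \<Rightarrow> 'n spacetime \<Rightarrow> real) \<Rightarrow> real \<Rightarrow> 'n spacetime set \<Rightarrow>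
      ('n spacetime \<Rightarrow> real) \<Rightarrow> real"
  where "W_norm a q D w =
    integral\<^sup>L (lebesgue_on D) (\<lambda>p. \<bar>dt w p\<bar>) +
    sqrt (integral\<^sup>L (lebesgue_on D) (\<lambda>p. coeff_form a p (grad w p) (grad w p))) +
    (integral\<^sup>L (lebesgue_on D) (\<lambda>p. \<bar>w p\<bar> powr max 1 q)) powr (1 / max 1 q)"

definition W_Cauchy ::
    "('n::finite \<Rightarrow> 'n \<Rightarrow> 'n spacetime \<Rightarrow> real) \<Rightarrow> real \<Rightarrow> 'n spacetime set \<Rightarrow>
      (nat \<Rightarrow> 'n spacetime \<Rightarrow> real) \<Rightarrow> bool"
  where "W_Cauchy a q D s \<longleftrightarrow>
    (\<forall>k. smooth_on D (s k) \<and> W_finite a q D (s k)) \<and>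
    (\<forall>e>0. \<exists>N. \<forall>k\<ge>N. \<forall>m\<ge>N. W_norm a q D (\<lambda>p. s k p - s m p) < e)"

text \<open>
  An element of the completion is the class of a Cauchy sequence \<open>s\<close> of smooth functions. Since
  the coefficients may degenerate, such a class need not be determined by its limit \<open>w\<close> alone, so
  it is recorded together with the limits attached to it: the limit \<open>wt\<close> of the time derivatives,
  and the limit \<open>F\<close> of the fluxes with components \<open>\<Sum>j. a i j * (grad (s k) $ j)\<close>. The flux is
  identified through its pairings with gradients of test functions, which converge in \<open>L\<^sup>1(D)\<close>
  along every Cauchy sequence; no convergence of \<open>grad (s k)\<close> itself is available.
  Nonnegative integrals are used so that the convergences entail finiteness.
\<close>

definition W_element ::
    "('n::finite \<Rightarrow> 'n \<Rightarrow> 'n spacetime \<Rightarrow> real) \<Rightarrow> real \<Rightarrow> 'n spacetime set \<Rightarrow>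
      ('n spacetime \<Rightarrow> real) \<Rightarrow> ('n spacetime \<Rightarrow> real) \<Rightarrow> ('n spacetime \<Rightarrow> real ^ 'n) \<Rightarrow> bool"
  where "W_element a q D w wt F \<longleftrightarrow> (\<exists>s. W_Cauchy a q D s \<and>
    (\<lambda>k. \<integral>\<^sup>+ p. ennreal (\<bar>s k p - w p\<bar> powr max 1 q) \<partial>lebesgue_on D) \<longlonglongrightarrow> 0 \<and>
    (\<lambda>k. \<integral>\<^sup>+ p. ennreal \<bar>dt (s k) p - wt p\<bar> \<partial>lebesgue_on D) \<longlonglongrightarrow> 0 \<and>
    (\<forall>\<phi>. test_function \<phi> \<longrightarrow>
      (\<lambda>k. \<integral>\<^sup>+ p. ennreal \<bar>coeff_form a p (grad \<phi> p) (grad (s k) p) - grad \<phi> p \<bullet> F p\<bar>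
        \<partial>lebesgue_on D) \<longlonglongrightarrow> 0))"

text \<open>One pair \<open>wt\<close>, \<open>F\<close> serves all domains: the elements over different domains are compatible.\<close>

definition W_loc ::
    "('n::finite \<Rightarrow> 'n \<Rightarrow> 'n spacetime \<Rightarrow> real) \<Rightarrow> real \<Rightarrow>
      ('n spacetime \<Rightarrow> real) \<Rightarrow> ('n spacetime \<Rightarrow> real) \<Rightarrow> ('n spacetime \<Rightarrow> real ^ 'n) \<Rightarrow> bool"
  where "W_loc a q w wt F \<longleftrightarrow>
    w \<in> borel_measurable (lebesgue_on half_space) \<and>
    wt \<in> borel_measurable (lebesgue_on half_space) \<and>
    F \<in> borel_measurable (lebesgue_on half_space) \<and>
    (\<forall>D. bounded_domain D \<longrightarrow> W_element a q D w wt F)"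


section \<open>Entire weak solutions\<close>

definition weak_form ::
    "real \<Rightarrow> ('n::finite spacetime \<Rightarrow> real) \<Rightarrow> ('n spacetime \<Rightarrow> real) \<Rightarrow>
      ('n spacetime \<Rightarrow> real ^ 'n) \<Rightarrow> ('n spacetime \<Rightarrow> real) \<Rightarrow> real"
  where "weak_form q w wt F \<phi> = integral\<^sup>L (lebesgue_on half_space)
    (\<lambda>p. wt p * \<phi> p + grad \<phi> p \<bullet> F p - \<bar>w p\<bar> powr (q - 1) * w p * \<phi> p)"

definition entire_weak_supersolution ::
    "('n::finite \<Rightarrow> 'n \<Rightarrow> 'n spacetime \<Rightarrow> real) \<Rightarrow> real \<Rightarrow> ('n spacetime \<Rightarrow> real) \<Rightarrow> bool"
  where "entire_weak_supersolution a q w \<longleftrightarrow> (\<exists>wt F. W_loc a q w wt F \<and>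
    (\<forall>\<phi>. test_function \<phi> \<and> (\<forall>p\<in>half_space. 0 \<le> \<phi> p) \<longrightarrow> 0 \<le> weak_form q w wt F \<phi>))"

definition entire_weak_subsolution ::
    "('n::finite \<Rightarrow> 'n \<Rightarrow> 'n spacetime \<Rightarrow> real) \<Rightarrow> real \<Rightarrow> ('n spacetime \<Rightarrow> real) \<Rightarrow> bool"
  where "entire_weak_subsolution a q w \<longleftrightarrow> (\<exists>wt F. W_loc a q w wt F \<and>
    (\<forall>\<phi>. test_function \<phi> \<and> (\<forall>p\<in>half_space. 0 \<le> \<phi> p) \<longrightarrow> weak_form q w wt F \<phi> \<le> 0))"

end

theory Submission
  imports Defs "HOL-Real_Asymp.Real_Asymp"
begin

text \<open>
  The difference \<open>w = u - v \<ge> 0\<close> is a weak solution of \<open>w\<^sub>t \<ge> div (a \<nabla>w) + 2\<^sup>-\<^sup>q w\<^sup>q\<close>. Take a cutoff \<open>\<zeta>\<close> of the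
  cylinder \<open>(0, R\<^sup>\<alpha>) \<times> {|x| < R}\<close> and test with \<open>g (w / \<kappa>) \<zeta>\<close>, where \<open>g\<close> decreases from 2 to 1 with
  \<open>1 / |g' y| \<le> C (1 + |y|\<^sup>p)\<close> for some \<open>1 < p < q\<close>. The term with \<open>g'\<close> has a good sign and absorbs the
  gradient of \<open>w\<close>; the rise of \<open>\<zeta>\<close> near \<open>t = 0\<close> has a good sign as well, so no initial condition is
  needed. With \<open>\<kappa> = h R\<^sup>-\<^sup>n\<close> and Young's inequality this gives
  \<open>\<integral> w\<^sup>q \<zeta> \<le> L (h\<^sup>1\<^sup>-\<^sup>q \<integral>\<^sub>N w\<^sup>q \<zeta> + h)\<close> for all \<open>h > 0\<close>, where \<open>N\<close> is the region on which \<open>\<zeta>\<close> decays and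
  \<open>L\<close> depends neither on \<open>R\<close> nor on \<open>h\<close>; here \<open>q \<le> 1 + \<alpha> / n\<close> enters. A large \<open>h\<close> shows that \<open>w\<^sup>q\<close> is
  integrable, so the integral over \<open>N\<close> vanishes as \<open>R \<rightarrow> \<infinity>\<close>, and then \<open>h \<rightarrow> 0\<close> yields \<open>w = 0\<close>.
\<close>

section \<open>Calculus of \<open>C\<^sup>k\<close> functions\<close>

text \<open>The form may degenerate, so no gradient of w is available: only w, w_t and pairings of
  its flux with gradients of test functions are. Test functions are therefore built from smooth
  approximants \<open>s k\<close>, and the passage to the limit rests on an energy bound uniform in
  k. Approximants may be negative, so g lives on the whole line; its lower bound 1 recovers \<zeta>,
  its upper bound 2 makes the antiderivative G Lipschitz, so that the time term converges in L^1.
  Boundedness of g makes g' integrable, which forces p > 1; p < q leaves room for Young's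
  inequality. Derivatives of \<zeta> cost R^(-\<alpha>): in time by the height of the cylinder, in
  space by A <= c R^(2-\<alpha>). The volume is of order R^(\<alpha>+n), so \<kappa> = h R^(-n)
  turns R^(-\<alpha>) \<kappa> |D| into h and R^(-\<alpha>) \<kappa>^(1-q) into h^(1-q)
  R^(n(q-1)-\<alpha>). At the critical q this power of R is constant, so letting R grow yields no
  decay by itself; smallness has to come from h and from the tail of a convergent integral.\<close>

lemma Ck_on_cong:
  fixes f g :: "'a::real_normed_vector \<Rightarrow> real"
  assumes "open U" and "\<And>x. x \<in> U \<Longrightarrow> f x = g x" and "Ck_on k U f"
  shows "Ck_on k U g"
  using assms(2,3)
proof (induction k arbitrary: f g)
  case 0
  then show ?case using continuous_on_cong by (metis Ck_on.simps(1))
next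
  case (Suc k)
  have der: "(g has_derivative frechet_derivative f (at x)) (at x)" if "x \<in> U" for x
  proof (rule has_derivative_transform_within_open[OF _ assms(1) that Suc.prems(1)])
    show "(f has_derivative frechet_derivative f (at x)) (at x)"
      using Suc.prems(2) that frechet_derivative_works by auto
  qed
  then have "frechet_derivative f (at x) = frechet_derivative g (at x)" if "x \<in> U" for x
    using that frechet_derivative_at by blast
  then have "Ck_on k U (\<lambda>x. frechet_derivative g (at x) h)" for h
    using Suc.IH[of "\<lambda>x. frechet_derivative f (at x) h"] Suc.prems(2) by simp
  then show ?case using der differentiable_def by (metis Ck_on.simps(2))
qed

text \<open>The recursion speaks of the selected \<open>frechet_derivative\<close>; uniqueness of
  derivatives lets any explicit derivative take its place, and openness of U carries the regularity
  over.\<close>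

lemma Ck_on_SucI:
  fixes f :: "'a::real_normed_vector \<Rightarrow> real"
  assumes "open U" and "\<And>x. x \<in> U \<Longrightarrow> (f has_derivative f' x) (at x)"
    and "\<And>h. Ck_on k U (\<lambda>x. f' x h)"
  shows "Ck_on (Suc k) U f"
proof -
  have "Ck_on k U (\<lambda>x. frechet_derivative f (at x) h)" for h
    by (rule Ck_on_cong[OF assms(1) _ assms(3)[of h]]) (metis assms(2) frechet_derivative_at)
  then show ?thesis using assms(2) by (auto simp: differentiable_def)
qed

lemma Ck_on_Suc_has_derivative:
  assumes "Ck_on (Suc k) U f" and "x \<in> U"
  shows "(f has_derivative frechet_derivative f (at x)) (at x)"
  using assms frechet_derivative_works by auto

lemma Ck_on_Suc_frechet: "Ck_on (Suc k) U f \<Longrightarrow> Ck_on k U (\<lambda>x. frechet_derivative f (at x) h)"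
  by simp

declare Ck_on.simps(2) [simp del]

lemma Ck_on_imp_continuous_on:
  assumes "Ck_on k U f"
  shows "continuous_on U f"
proof (cases k)
  case (Suc l)
  then have "f differentiable (at x)" if "x \<in> U" for x
    using assms that by (simp add: Ck_on.simps(2))
  then show ?thesis
    by (simp add: differentiable_imp_continuous_within continuous_at_imp_continuous_on)
qed (use assms in simp)

lemma Ck_on_Suc_imp: "Ck_on (Suc k) U f \<Longrightarrow> Ck_on k U f"
proof (induction k arbitrary: f)
  case 0
  show ?case using Ck_on_imp_continuous_on[OF 0] by simp
next
  case (Suc k)
  show ?case
    unfolding Ck_on.simps(2)[of k]
  proof (intro conjI allI)
    show "\<forall>x\<in>U. f differentiable (at x)"
      using Suc.prems by (simp add: Ck_on.simps(2))
    show "Ck_on k U (\<lambda>x. frechet_derivative f (at x) h)" for h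
      by (rule Suc.IH[OF Ck_on_Suc_frechet[OF Suc.prems]])
  qed
qed

lemma Ck_on_subset: "Ck_on k U f \<Longrightarrow> V \<subseteq> U \<Longrightarrow> Ck_on k V f"
proof (induction k arbitrary: f)
  case 0
  then show ?case by (simp add: continuous_on_subset)
next
  case (Suc k)
  show ?case
    unfolding Ck_on.simps(2)[of k]
  proof (intro conjI allI)
    show "\<forall>x\<in>V. f differentiable (at x)"
      using Suc.prems by (auto simp: Ck_on.simps(2))
    show "Ck_on k V (\<lambda>x. frechet_derivative f (at x) h)" for h
      by (rule Suc.IH[OF Ck_on_Suc_frechet[OF Suc.prems(1)] Suc.prems(2)])
  qed
qed

text \<open>Derivatives at a point do not see which of the two sets it was taken from. This is the
  gluing step behind extensions by zero.\<close>

lemma Ck_on_Un: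
  assumes "open U" "open V" "Ck_on k U f" "Ck_on k V f"
  shows "Ck_on k (U \<union> V) f"
  using assms(3,4)
  by (induction k arbitrary: f) (auto simp: Ck_on.simps(2) intro: continuous_on_open_Un assms(1,2))

lemma Ck_on_const: "open U \<Longrightarrow> Ck_on k U (\<lambda>x. c)"
proof (induction k arbitrary: c)
  case (Suc k)
  then show ?case by (intro Ck_on_SucI[where f' = "\<lambda>_ _. 0"]) auto
qed auto

lemma Ck_on_bounded_linear:
  fixes f :: "'a::real_normed_vector \<Rightarrow> real"
  assumes "open U" "bounded_linear f"
  shows "Ck_on k U f"
proof (cases k)
  case 0
  then show ?thesis using assms by (simp add: linear_continuous_on)
next
  case (Suc l)
  show ?thesis unfolding Suc
    by (rule Ck_on_SucI[where f' = "\<lambda>_. f"])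
      (use assms in \<open>auto intro: Ck_on_const bounded_linear_imp_has_derivative\<close>)
qed

lemma Ck_on_add:
  fixes f g :: "'a::real_normed_vector \<Rightarrow> real"
  assumes "open U" "Ck_on k U f" "Ck_on k U g"
  shows "Ck_on k U (\<lambda>x. f x + g x)"
  using assms(2,3)
proof (induction k arbitrary: f g)
  case (Suc k)
  show ?case
    by (rule Ck_on_SucI[OF assms(1) has_derivative_add[OF Ck_on_Suc_has_derivative[OF Suc.prems(1)]
          Ck_on_Suc_has_derivative[OF Suc.prems(2)]]])
      (simp_all add: Suc Ck_on_Suc_frechet)
qed (simp add: continuous_on_add)

lemma Ck_on_mult:
  fixes f g :: "'a::real_normed_vector \<Rightarrow> real"
  assumes "open U" "Ck_on k U f" "Ck_on k U g"
  shows "Ck_on k U (\<lambda>x. f x * g x)"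
  using assms(2,3)
proof (induction k arbitrary: f g)
  case (Suc k)
  have "Ck_on k U f" "Ck_on k U g"
    using Suc.prems by (simp_all add: Ck_on_Suc_imp)
  then show ?case
    by (intro Ck_on_SucI[OF assms(1) has_derivative_mult[OF Ck_on_Suc_has_derivative[OF Suc.prems(1)]
          Ck_on_Suc_has_derivative[OF Suc.prems(2)]]] Ck_on_add[OF assms(1)] Suc.IH)
      (simp_all add: Suc.prems Ck_on_Suc_frechet)
qed (simp add: continuous_on_mult)

lemma Ck_on_diff:
  fixes f g :: "'a::real_normed_vector \<Rightarrow> real"
  assumes "open U" "Ck_on k U f" "Ck_on k U g"
  shows "Ck_on k U (\<lambda>x. f x - g x)"
  using Ck_on_add[OF assms(1,2) Ck_on_mult[OF assms(1) Ck_on_const[OF assms(1), of k "-1"] assms(3)]]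
  by simp

lemma Ck_on_power:
  fixes f :: "'a::real_normed_vector \<Rightarrow> real"
  assumes "open U" "Ck_on k U f"
  shows "Ck_on k U (\<lambda>x. f x ^ m)"
proof (induction m)
  case (Suc m)
  then show ?case using Ck_on_mult[OF assms] by simp
qed (simp add: Ck_on_const assms(1))

text \<open>The outer function has one real variable, so the chain rule gives a product of two
  real-valued functions and the induction never leaves that class. \<sigma> is generalised because
  the induction hypothesis is applied to its derivative.\<close>

lemma Ck_on_compose:
  fixes f :: "'a::real_normed_vector \<Rightarrow> real" and \<sigma> :: "real \<Rightarrow> real"
  assumes "open U" "open V" "\<And>x. x \<in> U \<Longrightarrow> f x \<in> V" "Ck_on k U f" "Ck_on k V \<sigma>"
  shows "Ck_on k U (\<lambda>x. \<sigma> (f x))"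
  using assms(4,5)
proof (induction k arbitrary: \<sigma>)
  case 0
  then show ?case using assms(3) by (auto intro: continuous_on_compose2)
next
  case (Suc k)
  let ?s = "\<lambda>y. frechet_derivative \<sigma> (at y) 1"
  have s: "frechet_derivative \<sigma> (at y) h = ?s y * h" if "y \<in> V" for y h
  proof -
    have "linear (frechet_derivative \<sigma> (at y))"
      using Ck_on_Suc_has_derivative[OF Suc.prems(2) that] has_derivative_linear by blast
    then show ?thesis
      using linear_scale[of "frechet_derivative \<sigma> (at y)" h 1] by (simp add: mult.commute)
  qed
  have IH: "Ck_on k U (\<lambda>x. ?s (f x))"
    by (rule Suc.IH[OF Ck_on_Suc_imp[OF Suc.prems(1)] Ck_on_Suc_frechet[OF Suc.prems(2)]])
  show ?case
  proof (rule Ck_on_SucI[OF assms(1)])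
    show "((\<lambda>x. \<sigma> (f x)) has_derivative (\<lambda>h. ?s (f x) * frechet_derivative f (at x) h)) (at x)"
      if "x \<in> U" for x
      by (rule has_derivative_compose[OF Ck_on_Suc_has_derivative[OF Suc.prems(1) that]
            has_derivative_eq_rhs[OF Ck_on_Suc_has_derivative[OF Suc.prems(2) assms(3)[OF that]]
              ext[OF s[OF assms(3)[OF that]]]]])
    show "Ck_on k U (\<lambda>x. ?s (f x) * frechet_derivative f (at x) h)" for h
      by (rule Ck_on_mult[OF assms(1) IH Ck_on_Suc_frechet[OF Suc.prems(1)]])
  qed
qed

lemma Ck_on_SucI_real:
  fixes f f' :: "real \<Rightarrow> real"
  assumes "open V" "\<And>x. x \<in> V \<Longrightarrow> (f has_real_derivative f' x) (at x)" "Ck_on k V f'"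
  shows "Ck_on (Suc k) V f"
proof (rule Ck_on_SucI[OF assms(1)])
  show "(f has_derivative (\<lambda>h. f' x * h)) (at x)" if "x \<in> V" for x
    using assms(2)[OF that] by (simp add: has_field_derivative_def)
  show "Ck_on k V (\<lambda>x. f' x * h)" for h
    by (rule Ck_on_mult[OF assms(1,3) Ck_on_const[OF assms(1)]])
qed

lemma Ck_on_exp: "Ck_on k UNIV (exp :: real \<Rightarrow> real)"
proof (induction k)
  case (Suc k)
  then show ?case by (intro Ck_on_SucI_real[where f' = exp]) auto
qed (auto intro: continuous_at_imp_continuous_on)

lemma Ck_on_powr: "Ck_on k {0<..} (\<lambda>x. x powr r)"
proof (induction k arbitrary: r)
  case (Suc k)
  have "Ck_on k {0<..} (\<lambda>x. r * x powr (r - 1))"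
    by (intro Ck_on_mult Ck_on_const Suc) auto
  then show ?case
    by (intro Ck_on_SucI_real[where f' = "\<lambda>x. r * x powr (r - 1)"])
      (auto intro!: has_real_derivative_powr)
qed (simp add: continuous_on_powr continuous_on_id)

text \<open>Composition with the power function of exponent -1 on the positive axis.\<close>

lemma Ck_on_inverse:
  fixes f :: "'a::real_normed_vector \<Rightarrow> real"
  assumes "open U" "Ck_on k U f" "\<And>x. x \<in> U \<Longrightarrow> 0 < f x"
  shows "Ck_on k U (\<lambda>x. inverse (f x))"
proof -
  have "Ck_on k U (\<lambda>x. f x powr -1)"
    by (rule Ck_on_compose[OF assms(1) _ _ assms(2) Ck_on_powr]) (use assms(3) in auto)
  then show ?thesis
    by (rule Ck_on_cong[OF assms(1), rotated]) (use assms(3) in \<open>force simp: powr_minus\<close>)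
qed

text \<open>One differentiation removes arsinh and leaves a power of x * x + 1, to which composition
  applies; hence a case distinction on k and no induction.\<close>

lemma Ck_on_arsinh: "Ck_on k UNIV (arsinh :: real \<Rightarrow> real)"
proof (cases k)
  case (Suc l)
  have "Ck_on l UNIV (\<lambda>x::real. (x * x + 1) powr (-1/2))"
    by (rule Ck_on_compose[OF _ _ _ _ Ck_on_powr])
      (simp_all add: Ck_on_add Ck_on_mult Ck_on_const Ck_on_bounded_linear[OF _ bounded_linear_ident]
        add_nonneg_pos)
  moreover have "(arsinh has_real_derivative (x * x + 1) powr (-1/2)) (at x)" for x :: real
  proof -
    have "(x * x + 1) powr (-1/2) = 1 / sqrt (x\<^sup>2 + 1)"
      by (simp add: powr_minus powr_half_sqrt power2_eq_square divide_simps)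
    then show ?thesis using arsinh_real_has_field_derivative[of x UNIV] by simp
  qed
  ultimately show ?thesis unfolding Suc by (intro Ck_on_SucI_real) auto
qed (auto intro: continuous_on_arsinh')

lemma Ck_on_dt: "Ck_on (Suc k) U f \<Longrightarrow> Ck_on k U (dt f)"
  unfolding dt_def[abs_def] by (rule Ck_on_Suc_frechet)

lemma continuous_on_grad:
  assumes "Ck_on (Suc k) U f"
  shows "continuous_on U (grad f)"
  unfolding grad_def[abs_def]
  by (rule continuous_on_vec_lambda, rule Ck_on_imp_continuous_on, rule Ck_on_Suc_frechet, rule assms)

lemma grad_eqI:
  assumes "(f has_derivative f') (at p)"
  shows "grad f p = (\<chi> i. f' (0, axis i 1))" and "dt f p = f' (1, 0)"
  unfolding grad_def dt_def frechet_derivative_at[OF assms, symmetric] by simp_all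

section \<open>Cutoffs, profiles and elementary inequalities\<close>

definition flat :: "nat \<Rightarrow> real \<Rightarrow> real"
  where "flat m x = (if 0 < x then inverse x ^ m * exp (- inverse x) else 0)"

text \<open>The parameter m makes the family closed under differentiation up to linear combinations,
  so that smoothness of exp(-1/x) becomes an induction over the whole family. The only delicate
  point is 0, where the exponential beats every power in the right-hand difference quotient.\<close>

lemma flat_has_derivative:
  "(flat m has_real_derivative flat (m + 2) x - real m * flat (m + 1) x) (at x)"
proof (cases x "0::real" rule: linorder_cases)
  case less
  have "(flat m has_real_derivative 0) (at x)"
    by (rule has_field_derivative_transform_within_open[where f = "\<lambda>_. 0" and S = "{..<0}"])
      (use less in \<open>auto simp: flat_def\<close>)
  then show ?thesis using less by (simp add: flat_def)
next
  case greater
  let ?f = "\<lambda>x::real. inverse x ^ m * exp (- inverse x)"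
  let ?d = "real m * inverse x ^ (m - 1) * (- (inverse x ^ 2)) * exp (- inverse x)
      + inverse x ^ m * (exp (- inverse x) * inverse x ^ 2)"
  have "(?f has_real_derivative ?d) (at x)"
    using greater by (auto intro!: derivative_eq_intros simp: power2_eq_square algebra_simps)
  moreover have "?d = flat (m + 2) x - real m * flat (m + 1) x"
    using greater by (cases m) (simp_all add: flat_def power2_eq_square algebra_simps)
  ultimately have "(?f has_real_derivative flat (m + 2) x - real m * flat (m + 1) x) (at x)"
    by simp
  then show ?thesis
    by (rule has_field_derivative_transform_within_open[where S = "{0<..}"])
      (use greater in \<open>auto simp: flat_def\<close>)
next
  case equal
  have "((\<lambda>y. flat m y / y) \<longlongrightarrow> 0) (at_right 0)"
  proof (rule Lim_transform_eventually)
    show "((\<lambda>y::real. inverse y ^ m * exp (- inverse y) / y) \<longlongrightarrow> 0) (at_right 0)"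
      by real_asymp
    show "\<forall>\<^sub>F y in at_right 0. inverse y ^ m * exp (- inverse y) / y = flat m y / y"
      unfolding eventually_at_right_field by (intro exI[of _ 1]) (auto simp: flat_def)
  qed
  moreover have "((\<lambda>y. flat m y / y) \<longlongrightarrow> 0) (at_left 0)"
    by (rule tendsto_eventually)
      (auto simp: eventually_at_left_field flat_def intro!: exI[of _ "-1"])
  ultimately have "((\<lambda>y. flat m y / y) \<longlongrightarrow> 0) (at 0)"
    by (simp add: filterlim_split_at)
  then show ?thesis using equal
    by (simp add: has_field_derivative_iff flat_def)
qed

lemma Ck_on_flat: "Ck_on k UNIV (flat m)"
proof (induction k arbitrary: m)
  case 0
  have "isCont (flat m) x" for x
    using flat_has_derivative DERIV_isCont by blast
  then show ?case by (simp add: continuous_at_imp_continuous_on)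
next
  case (Suc k)
  have "Ck_on k UNIV (\<lambda>x. flat (m + 2) x - real m * flat (m + 1) x)"
    by (rule Ck_on_diff[OF open_UNIV Suc Ck_on_mult[OF open_UNIV Ck_on_const[OF open_UNIV] Suc]])
  then show ?case
    by (rule Ck_on_SucI_real[OF open_UNIV flat_has_derivative])
qed

text \<open>The usual quotient a / (a + b) of two flat functions. The step lies in [1/4, 1] because
  the argument will be |x|^2 / R^2: this is R/2 <= |x| <= R, the annulus of the growth hypothesis.
  Monotonicity is needed for the sign of the time derivative near t = 0.\<close>

lemma smooth_cutoff_exists:
  obtains \<psi> \<psi>' :: "real \<Rightarrow> real" and B :: real
  where "\<And>k. Ck_on k UNIV \<psi>" "\<And>r. (\<psi> has_real_derivative \<psi>' r) (at r)"
    "\<And>r. 0 \<le> \<psi> r" "\<And>r. \<psi> r \<le> 1" "\<And>r. \<psi>' r \<le> 0" "\<And>r. \<bar>\<psi>' r\<bar> \<le> B"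
    "\<And>r. r \<le> 1/4 \<Longrightarrow> \<psi> r = 1" "\<And>r. 1 \<le> r \<Longrightarrow> \<psi> r = 0"
    "\<And>r. r \<le> 1/4 \<or> 1 \<le> r \<Longrightarrow> \<psi>' r = 0"
proof -
  let ?a = "\<lambda>r. flat 0 (1 - r)" and ?b = "\<lambda>r. flat 0 (r - 1/4)"
  let ?a' = "\<lambda>r. - flat 2 (1 - r)" and ?b' = "\<lambda>r. flat 2 (r - 1/4)"
  define \<psi> where "\<psi> r = ?a r * inverse (?a r + ?b r)" for r
  define \<psi>' where "\<psi>' r = (?a' r * ?b r - ?a r * ?b' r) / (?a r + ?b r)\<^sup>2" for r
  have nn: "0 \<le> flat m x" for m x
    by (simp add: flat_def)
  \<comment> \<open>The arguments 1 - r and r - 1/4 add up to 3/4, so one of them is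
    positive.\<close>
  have pos: "0 < ?a r + ?b r" for r
    by (auto simp: flat_def add_pos_pos)
  have fl: "(flat 0 has_real_derivative flat 2 x) (at x)" for x
    using flat_has_derivative[of 0 x] by (simp add: numeral_2_eq_2)
  have da: "(?a has_real_derivative ?a' r) (at r)" for r
  proof -
    have "((\<lambda>r. 1 - r) has_real_derivative -1) (at r)" by (auto intro!: derivative_eq_intros)
    from DERIV_chain2[OF fl this] show ?thesis by simp
  qed
  have db: "(?b has_real_derivative ?b' r) (at r)" for r
  proof -
    have "((\<lambda>r. r - 1/4) has_real_derivative 1) (at r)" by (auto intro!: derivative_eq_intros)
    from DERIV_chain2[OF fl this] show ?thesis by simp
  qed
  have d: "(\<psi> has_real_derivative \<psi>' r) (at r)" for r
  proof -
    have "?a r + ?b r \<noteq> 0" using pos[of r] by simp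
    then have "((\<lambda>r. ?a r / (?a r + ?b r)) has_real_derivative
        (?a' r * (?a r + ?b r) - ?a r * (?a' r + ?b' r)) / ((?a r + ?b r) * (?a r + ?b r))) (at r)"
      by (intro DERIV_divide DERIV_add da db)
    moreover have "\<psi> = (\<lambda>r. ?a r / (?a r + ?b r))"
      unfolding \<psi>_def divide_inverse ..
    moreover have "x * (y + z) - y * (x + w) = x * z - y * w" for x y z w :: real
      by algebra
    ultimately show ?thesis
      by (simp only: \<psi>'_def power2_eq_square)
  qed
  have sm_a: "Ck_on k UNIV ?a" and sm_b: "Ck_on k UNIV ?b" for k
    by (rule Ck_on_compose[OF open_UNIV open_UNIV UNIV_I _ Ck_on_flat];
        rule Ck_on_diff[OF open_UNIV];
        rule Ck_on_const[OF open_UNIV] Ck_on_bounded_linear[OF open_UNIV bounded_linear_ident])+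
  have sm: "Ck_on k UNIV \<psi>" for k
    unfolding \<psi>_def[abs_def]
    by (rule Ck_on_mult[OF open_UNIV sm_a Ck_on_inverse[OF open_UNIV Ck_on_add[OF open_UNIV sm_a sm_b] pos]])
  have rng: "0 \<le> \<psi> r" "\<psi> r \<le> 1" for r
    using nn pos[of r] unfolding \<psi>_def by (auto simp: field_simps)
  have neg: "\<psi>' r \<le> 0" for r
    unfolding \<psi>'_def
    using mult_nonneg_nonneg[OF nn[of 2 "1 - r"] nn[of 0 "r - 1/4"]]
      mult_nonneg_nonneg[OF nn[of 0 "1 - r"] nn[of 2 "r - 1/4"]]
    by (intro divide_nonpos_nonneg) auto
  have one: "\<psi> r = 1" if "r \<le> 1/4" for r
    using that pos[of r] unfolding \<psi>_def by (simp add: flat_def)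
  have zero: "\<psi> r = 0" if "1 \<le> r" for r
    using that unfolding \<psi>_def by (simp add: flat_def)
  have zero': "\<psi>' r = 0" if "r \<le> 1/4 \<or> 1 \<le> r" for r
    using that unfolding \<psi>'_def by (auto simp: flat_def)
  have cflat: "continuous_on UNIV (flat m)" for m
    using Ck_on_imp_continuous_on[OF Ck_on_flat[of 0 m]] .
  \<comment> \<open>Off [1/4, 1] the derivative vanishes, so a bound on one compact interval is
    global.\<close>
  have "continuous_on {0..1} \<psi>'"
    unfolding \<psi>'_def[abs_def] using pos
    by (intro continuous_intros continuous_on_compose2[OF cflat]) (auto simp: less_imp_neq[symmetric])
  then have "bounded (\<psi>' ` {0..1})"
    by (intro compact_imp_bounded compact_continuous_image) auto
  then obtain B where B: "\<And>r. r \<in> {0..1} \<Longrightarrow> \<bar>\<psi>' r\<bar> \<le> B" "0 < B"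
    unfolding bounded_pos real_norm_def by blast
  have "\<bar>\<psi>' r\<bar> \<le> B" for r
  proof (cases "r \<in> {0..1}")
    case False
    then have "\<psi>' r = 0" by (intro zero') auto
    then show ?thesis using B(2) by simp
  qed (use B(1) in blast)
  then show thesis
    using that[OF sm d rng neg _ one zero zero'] by blast
qed

section \<open>The bounded profile g and its antiderivative\<close>

lemma exists_antiderivative:
  fixes g :: "real \<Rightarrow> real"
  assumes "continuous_on UNIV g"
  obtains G where "\<And>y. (G has_real_derivative g y) (at y)" "G 0 = 0"
proof -
  let ?G = "\<lambda>u. interval_lebesgue_integral lborel (ereal 0) (ereal u) g"
  have "(?G has_real_derivative g y) (at y)" for y
  proof -
    \<comment> \<open>This interval contains 0 and has y in its interior, so the one-interval
      derivative is the full one.\<close>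
    let ?a = "- \<bar>y\<bar> - 1" and ?b = "\<bar>y\<bar> + 1"
    have "(?G has_vector_derivative g y) (at y within {?a..?b})"
      by (rule interval_integral_FTC2[where a = ?a and b = ?b])
        (auto intro: continuous_on_subset[OF assms])
    then have "(?G has_real_derivative g y) (at y within {?a..?b})"
      by (simp add: has_real_derivative_iff_has_vector_derivative)
    moreover have "y \<in> interior {?a..?b}"
      by (auto simp: interior_atLeastAtMost_real)
    ultimately show ?thesis by (simp only: at_within_interior)
  qed
  then show thesis using that[of ?G] by simp
qed

text \<open>g is a logistic step in the variable arsinh y: E is (y + sqrt(y^2 + 1))^\<nu> with \<nu>
  = p - 1, hence of order |y|^\<nu> at plus infinity and |y|^(-\<nu>) at minus infinity. So |g'|
  decays like |y|^(-1-\<nu>) = |y|^(-p) on both sides, while g' never vanishes.\<close>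

lemma slowly_decreasing_profile:
  fixes p :: real
  assumes "1 < p"
  obtains g g' G :: "real \<Rightarrow> real" and C :: real
  where "\<And>k. Ck_on k UNIV g" "\<And>y. (g has_real_derivative g' y) (at y)"
    "\<And>y. (G has_real_derivative g y) (at y)" "G 0 = 0"
    "\<And>y. 1 \<le> g y" "\<And>y. g y \<le> 2" "\<And>y. g' y < 0" "\<And>y. \<bar>g' y\<bar> \<le> C"
    "\<And>y. 1 / \<bar>g' y\<bar> \<le> C * (1 + \<bar>y\<bar> powr p)" "0 < C" "continuous_on UNIV g'"
proof -
  define \<nu> where "\<nu> = p - 1"
  have \<nu>: "0 < \<nu>" using assms by (simp add: \<nu>_def)
  define E where "E y = exp (\<nu> * arsinh y)" for y :: real
  define g where "g y = 1 + inverse (1 + E y)" for y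
  define g' where "g' y = - (E y * \<nu> / sqrt (y\<^sup>2 + 1)) / (1 + E y)\<^sup>2" for y
  have E: "0 < E y" for y by (simp add: E_def)
  have pE: "0 < 1 + E y" for y using E[of y] by simp
  have smE: "Ck_on k UNIV E" for k
    unfolding E_def[abs_def]
    by (rule Ck_on_compose[OF open_UNIV open_UNIV UNIV_I _ Ck_on_exp],
        rule Ck_on_mult[OF open_UNIV Ck_on_const[OF open_UNIV] Ck_on_arsinh])
  have sm: "Ck_on k UNIV g" for k
    unfolding g_def[abs_def]
    by (rule Ck_on_add[OF open_UNIV Ck_on_const[OF open_UNIV] Ck_on_inverse[OF open_UNIV
          Ck_on_add[OF open_UNIV Ck_on_const[OF open_UNIV] smE] pE]])
  have dE: "(E has_real_derivative E y * \<nu> / sqrt (y\<^sup>2 + 1)) (at y)" for y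
    unfolding E_def[abs_def] by (auto intro!: derivative_eq_intros)
  have d: "(g has_real_derivative g' y) (at y)" for y
  proof -
    have "1 + E y \<noteq> 0" using pE[of y] by simp
    then show ?thesis
      unfolding g_def[abs_def] g'_def
      by (auto intro!: derivative_eq_intros dE simp: power2_eq_square field_simps)
  qed
  have sq: "1 \<le> sqrt (y\<^sup>2 + 1)" for y :: real by simp
  have g1: "1 \<le> g y" and g2: "g y \<le> 2" for y
    using E[of y] unfolding g_def by (auto simp: field_simps)
  have neg: "g' y < 0" for y
  proof -
    have "0 < E y * \<nu> / sqrt (y\<^sup>2 + 1)"
      using E[of y] \<nu> by (simp add: add_nonneg_pos)
    then show ?thesis unfolding g'_def using pE[of y]
      by (intro divide_neg_pos) auto
  qed
  have absg': "\<bar>g' y\<bar> = E y * \<nu> / (sqrt (y\<^sup>2 + 1) * (1 + E y)\<^sup>2)" for y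
  proof -
    have "\<bar>E y * \<nu>\<bar> = E y * \<nu>" using E[of y] \<nu> by simp
    then show ?thesis by (simp only: g'_def abs_divide abs_minus_cancel abs_power2 divide_divide_eq_left)
        (simp add: mult.commute)
  qed
  have bd: "\<bar>g' y\<bar> \<le> \<nu>" for y
  proof -
    have "E y \<le> (1 + E y)\<^sup>2" using E[of y] by (simp add: power2_eq_square algebra_simps)
    also have "\<dots> \<le> sqrt (y\<^sup>2 + 1) * (1 + E y)\<^sup>2"
      using mult_right_mono[OF sq[of y], of "(1 + E y)\<^sup>2"] by simp
    finally have "E y * \<nu> \<le> \<nu> * (sqrt (y\<^sup>2 + 1) * (1 + E y)\<^sup>2)"
      using \<nu> by (simp add: mult.commute)
    moreover have "0 < sqrt (y\<^sup>2 + 1) * (1 + E y)\<^sup>2"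
      using pE[of y] by (simp add: add_nonneg_pos)
    ultimately show ?thesis unfolding absg' by (simp add: pos_divide_le_eq)
  qed
  \<comment> \<open>The factor 4 bounds (1 + E)^2 / E by 4 M, the factor 3^p comes from L <= 3
    max(1, |y|), and 1 / \<nu> from differentiating E.\<close>
  have low: "1 / \<bar>g' y\<bar> \<le> (4 * 3 powr p / \<nu>) * (1 + \<bar>y\<bar> powr p)" for y
  proof -
    define L where "L = \<bar>y\<bar> + sqrt (y\<^sup>2 + 1)"
    define M where "M = L powr \<nu>"
    have L1: "1 \<le> L" using sq[of y] unfolding L_def by linarith
    have M1: "1 \<le> M" using L1 \<nu> unfolding M_def by (simp add: ge_one_powr_ge_zero)
    have M: "M = exp (\<nu> * arsinh \<bar>y\<bar>)"
      using L1 unfolding M_def L_def by (simp add: powr_def arsinh_real_def)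
    have "E y = M \<or> E y = 1 / M"
    proof (cases "0 \<le> y")
      case False
      then have "arsinh \<bar>y\<bar> = - arsinh y" by (simp add: arsinh_minus_real)
      then show ?thesis unfolding M E_def by (simp add: exp_minus field_simps)
    qed (simp add: M E_def)
    \<comment> \<open>(1 + E)^2 / E is invariant under E -> 1/E, which reflects that arsinh is odd;
      so both signs of y obey the same bound.\<close>
    then have "(1 + E y)\<^sup>2 / E y \<le> 4 * M"
    proof
      assume "E y = M"
      moreover have "(1 + M)\<^sup>2 \<le> (2 * M)\<^sup>2" using M1 by (intro power_mono) auto
      ultimately show ?thesis using M1 by (simp add: power2_eq_square field_simps)
    next
      assume "E y = 1 / M"
      moreover have "(1 + 1 / M)\<^sup>2 \<le> 2\<^sup>2" using M1 by (intro power_mono) auto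
      ultimately show ?thesis using M1 by simp
    qed
    then have "(1 + E y)\<^sup>2 / E y * sqrt (y\<^sup>2 + 1) / \<nu> \<le> (4 * M) * L / \<nu>"
      using \<nu> M1 by (intro divide_right_mono mult_mono) (auto simp: L_def)
    moreover have "1 / \<bar>g' y\<bar> = (1 + E y)\<^sup>2 / E y * sqrt (y\<^sup>2 + 1) / \<nu>"
      unfolding absg' by simp
    moreover have "M * L = L powr p"
      using L1 powr_add[of L \<nu> 1] unfolding M_def \<nu>_def by simp
    moreover have "L powr p \<le> 3 powr p * (1 + \<bar>y\<bar> powr p)"
    proof -
      have "sqrt (y\<^sup>2 + 1) \<le> \<bar>y\<bar> + 1"
        by (rule real_le_lsqrt) (auto simp: power2_eq_square algebra_simps)
      then have "L \<le> 3 * max 1 \<bar>y\<bar>" unfolding L_def by linarith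
      then have "L powr p \<le> (3 * max 1 \<bar>y\<bar>) powr p"
        using L1 assms by (intro powr_mono2) auto
      also have "\<dots> = 3 powr p * max 1 \<bar>y\<bar> powr p" by (simp add: powr_mult)
      also have "max 1 \<bar>y\<bar> powr p \<le> 1 + \<bar>y\<bar> powr p" by (auto simp: max_def)
      finally show ?thesis by simp
    qed
    ultimately show ?thesis using \<nu> by (simp add: field_simps)
  qed
  obtain G where G: "\<And>y. (G has_real_derivative g y) (at y)" "G 0 = 0"
    using exists_antiderivative[OF Ck_on_imp_continuous_on[OF sm[of 0]]] by blast
  let ?C = "max \<nu> (4 * 3 powr p / \<nu>)"
  have "1 / \<bar>g' y\<bar> \<le> ?C * (1 + \<bar>y\<bar> powr p)" for y
    by (rule order_trans[OF low mult_right_mono]) (auto intro: add_nonneg_nonneg)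
  moreover have "\<bar>g' y\<bar> \<le> ?C" for y using bd[of y] by simp
  moreover have "continuous_on UNIV g'"
  proof -
    have "1 + E y \<noteq> 0" "sqrt (y\<^sup>2 + 1) \<noteq> 0" for y using pE[of y] sq[of y] by linarith+
    then show ?thesis unfolding g'_def[abs_def]
      by (intro continuous_intros Ck_on_imp_continuous_on[OF smE[of 0]]) simp_all
  qed
  ultimately show thesis
    using that[OF sm d G g1 g2 neg, of ?C] \<nu> by (simp add: less_max_iff_disj)
qed

section \<open>Inequalities for real powers\<close>

lemma powr_superadditive:
  fixes x y q :: real
  assumes "0 \<le> x" "0 \<le> y" "1 \<le> q"
  shows "x powr q + y powr q \<le> (x + y) powr q"
proof (cases "x + y = 0")
  case False
  then have pos: "0 < x + y" using assms by linarith
  \<comment> \<open>Both summands are at most x + y; adding this bound for z = x and z = y gives the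
    claim.\<close>
  have "z powr q \<le> (x + y) powr (q - 1) * z" if "0 \<le> z" "z \<le> x + y" for z
  proof (cases "z = 0")
    case False
    then have "z powr q = z powr (q - 1) * z"
      using that powr_mult_base[of z "q - 1"] by (simp add: mult.commute)
    also have "\<dots> \<le> (x + y) powr (q - 1) * z"
      using that assms by (intro mult_right_mono powr_mono2) auto
    finally show ?thesis .
  qed simp
  from add_mono[OF this[of x] this[of y]]
  have "x powr q + y powr q \<le> (x + y) powr (q - 1) * (x + y)"
    using assms by (simp add: algebra_simps)
  also have "\<dots> = (x + y) powr q"
    using pos powr_mult_base[of "x + y" "q - 1"] by (simp add: mult.commute)
  finally show ?thesis .
next
  case True
  then have "x = 0" "y = 0" using assms by linarith+
  then show ?thesis by simp
qed

text \<open>For equal signs superadditivity gives the bound even with constant 1. The constant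
  2^(-q) is due to opposite signs, where u - v is at most twice the larger of u and -v. This is what
  makes the difference of the solutions a supersolution with a power source.\<close>

lemma signed_powr_diff_ge:
  fixes u v q :: real
  assumes "v \<le> u" "1 < q"
  shows "2 powr (- q) * (u - v) powr q \<le> \<bar>u\<bar> powr (q - 1) * u - \<bar>v\<bar> powr (q - 1) * v"
proof -
  have base: "x powr (q - 1) * x = x powr q" if "0 \<le> x" for x :: real
    using that assms powr_mult_base[of x "q - 1"] by (cases "x = 0") (auto simp: mult.commute)
  have le: "2 powr (- q) * z \<le> z" if "0 \<le> z" for z :: real
    using that assms powr_mono[of "-q" 0 2] by (intro mult_left_le_one_le) auto
  consider "0 \<le> v" | "v < 0" "0 \<le> u" | "u < 0" by linarith
  then show ?thesis
  proof cases
    case 1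
    have "(u - v) powr q + v powr q \<le> u powr q"
      using powr_superadditive[of "u - v" v q] 1 assms by simp
    moreover note le[of "(u - v) powr q"] base[of u] base[of v]
    ultimately show ?thesis using 1 assms(1) by simp
  next
    case 2
    let ?m = "max u (- v)"
    have "(u - v) powr q \<le> (2 * ?m) powr q" using 2 assms by (intro powr_mono2) auto
    also have "\<dots> = 2 powr q * ?m powr q" using 2 by (simp add: powr_mult)
    also have "?m powr q \<le> u powr q + (- v) powr q" using 2 by (auto simp: max_def)
    finally have "2 powr (- q) * (u - v) powr q \<le> u powr q + (- v) powr q"
      by (simp add: powr_minus field_simps)
    then show ?thesis using base[of u] base[of "- v"] 2 by simp
  next
    case 3
    have "(u - v) powr q + (- u) powr q \<le> (- v) powr q"
      using powr_superadditive[of "u - v" "- u" q] 3 assms by simp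
    moreover note le[of "(u - v) powr q"] base[of "- u"] base[of "- v"]
    ultimately show ?thesis using 3 assms(1) by simp
  qed
qed

lemma abs_add_powr_le:
  fixes x y q :: real
  assumes "0 \<le> q"
  shows "\<bar>x + y\<bar> powr q \<le> 2 powr q * (\<bar>x\<bar> powr q + \<bar>y\<bar> powr q)"
proof -
  let ?m = "max \<bar>x\<bar> \<bar>y\<bar>"
  have "\<bar>x + y\<bar> powr q \<le> (2 * ?m) powr q" using assms by (intro powr_mono2) auto
  also have "\<dots> = 2 powr q * ?m powr q" by (simp add: powr_mult)
  also have "?m powr q \<le> \<bar>x\<bar> powr q + \<bar>y\<bar> powr q" by (auto simp: max_def)
  finally show ?thesis by simp
qed

text \<open>Young's inequality in a form adapted to \<zeta> = W^s, whose derivatives lose up to two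
  powers of W. If y^(q-p) W^2 >= 1, multiplying the left side by it gives the first term on the
  right; otherwise the left side is at most a positive power of this quantity, hence at most
  1.\<close>

lemma weighted_powr_le:
  fixes y W p q :: real
  assumes "0 \<le> y" "0 \<le> W" "W \<le> 1" "1 \<le> p" "p < q" "2 * q / (q - p) \<le> real s"
  shows "y powr p * W ^ (s - 2) \<le> y powr q * W ^ s + 1"
proof -
  have "2 < 2 * q / (q - p)" using assms by (simp add: field_simps)
  then have s: "2 < s" using assms(6) by linarith
  then have Ws: "W ^ s = W ^ (s - 2) * W\<^sup>2" by (metis le_add_diff_inverse2 less_imp_le power_add)
  show ?thesis
  proof (cases "y = 0 \<or> W = 0")
    case True
    then have "y powr p * W ^ (s - 2) = 0" using s by auto
    moreover have "0 \<le> y powr q * W ^ s" using assms by simp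
    ultimately show ?thesis by linarith
  next
    case False
    then have y: "0 < y" and W: "0 < W" using assms by auto
    show ?thesis
    proof (cases "1 \<le> y powr (q - p) * W\<^sup>2")
      case True
      have "y powr p * W ^ (s - 2) \<le> (y powr p * W ^ (s - 2)) * (y powr (q - p) * W\<^sup>2)"
        using mult_left_mono[OF True, of "y powr p * W ^ (s - 2)"] W by simp
      also have "\<dots> = y powr q * W ^ s"
        unfolding Ws using powr_add[of y p "q - p"] by (simp add: algebra_simps)
      finally show ?thesis by simp
    next
      case False
      \<comment> \<open>Chosen so that raising y^(q-p) to this power gives y^p; then W must carry
        exponent 2e <= s - 2, which is exactly s >= 2q/(q-p).\<close>
      let ?e = "p / (q - p)"
      have "W ^ (s - 2) = W powr real (s - 2)" using W by (simp add: powr_realpow)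
      also have "\<dots> \<le> W powr (2 * ?e)"
      proof (rule powr_mono')
        have "2 * q / (q - p) = 2 + 2 * ?e" using assms by (simp add: field_simps)
        then show "2 * ?e \<le> real (s - 2)" using assms(6) s by (simp add: of_nat_diff)
      qed (use assms in auto)
      also have "W powr (2 * ?e) = (W\<^sup>2) powr ?e"
        using W by (simp add: powr_powr flip: powr_numeral)
      finally have "y powr p * W ^ (s - 2) \<le> y powr p * (W\<^sup>2) powr ?e"
        by (intro mult_left_mono) auto
      also have "\<dots> = (y powr (q - p) * W\<^sup>2) powr ?e"
        using assms by (simp add: powr_mult powr_powr)
      also have "\<dots> \<le> 1"
        using False assms by (intro powr_le1) auto
      finally have "y powr p * W ^ (s - 2) \<le> 1" .
      moreover have "0 \<le> y powr q * W ^ s" using assms by simp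
      ultimately show ?thesis by linarith
    qed
  qed
qed

lemma smooth_on_imp_Ck_on: "smooth_on U f \<Longrightarrow> Ck_on k U f"
  by (simp add: smooth_on_def)

lemma
  assumes "Ck_on (Suc k) U f" "Ck_on (Suc k) U g" "p \<in> U"
  shows grad_diff: "grad (\<lambda>x. f x - g x) p = grad f p - grad g p"
    and dt_diff: "dt (\<lambda>x. f x - g x) p = dt f p - dt g p"
  using grad_eqI[OF has_derivative_diff[OF Ck_on_Suc_has_derivative[OF assms(1,3)]
      Ck_on_Suc_has_derivative[OF assms(2,3)]]]
  by (auto simp: grad_def dt_def vec_eq_iff)

lemma
  assumes "open U" "p \<in> U" "\<And>x. x \<in> U \<Longrightarrow> f x = 0"
  shows grad_eq_0: "grad f p = 0" and dt_eq_0: "dt f p = 0"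
proof -
  have "(f has_derivative (\<lambda>_. 0)) (at p)"
    by (rule has_derivative_transform_within_open[OF has_derivative_const assms(1,2)])
      (use assms(3) in simp)
  from grad_eqI[OF this] show "grad f p = 0" "dt f p = 0"
    by (auto simp: vec_eq_iff)
qed

section \<open>The coefficient form\<close>

lemma
  shows coeff_form_add_left: "coeff_form a p (x + y) z = coeff_form a p x z + coeff_form a p y z"
    and coeff_form_add_right: "coeff_form a p z (x + y) = coeff_form a p z x + coeff_form a p z y"
    and coeff_form_diff_left: "coeff_form a p (x - y) z = coeff_form a p x z - coeff_form a p y z"
    and coeff_form_diff_right: "coeff_form a p z (x - y) = coeff_form a p z x - coeff_form a p z y"
    and coeff_form_scaleR_left: "coeff_form a p (c *\<^sub>R x) z = c * coeff_form a p x z"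
    and coeff_form_scaleR_right: "coeff_form a p z (c *\<^sub>R x) = c * coeff_form a p z x"
    and coeff_form_zero_left: "coeff_form a p 0 z = 0"
    and coeff_form_zero_right: "coeff_form a p z 0 = 0"
  unfolding coeff_form_def
  by (simp_all add: algebra_simps sum.distrib sum_subtractf sum_distrib_left)

lemmas coeff_form_simps = coeff_form_add_left coeff_form_add_right coeff_form_diff_left
  coeff_form_diff_right coeff_form_scaleR_left coeff_form_scaleR_right
  coeff_form_zero_left coeff_form_zero_right

text \<open>The hypotheses on the coefficients at a single point. Cauchy-Schwarz type facts become
  pure algebra there, and exceptional null sets appear only when integrating.\<close>

definition psd_at :: "('n::finite \<Rightarrow> 'n \<Rightarrow> 'n spacetime \<Rightarrow> real) \<Rightarrow> 'n spacetime \<Rightarrow> bool"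
  where "psd_at a p \<longleftrightarrow> (\<forall>i j. a i j p = a j i p) \<and> (\<forall>\<xi>. 0 \<le> coeff_form a p \<xi> \<xi>)"

context
  fixes a :: "'n::finite \<Rightarrow> 'n \<Rightarrow> 'n spacetime \<Rightarrow> real" and p
  assumes psd: "psd_at a p"
begin

lemma coeff_form_nonneg: "0 \<le> coeff_form a p \<xi> \<xi>"
  using psd by (simp add: psd_at_def)

lemma coeff_form_commute: "coeff_form a p \<xi> \<eta> = coeff_form a p \<eta> \<xi>"
proof -
  have "coeff_form a p \<xi> \<eta> = (\<Sum>j\<in>UNIV. \<Sum>i\<in>UNIV. a i j p * \<xi> $ i * \<eta> $ j)"
    unfolding coeff_form_def by (rule sum.swap)
  also have "\<dots> = coeff_form a p \<eta> \<xi>"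
    unfolding coeff_form_def using psd
    by (intro sum.cong refl) (simp add: psd_at_def mult.assoc mult.left_commute mult.commute)
  finally show ?thesis .
qed

text \<open>Expand the nonnegative values of the form at \<delta> \<xi> - \<eta> and \<delta> \<xi>
  + \<eta>, then divide by 2 \<delta>.\<close>

lemma coeff_form_young:
  assumes "0 < \<delta>"
  shows "\<bar>coeff_form a p \<xi> \<eta>\<bar> \<le> \<delta> / 2 * coeff_form a p \<xi> \<xi> + coeff_form a p \<eta> \<eta> / (2 * \<delta>)"
proof -
  have "0 \<le> \<delta>\<^sup>2 * coeff_form a p \<xi> \<xi> - 2 * \<delta> * coeff_form a p \<xi> \<eta> + coeff_form a p \<eta> \<eta>"
    using coeff_form_nonneg[of "\<delta> *\<^sub>R \<xi> - \<eta>"] coeff_form_commute[of \<eta> \<xi>]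
    by (simp add: coeff_form_simps power2_eq_square algebra_simps)
  moreover have "0 \<le> \<delta>\<^sup>2 * coeff_form a p \<xi> \<xi> + 2 * \<delta> * coeff_form a p \<xi> \<eta> + coeff_form a p \<eta> \<eta>"
    using coeff_form_nonneg[of "\<delta> *\<^sub>R \<xi> + \<eta>"] coeff_form_commute[of \<eta> \<xi>]
    by (simp add: coeff_form_simps power2_eq_square algebra_simps)
  ultimately have "2 * \<delta> * \<bar>coeff_form a p \<xi> \<eta>\<bar> \<le> \<delta>\<^sup>2 * coeff_form a p \<xi> \<xi> + coeff_form a p \<eta> \<eta>"
    by (simp add: abs_if)
  then have "\<bar>coeff_form a p \<xi> \<eta>\<bar> \<le> (\<delta>\<^sup>2 * coeff_form a p \<xi> \<xi> + coeff_form a p \<eta> \<eta>) / (2 * \<delta>)"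
    using assms by (simp add: pos_le_divide_eq mult.commute)
  also have "\<dots> = \<delta> / 2 * coeff_form a p \<xi> \<xi> + coeff_form a p \<eta> \<eta> / (2 * \<delta>)"
    using assms by (simp add: field_simps power2_eq_square)
  finally show ?thesis .
qed

text \<open>Parallelogram law: the values at \<xi> + \<eta> and \<xi> - \<eta> are both nonnegative
  and add up to the right-hand side.\<close>

lemma
  shows coeff_form_add_le:
      "coeff_form a p (\<xi> + \<eta>) (\<xi> + \<eta>) \<le> 2 * coeff_form a p \<xi> \<xi> + 2 * coeff_form a p \<eta> \<eta>"
    and coeff_form_diff_le:
      "coeff_form a p (\<xi> - \<eta>) (\<xi> - \<eta>) \<le> 2 * coeff_form a p \<xi> \<xi> + 2 * coeff_form a p \<eta> \<eta>"
  using coeff_form_nonneg[of "\<xi> - \<eta>"] coeff_form_nonneg[of "\<xi> + \<eta>"]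
  by (simp_all add: coeff_form_simps algebra_simps)

text \<open>Used with \<xi> the gradient of the cutoff, \<eta> the gradient of an approximant, z the
  cutoff and \<gamma> = |g'|: the good term -\<gamma> z a(\<eta>,\<eta>) swallows the mixed term.
  What remains is free of \<eta>, so no bound on gradients of solutions enters the final
  estimate.\<close>

lemma coeff_form_absorb:
  assumes "coeff_form a p \<xi> \<xi> \<le> b * z" "0 \<le> b" "0 \<le> z" "0 < \<gamma>" "0 \<le> G" "G \<le> 2"
  shows "G * coeff_form a p \<xi> \<eta> - \<gamma> * z * coeff_form a p \<eta> \<eta> \<le> b / \<gamma>"
proof (cases "z = 0")
  case True
  then have x: "coeff_form a p \<xi> \<xi> = 0" using assms(1) coeff_form_nonneg[of \<xi>] by simp
  have "coeff_form a p \<xi> \<eta> \<le> 0"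
  proof (rule ccontr)
    let ?c = "coeff_form a p \<xi> \<eta>" and ?d = "coeff_form a p \<eta> \<eta>"
    assume "\<not> ?c \<le> 0"
    then have c: "0 < ?c" by simp
    \<comment> \<open>As \<xi> is a null vector of the form, Young bounds c by d / (2 \<delta>);
      this \<delta> makes that bound at most c / 2, which is absurd for c > 0.\<close>
    let ?\<delta> = "(?d + 1) / ?c"
    have "0 < ?\<delta>" using c coeff_form_nonneg[of \<eta>] by simp
    from coeff_form_young[OF this, of \<xi> \<eta>] have "?c \<le> ?d / (2 * ?\<delta>)" using x by simp
    also have "\<dots> = ?c * (?d / (2 * (?d + 1)))" by simp
    also have "?d / (2 * (?d + 1)) \<le> 1/2" using coeff_form_nonneg[of \<eta>] by (simp add: field_simps)
    finally show False using c by (simp add: mult_left_mono)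
  qed
  then have "G * coeff_form a p \<xi> \<eta> \<le> 0" using assms(5) by (simp add: mult_nonneg_nonpos)
  moreover have "0 \<le> b / \<gamma>" using assms by simp
  ultimately show ?thesis using True by simp
next
  case False
  then have z: "0 < z" using assms by simp
  have "G * coeff_form a p \<xi> \<eta> = coeff_form a p (G *\<^sub>R \<xi>) \<eta>"
    by (simp add: coeff_form_simps)
  \<comment> \<open>With \<delta> = 1 / (2 \<gamma> z) the second Young term is exactly the good
    term; the first is G^2 a(\<xi>,\<xi>) / (4 \<gamma> z), and G <= 2 cancels the 4.\<close>
  also have "\<dots> \<le> (1 / (2 * \<gamma> * z)) / 2 * coeff_form a p (G *\<^sub>R \<xi>) (G *\<^sub>R \<xi>)
      + coeff_form a p \<eta> \<eta> / (2 * (1 / (2 * \<gamma> * z)))"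
    by (rule order_trans[OF abs_ge_self coeff_form_young]) (use z assms in simp)
  also have "\<dots> = G\<^sup>2 * coeff_form a p \<xi> \<xi> / (4 * \<gamma> * z) + \<gamma> * z * coeff_form a p \<eta> \<eta>"
    by (simp add: coeff_form_simps power2_eq_square)
  also have "G\<^sup>2 * coeff_form a p \<xi> \<xi> / (4 * \<gamma> * z) \<le> 2\<^sup>2 * (b * z) / (4 * \<gamma> * z)"
    using assms z coeff_form_nonneg[of \<xi>]
    by (intro divide_right_mono mult_mono power_mono) auto
  also have "2\<^sup>2 * (b * z) / (4 * \<gamma> * z) = b / \<gamma>" using z by simp
  finally show ?thesis by simp
qed

end


section \<open>Integration over subdomains\<close>

lemma nn_integral_dominated_tendsto_0:
  fixes f g h :: "nat \<Rightarrow> 'a \<Rightarrow> real"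
  assumes "\<And>k. f k \<in> borel_measurable M" "\<And>k. g k \<in> borel_measurable M"
    and "\<And>k x. x \<in> space M \<Longrightarrow> h k x \<le> c * (f k x + g k x)"
    and "\<And>k x. 0 \<le> f k x" "\<And>k x. 0 \<le> g k x" "0 \<le> c"
    and "(\<lambda>k. \<integral>\<^sup>+ x. ennreal (f k x) \<partial>M) \<longlonglongrightarrow> 0"
    and "(\<lambda>k. \<integral>\<^sup>+ x. ennreal (g k x) \<partial>M) \<longlonglongrightarrow> 0"
  shows "(\<lambda>k. \<integral>\<^sup>+ x. ennreal (h k x) \<partial>M) \<longlonglongrightarrow> 0"
proof (rule tendsto_sandwich[where f = "\<lambda>_. 0"])
  show "\<forall>\<^sub>F k in sequentially. 0 \<le> (\<integral>\<^sup>+ x. ennreal (h k x) \<partial>M)" by simp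
  show "(\<lambda>_. 0::ennreal) \<longlonglongrightarrow> 0" by simp
  have "(\<integral>\<^sup>+ x. ennreal (h k x) \<partial>M)
      \<le> ennreal c * ((\<integral>\<^sup>+ x. ennreal (f k x) \<partial>M) + (\<integral>\<^sup>+ x. ennreal (g k x) \<partial>M))" for k
  proof -
    have "(\<integral>\<^sup>+ x. ennreal (h k x) \<partial>M) \<le> (\<integral>\<^sup>+ x. ennreal c * (ennreal (f k x) + ennreal (g k x)) \<partial>M)"
      using assms(3-6)
      by (intro nn_integral_mono) (simp add: ennreal_leI flip: ennreal_mult ennreal_plus)
    also have "\<dots> = ennreal c * ((\<integral>\<^sup>+ x. ennreal (f k x) \<partial>M) + (\<integral>\<^sup>+ x. ennreal (g k x) \<partial>M))"
      using assms(1,2) by (simp add: nn_integral_cmult nn_integral_add)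
    finally show ?thesis .
  qed
  then show "\<forall>\<^sub>F k in sequentially. (\<integral>\<^sup>+ x. ennreal (h k x) \<partial>M)
      \<le> ennreal c * ((\<integral>\<^sup>+ x. ennreal (f k x) \<partial>M) + (\<integral>\<^sup>+ x. ennreal (g k x) \<partial>M))"
    by simp
  have "(\<lambda>k. (\<integral>\<^sup>+ x. ennreal (f k x) \<partial>M) + (\<integral>\<^sup>+ x. ennreal (g k x) \<partial>M)) \<longlonglongrightarrow> 0 + 0"
    by (intro tendsto_add assms(7,8))
  from ennreal_tendsto_cmult[OF _ this, of "ennreal c"]
  show "(\<lambda>k. ennreal c * ((\<integral>\<^sup>+ x. ennreal (f k x) \<partial>M) + (\<integral>\<^sup>+ x. ennreal (g k x) \<partial>M))) \<longlonglongrightarrow> 0"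
    by simp
qed

text \<open>A nonnegative integral that tends to 0 is eventually finite. This is the passage from
  the limits in the definition of the spaces to Bochner integrals.\<close>

lemma eventually_integral_less:
  fixes f :: "nat \<Rightarrow> 'a \<Rightarrow> real"
  assumes "\<And>k. f k \<in> borel_measurable M" "\<And>k x. 0 \<le> f k x"
    and "(\<lambda>k. \<integral>\<^sup>+ x. ennreal (f k x) \<partial>M) \<longlonglongrightarrow> 0" and "0 < e"
  shows "\<forall>\<^sub>F k in sequentially. integrable M (f k) \<and> integral\<^sup>L M (f k) < e"
proof -
  have "\<forall>\<^sub>F k in sequentially. (\<integral>\<^sup>+ x. ennreal (f k x) \<partial>M) < ennreal e"
    using assms(3,4) by (intro order_tendstoD(2)) auto
  then show ?thesis
  proof (rule eventually_mono)
    fix k assume k: "(\<integral>\<^sup>+ x. ennreal (f k x) \<partial>M) < ennreal e"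
    have int: "integrable M (f k)"
      using k assms(1,2) by (intro integrableI_nonneg) (auto intro: less_trans)
    moreover have "ennreal (integral\<^sup>L M (f k)) < ennreal e"
      using k nn_integral_eq_integral[OF int] assms(2) by simp
    ultimately show "integrable M (f k) \<and> integral\<^sup>L M (f k) < e"
      using assms(2,4) by (simp add: ennreal_less_iff)
  qed
qed

lemma integral_lebesgue_on_superset:
  fixes f :: "'a::euclidean_space \<Rightarrow> real"
  assumes "S \<subseteq> T" "S \<in> sets lebesgue" "T \<in> sets lebesgue" "\<And>x. x \<in> T - S \<Longrightarrow> f x = 0"
  shows "integral\<^sup>L (lebesgue_on T) f = integral\<^sup>L (lebesgue_on S) f"
proof -
  have "integral\<^sup>L (lebesgue_on T) f = integral\<^sup>L (lebesgue_on T) (\<lambda>x. if x \<in> S then f x else 0)"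
    by (rule Bochner_Integration.integral_cong) (use assms(4) in auto)
  also have "\<dots> = integral\<^sup>L (lebesgue_on S) f"
    by (rule integral_restrict[OF assms(1-3)])
  finally show ?thesis .
qed

lemma open_half_space: "open (half_space :: 'n::finite spacetime set)"
  by (simp add: half_space_def open_Times)

lemma AE_lebesgue_on_subset:
  assumes "AE x in lebesgue_on T. P x" "S \<subseteq> T" "S \<in> sets lebesgue" "T \<in> sets lebesgue"
  shows "AE x in lebesgue_on S. P x"
proof -
  have "AE x in lebesgue. x \<in> T \<longrightarrow> P x"
    using assms(1,4) by (simp add: AE_restrict_space_iff)
  then have "AE x in lebesgue. x \<in> S \<longrightarrow> P x"
    by (rule eventually_mono) (use assms(2) in blast)
  then show ?thesis using assms(3) by (simp add: AE_restrict_space_iff)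
qed

lemma test_function_grad_eq_0:
  assumes "test_function \<phi>" "p \<in> half_space" "p \<notin> closure {p \<in> half_space. \<phi> p \<noteq> 0}"
  shows "grad \<phi> p = 0"
proof (rule grad_eq_0)
  show "open (half_space - closure {p \<in> half_space. \<phi> p \<noteq> 0})"
    by (intro open_Diff open_half_space) auto
  show "\<phi> x = 0" if "x \<in> half_space - closure {p \<in> half_space. \<phi> p \<noteq> 0}" for x
    using that subsetD[OF closure_subset[of "{p \<in> half_space. \<phi> p \<noteq> 0}"], of x] by auto
qed (use assms in auto)

section \<open>Approximating sequences\<close>

text \<open>Limits along approximants are all taken on one bounded open set D, where the completion
  supplies smooth sequences and the measure is finite; D is later a cylinder.\<close>

locale diffusion_domain =
  fixes a :: "'n::finite \<Rightarrow> 'n \<Rightarrow> 'n spacetime \<Rightarrow> real" and D :: "'n spacetime set" and q :: real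
  assumes a_measurable: "\<And>i j. a i j \<in> borel_measurable (lebesgue_on half_space)"
    and a_bounded: "\<And>i j. locally_bounded_on half_space (a i j)"
    and a_psd: "AE p in lebesgue_on half_space. psd_at a p"
    and open_D: "open D" and bounded_D: "bounded D" and D_half_space: "D \<subseteq> half_space"
    and q_gt_1: "1 < q"
begin

abbreviation M where "M \<equiv> lebesgue_on D"
abbreviation energy where "energy f p \<equiv> coeff_form a p (grad f p) (grad f p)"

lemma sets_D: "D \<in> sets lebesgue"
  using open_D by (simp add: borel_open sets_completionI_sets)

lemma sets_half_space: "(half_space :: 'n spacetime set) \<in> sets lebesgue"
  by (intro sets_completionI_sets) (simp add: borel_open open_half_space)

lemma finite_measure_M: "finite_measure M"
  by (rule finite_measure_lebesgue_on[OF lmeasurable_open[OF bounded_D open_D]])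

lemma measurable_on_D:
  "f \<in> borel_measurable (lebesgue_on half_space) \<Longrightarrow> f \<in> borel_measurable M"
  by (rule measurable_restrict_mono[OF _ D_half_space])

lemma AE_psd: "AE p in M. psd_at a p"
  by (rule AE_lebesgue_on_subset[OF a_psd D_half_space sets_D sets_half_space])

lemma continuous_measurable: "continuous_on D f \<Longrightarrow> f \<in> borel_measurable M"
  by (rule continuous_imp_measurable_on_sets_lebesgue[OF _ sets_D])

lemma form_measurable:
  assumes "Ck_on (Suc 0) D f" "Ck_on (Suc 0) D g"
  shows "(\<lambda>p. coeff_form a p (grad f p) (grad g p)) \<in> borel_measurable M"
proof -
  have "(\<lambda>p. grad h p $ i) \<in> borel_measurable M" if "Ck_on (Suc 0) D h" for h :: "'n spacetime \<Rightarrow> real" and i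
    by (rule continuous_measurable) (intro continuous_on_component continuous_on_grad[OF that])
  with assms show ?thesis
    unfolding coeff_form_def
    by (intro borel_measurable_sum borel_measurable_times measurable_on_D[OF a_measurable]) auto
qed

text \<open>Young's inequality with parameter 1 dominates the mixed form by the two
  energies.\<close>

lemma form_integrable:
  assumes "Ck_on (Suc 0) D f" "Ck_on (Suc 0) D g" "integrable M (energy f)" "integrable M (energy g)"
  shows "integrable M (\<lambda>p. coeff_form a p (grad f p) (grad g p))"
proof (rule Bochner_Integration.integrable_bound)
  show "integrable M (\<lambda>p. energy f p + energy g p)"
    by (intro Bochner_Integration.integrable_add assms)
  show "AE p in M. norm (coeff_form a p (grad f p) (grad g p)) \<le> norm (energy f p + energy g p)"
    using AE_psd
  proof (rule eventually_mono)
    fix p assume p: "psd_at a p"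
    show "norm (coeff_form a p (grad f p) (grad g p)) \<le> norm (energy f p + energy g p)"
      using coeff_form_young[OF p, of 1 "grad f p" "grad g p"] coeff_form_nonneg[OF p, of "grad f p"]
        coeff_form_nonneg[OF p, of "grad g p"] by simp
  qed
qed (rule form_measurable[OF assms(1,2)])

text \<open>Stands in for the triangle inequality of the energy seminorm; the factor 2 is harmless
  in Cauchy arguments.\<close>

lemma energy_diff:
  assumes "Ck_on (Suc 0) D f" "Ck_on (Suc 0) D g" "integrable M (energy f)" "integrable M (energy g)"
  shows "integrable M (energy (\<lambda>p. f p - g p))"
    and "integral\<^sup>L M (energy (\<lambda>p. f p - g p)) \<le> 2 * integral\<^sup>L M (energy f) + 2 * integral\<^sup>L M (energy g)"
proof -
  have i: "integrable M (\<lambda>p. 2 * energy f p + 2 * energy g p)"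
    by (intro Bochner_Integration.integrable_add integrable_mult_right assms)
  have ae: "AE p in M. 0 \<le> energy (\<lambda>p. f p - g p) p \<and>
      energy (\<lambda>p. f p - g p) p \<le> 2 * energy f p + 2 * energy g p"
  proof -
    have "AE p in M. p \<in> D" by (rule AE_I2) simp
    then show ?thesis using AE_psd
    proof eventually_elim
      case (elim p)
      show ?case
        using coeff_form_nonneg[OF elim(2)] coeff_form_diff_le[OF elim(2)]
        unfolding grad_diff[OF assms(1,2) elim(1)] by blast
    qed
  qed
  show i': "integrable M (energy (\<lambda>p. f p - g p))"
  proof (rule Bochner_Integration.integrable_bound[OF i])
    show "energy (\<lambda>p. f p - g p) \<in> borel_measurable M"
      by (intro form_measurable Ck_on_diff[OF open_D] assms)
    show "AE p in M. norm (energy (\<lambda>p. f p - g p) p) \<le> norm (2 * energy f p + 2 * energy g p)"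
      using ae by (rule eventually_mono) simp
  qed
  have "integral\<^sup>L M (energy (\<lambda>p. f p - g p)) \<le> integral\<^sup>L M (\<lambda>p. 2 * energy f p + 2 * energy g p)"
    by (rule integral_mono_AE[OF i' i]) (use ae in \<open>rule eventually_mono, simp\<close>)
  then show "integral\<^sup>L M (energy (\<lambda>p. f p - g p)) \<le> 2 * integral\<^sup>L M (energy f) + 2 * integral\<^sup>L M (energy g)"
    using assms by simp
qed

text \<open>The completion on D, unpacked. w, its time derivative and the flux pairings have genuine
  limits; for the energy only the Cauchy property is recorded, since gradients of the approximants
  need not converge to anything.\<close>

definition approximates ::
    "('n spacetime \<Rightarrow> real) \<Rightarrow> ('n spacetime \<Rightarrow> real) \<Rightarrow> ('n spacetime \<Rightarrow> real ^ 'n) \<Rightarrow>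
      (nat \<Rightarrow> 'n spacetime \<Rightarrow> real) \<Rightarrow> bool"
  where "approximates w wt F s \<longleftrightarrow>
    w \<in> borel_measurable M \<and> wt \<in> borel_measurable M \<and> F \<in> borel_measurable M \<and>
    (\<forall>k. smooth_on D (s k) \<and> integrable M (dt (s k)) \<and> integrable M (energy (s k)) \<and>
      integrable M (\<lambda>p. \<bar>s k p\<bar> powr q)) \<and>
    (\<forall>e>0. \<exists>N. \<forall>k\<ge>N. \<forall>m\<ge>N. integral\<^sup>L M (energy (\<lambda>p. s k p - s m p)) < e) \<and>
    (\<lambda>k. \<integral>\<^sup>+ p. ennreal (\<bar>s k p - w p\<bar> powr q) \<partial>M) \<longlonglongrightarrow> 0 \<and>
    (\<lambda>k. \<integral>\<^sup>+ p. ennreal \<bar>dt (s k) p - wt p\<bar> \<partial>M) \<longlonglongrightarrow> 0 \<and>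
    (\<forall>\<phi>. test_function \<phi> \<longrightarrow>
      (\<lambda>k. \<integral>\<^sup>+ p. ennreal \<bar>coeff_form a p (grad \<phi> p) (grad (s k) p) - grad \<phi> p \<bullet> F p\<bar> \<partial>M) \<longlonglongrightarrow> 0)"

lemma approximatesD:
  assumes "approximates w wt F s"
  shows "w \<in> borel_measurable M" "wt \<in> borel_measurable M" "F \<in> borel_measurable M"
    "\<And>k. smooth_on D (s k)" "\<And>k. integrable M (dt (s k))" "\<And>k. integrable M (energy (s k))"
    "\<And>k. integrable M (\<lambda>p. \<bar>s k p\<bar> powr q)"
    "\<And>e. 0 < e \<Longrightarrow> \<exists>N. \<forall>k\<ge>N. \<forall>m\<ge>N. integral\<^sup>L M (energy (\<lambda>p. s k p - s m p)) < e"
    "(\<lambda>k. \<integral>\<^sup>+ p. ennreal (\<bar>s k p - w p\<bar> powr q) \<partial>M) \<longlonglongrightarrow> 0"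
    "(\<lambda>k. \<integral>\<^sup>+ p. ennreal \<bar>dt (s k) p - wt p\<bar> \<partial>M) \<longlonglongrightarrow> 0"
    "\<And>\<phi>. test_function \<phi> \<Longrightarrow>
      (\<lambda>k. \<integral>\<^sup>+ p. ennreal \<bar>coeff_form a p (grad \<phi> p) (grad (s k) p) - grad \<phi> p \<bullet> F p\<bar> \<partial>M) \<longlonglongrightarrow> 0"
  using assms by (simp_all only: approximates_def)

lemma W_element_approximates:
  assumes "W_element a q D w wt F"
    and "w \<in> borel_measurable (lebesgue_on half_space)" "wt \<in> borel_measurable (lebesgue_on half_space)"
      "F \<in> borel_measurable (lebesgue_on half_space)"
  obtains s where "approximates w wt F s"
proof -
  have q: "max 1 q = q" using q_gt_1 by simp
  obtain s where s: "W_Cauchy a q D s"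
      "(\<lambda>k. \<integral>\<^sup>+ p. ennreal (\<bar>s k p - w p\<bar> powr q) \<partial>M) \<longlonglongrightarrow> 0"
      "(\<lambda>k. \<integral>\<^sup>+ p. ennreal \<bar>dt (s k) p - wt p\<bar> \<partial>M) \<longlonglongrightarrow> 0"
      "\<And>\<phi>. test_function \<phi> \<Longrightarrow>
      (\<lambda>k. \<integral>\<^sup>+ p. ennreal \<bar>coeff_form a p (grad \<phi> p) (grad (s k) p) - grad \<phi> p \<bullet> F p\<bar> \<partial>M) \<longlonglongrightarrow> 0"
    using assms(1) unfolding W_element_def q by blast
  have sm: "smooth_on D (s k)" and fin: "W_finite a q D (s k)" for k
    using s(1) unfolding W_Cauchy_def by blast+
  have en: "integrable M (energy (s k))" and pw: "integrable M (\<lambda>p. \<bar>s k p\<bar> powr q)"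
    and dta: "integrable M (\<lambda>p. \<bar>dt (s k) p\<bar>)" for k
    using fin[of k] unfolding W_finite_def q by blast+
  have "dt (s k) \<in> borel_measurable M" for k
    by (rule continuous_measurable[OF Ck_on_imp_continuous_on[OF Ck_on_dt[OF smooth_on_imp_Ck_on[OF sm]]]])
  then have dti: "integrable M (dt (s k))" for k
    using dta[of k] by (simp add: integrable_abs_iff)
  have cauchy: "\<exists>N. \<forall>k\<ge>N. \<forall>m\<ge>N. integral\<^sup>L M (energy (\<lambda>p. s k p - s m p)) < e" if "0 < e" for e
  proof -
    \<comment> \<open>The energy enters the norm under a square root, and the other two summands are
      nonnegative.\<close>
    have "0 < sqrt e" using that by simp
    then obtain N where N: "\<And>k m. N \<le> k \<Longrightarrow> N \<le> m \<Longrightarrow> W_norm a q D (\<lambda>p. s k p - s m p) < sqrt e"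
      using s(1) unfolding W_Cauchy_def by blast
    have "integral\<^sup>L M (energy (\<lambda>p. s k p - s m p)) < e" if "N \<le> k" "N \<le> m" for k m
    proof -
      have "0 \<le> integral\<^sup>L M (\<lambda>p. \<bar>dt (\<lambda>p. s k p - s m p) p\<bar>)" by simp
      moreover have "0 \<le> (integral\<^sup>L M (\<lambda>p. \<bar>s k p - s m p\<bar> powr max 1 q)) powr (1 / max 1 q)"
        by simp
      ultimately have "sqrt (integral\<^sup>L M (energy (\<lambda>p. s k p - s m p))) < sqrt e"
        using N[OF that] unfolding W_norm_def by linarith
      then show ?thesis by simp
    qed
    then show ?thesis by blast
  qed
  show thesis
    by (rule that[of s], unfold approximates_def)
      (intro conjI allI impI measurable_on_D assms(2-4) sm dti en pw cauchy s(2-4))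
qed

text \<open>Lets the difference u - v be treated as a single element of the space, with approximants
  and flux of its own.\<close>

lemma approximates_diff:
  assumes u: "approximates u ut Fu su" and v: "approximates v vt Fv sv"
  shows "approximates (\<lambda>p. u p - v p) (\<lambda>p. ut p - vt p) (\<lambda>p. Fu p - Fv p) (\<lambda>k p. su k p - sv k p)"
proof -
  note U = approximatesD[OF u] and V = approximatesD[OF v]
  have Cu: "Ck_on m D (su k)" and Cv: "Ck_on m D (sv k)" for k m
    using smooth_on_imp_Ck_on U(4) V(4) by blast+
  have cu: "su k \<in> borel_measurable M" "dt (su k) \<in> borel_measurable M"
    and cv: "sv k \<in> borel_measurable M" "dt (sv k) \<in> borel_measurable M" for k
    using continuous_measurable[OF Ck_on_imp_continuous_on[OF Cu[of 0]]]
      continuous_measurable[OF Ck_on_imp_continuous_on[OF Cv[of 0]]] U(5) V(5) by auto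
  note Dg = grad_diff[OF Cu[of 1, simplified One_nat_def] Cv[of 1, simplified One_nat_def]]
  show ?thesis
    unfolding approximates_def
  proof (intro conjI allI impI)
    show "(\<lambda>p. u p - v p) \<in> borel_measurable M" "(\<lambda>p. ut p - vt p) \<in> borel_measurable M"
      "(\<lambda>p. Fu p - Fv p) \<in> borel_measurable M"
      using U(1-3) V(1-3) by measurable
    fix k
    show "smooth_on D (\<lambda>p. su k p - sv k p)"
      unfolding smooth_on_def using Ck_on_diff[OF open_D Cu Cv] by blast
    have "integrable M (\<lambda>p. dt (su k) p - dt (sv k) p)"
      by (intro Bochner_Integration.integrable_diff U V)
    moreover have "dt (\<lambda>p. su k p - sv k p) p = dt (su k) p - dt (sv k) p" if "p \<in> space M" for p
      using that dt_diff[OF Cu Cv] by simp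
    ultimately show "integrable M (dt (\<lambda>p. su k p - sv k p))"
      by (subst Bochner_Integration.integrable_cong[OF refl]) auto
    show "integrable M (energy (\<lambda>p. su k p - sv k p))"
      by (rule energy_diff(1)[OF Cu Cv U(6) V(6)])
    show "integrable M (\<lambda>p. \<bar>su k p - sv k p\<bar> powr q)"
    proof (rule Bochner_Integration.integrable_bound)
      show "integrable M (\<lambda>p. 2 powr q * (\<bar>su k p\<bar> powr q + \<bar>sv k p\<bar> powr q))"
        by (intro integrable_mult_right Bochner_Integration.integrable_add U V)
      show "AE p in M. norm (\<bar>su k p - sv k p\<bar> powr q)
          \<le> norm (2 powr q * (\<bar>su k p\<bar> powr q + \<bar>sv k p\<bar> powr q))"
        using abs_add_powr_le[of q "su k _" "- sv k _"] q_gt_1 by (intro AE_I2) auto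
    qed (use cu cv in measurable)
  next
    fix e :: real assume e: "0 < e"
    \<comment> \<open>A quarter each, since \<open>energy_diff\<close> doubles both
      contributions.\<close>
    obtain N1 where N1: "\<And>k m. N1 \<le> k \<Longrightarrow> N1 \<le> m \<Longrightarrow> integral\<^sup>L M (energy (\<lambda>p. su k p - su m p)) < e/4"
      using U(8)[of "e/4"] e by auto
    obtain N2 where N2: "\<And>k m. N2 \<le> k \<Longrightarrow> N2 \<le> m \<Longrightarrow> integral\<^sup>L M (energy (\<lambda>p. sv k p - sv m p)) < e/4"
      using V(8)[of "e/4"] e by auto
    have "integral\<^sup>L M (energy (\<lambda>p. (su k p - sv k p) - (su m p - sv m p))) < e"
      if "max N1 N2 \<le> k" "max N1 N2 \<le> m" for k m
    proof -
      have "(\<lambda>p. (su k p - sv k p) - (su m p - sv m p)) = (\<lambda>p. (su k p - su m p) - (sv k p - sv m p))"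
        by (simp add: fun_eq_iff)
      moreover have "integral\<^sup>L M (energy (\<lambda>p. (su k p - su m p) - (sv k p - sv m p)))
          \<le> 2 * integral\<^sup>L M (energy (\<lambda>p. su k p - su m p)) + 2 * integral\<^sup>L M (energy (\<lambda>p. sv k p - sv m p))"
        by (rule energy_diff(2)[OF Ck_on_diff[OF open_D Cu Cu] Ck_on_diff[OF open_D Cv Cv]
              energy_diff(1)[OF Cu Cu U(6) U(6)] energy_diff(1)[OF Cv Cv V(6) V(6)]])
      ultimately show ?thesis using N1[of k m] N2[of k m] that by simp
    qed
    then show "\<exists>N. \<forall>k\<ge>N. \<forall>m\<ge>N. integral\<^sup>L M (energy (\<lambda>p. (su k p - sv k p) - (su m p - sv m p))) < e"
      by blast
  next
    show "(\<lambda>k. \<integral>\<^sup>+ p. ennreal (\<bar>su k p - sv k p - (u p - v p)\<bar> powr q) \<partial>M) \<longlonglongrightarrow> 0"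
    proof (rule nn_integral_dominated_tendsto_0[OF _ _ _ _ _ _ U(9) V(9), where c = "2 powr q"])
      fix k p
      have eq: "su k p - sv k p - (u p - v p) = (su k p - u p) + (v p - sv k p)" by simp
      show "\<bar>su k p - sv k p - (u p - v p)\<bar> powr q
          \<le> 2 powr q * (\<bar>su k p - u p\<bar> powr q + \<bar>sv k p - v p\<bar> powr q)"
        using abs_add_powr_le[of q "su k p - u p" "v p - sv k p"] q_gt_1
        unfolding eq abs_minus_commute[of "sv k p" "v p"] by simp
    qed (use cu cv U(1) V(1) in \<open>simp_all\<close>)
    show "(\<lambda>k. \<integral>\<^sup>+ p. ennreal \<bar>dt (\<lambda>p. su k p - sv k p) p - (ut p - vt p)\<bar> \<partial>M) \<longlonglongrightarrow> 0"
    proof (rule nn_integral_dominated_tendsto_0[OF _ _ _ _ _ _ U(10) V(10), where c = 1])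
      fix k p assume "p \<in> space M"
      then show "\<bar>dt (\<lambda>p. su k p - sv k p) p - (ut p - vt p)\<bar>
          \<le> 1 * (\<bar>dt (su k) p - ut p\<bar> + \<bar>dt (sv k) p - vt p\<bar>)"
        using dt_diff[OF Cu Cv, of p] by simp
    qed (use cu cv U(2) V(2) in \<open>simp_all\<close>)
  next
    fix \<phi> :: "'n spacetime \<Rightarrow> real" assume \<phi>: "test_function \<phi>"
    have C\<phi>: "Ck_on (Suc 0) D \<phi>"
      using \<phi> Ck_on_subset[OF _ D_half_space] by (simp add: test_function_def smooth_on_def)
    have g\<phi>: "grad \<phi> \<in> borel_measurable M"
      by (rule continuous_measurable[OF continuous_on_grad[OF C\<phi>]])
    show "(\<lambda>k. \<integral>\<^sup>+ p. ennreal \<bar>coeff_form a p (grad \<phi> p) (grad (\<lambda>p. su k p - sv k p) p)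
        - grad \<phi> p \<bullet> (Fu p - Fv p)\<bar> \<partial>M) \<longlonglongrightarrow> 0"
    proof (rule nn_integral_dominated_tendsto_0[OF _ _ _ _ _ _ U(11)[OF \<phi>] V(11)[OF \<phi>], where c = 1])
      fix k p assume "p \<in> space M"
      then show "\<bar>coeff_form a p (grad \<phi> p) (grad (\<lambda>p. su k p - sv k p) p) - grad \<phi> p \<bullet> (Fu p - Fv p)\<bar>
          \<le> 1 * (\<bar>coeff_form a p (grad \<phi> p) (grad (su k) p) - grad \<phi> p \<bullet> Fu p\<bar> +
               \<bar>coeff_form a p (grad \<phi> p) (grad (sv k) p) - grad \<phi> p \<bullet> Fv p\<bar>)"
        using grad_diff[OF Cu Cv, of p] by (simp add: coeff_form_simps inner_diff_right)
    qed (use g\<phi> form_measurable[OF C\<phi> Cu] form_measurable[OF C\<phi> Cv] U(3) V(3) in \<open>simp_all\<close>)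
  qed
qed

section \<open>Integrability on D and the weak inequality for the difference\<close>

lemma test_function_Ck_on: "test_function \<phi> \<Longrightarrow> Ck_on k D \<phi>"
  using Ck_on_subset[OF _ D_half_space] by (simp add: test_function_def smooth_on_def)

text \<open>On the compact support, continuity bounds \<phi> and its gradient and local boundedness
  bounds the coefficients; elsewhere in the half-space everything vanishes.\<close>

lemma test_function_bounded:
  assumes "test_function \<phi>"
  shows "\<exists>B. \<forall>p\<in>half_space. \<bar>\<phi> p\<bar> \<le> B \<and> \<bar>energy \<phi> p\<bar> \<le> B"
proof -
  let ?S = "closure {p \<in> half_space. \<phi> p \<noteq> 0}"
  have S: "compact ?S" "?S \<subseteq> half_space" and sm: "smooth_on half_space \<phi>"
    using assms by (simp_all add: test_function_def)
  have "continuous_on half_space \<phi>" "continuous_on half_space (grad \<phi>)"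
    using smooth_on_imp_Ck_on[OF sm] Ck_on_imp_continuous_on continuous_on_grad by blast+
  then have "bounded (\<phi> ` ?S)" "bounded (grad \<phi> ` ?S)"
    using S by (meson compact_imp_bounded compact_continuous_image continuous_on_subset)+
  then obtain B1 B2 where B1: "\<And>p. p \<in> ?S \<Longrightarrow> \<bar>\<phi> p\<bar> \<le> B1" and B2: "\<And>p. p \<in> ?S \<Longrightarrow> norm (grad \<phi> p) \<le> B2"
    unfolding bounded_iff by auto
  have ex: "\<exists>K. \<forall>p\<in>?S. \<bar>a i j p\<bar> \<le> K" for i j
  proof -
    have "bounded (a i j ` ?S)"
      using a_bounded[of i j] S unfolding locally_bounded_on_def by simp
    then show ?thesis by (simp add: bounded_iff)
  qed
  define K where "K i j = (SOME K. \<forall>p\<in>?S. \<bar>a i j p\<bar> \<le> K)" for i j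
  have K: "\<bar>a i j p\<bar> \<le> K i j" if "p \<in> ?S" for i j p
    using someI_ex[OF ex[of i j]] that unfolding K_def by simp
  let ?B3 = "\<Sum>i\<in>UNIV. \<Sum>j\<in>UNIV. K i j * B2 * B2"
  have e: "\<bar>energy \<phi> p\<bar> \<le> max 0 ?B3" if p: "p \<in> half_space" for p
  proof (cases "p \<in> ?S")
    case True
    have "\<bar>a i j p * grad \<phi> p $ i * grad \<phi> p $ j\<bar> \<le> K i j * B2 * B2" for i j
      unfolding abs_mult
      using K[OF True, of i j] order_trans[OF component_le_norm_cart B2[OF True]]
      by (intro mult_mono) (auto intro: order_trans[OF abs_ge_zero] mult_nonneg_nonneg)
    then have "\<bar>energy \<phi> p\<bar> \<le> ?B3"
      unfolding coeff_form_def by (intro order_trans[OF sum_abs] sum_mono)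
    then show ?thesis by simp
  next
    case False
    then show ?thesis using test_function_grad_eq_0[OF assms p] by (simp add: coeff_form_simps)
  qed
  have f: "\<bar>\<phi> p\<bar> \<le> max 0 B1" if p: "p \<in> half_space" for p
  proof (cases "p \<in> ?S")
    case True
    then show ?thesis using B1 by (simp add: le_max_iff_disj)
  next
    case False
    then have "\<phi> p = 0" using p subsetD[OF closure_subset[of "{p \<in> half_space. \<phi> p \<noteq> 0}"], of p] by auto
    then show ?thesis by simp
  qed
  show ?thesis
    by (rule exI[of _ "max (max 0 B1) (max 0 ?B3)"]) (use e f in \<open>simp add: le_max_iff_disj\<close>)
qed

lemma test_function_energy_integrable:
  assumes "test_function \<phi>"
  shows "integrable M (energy \<phi>)"
proof -
  obtain B where B: "\<forall>p\<in>half_space. \<bar>\<phi> p\<bar> \<le> B \<and> \<bar>energy \<phi> p\<bar> \<le> B"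
    using test_function_bounded[OF assms] ..
  interpret finite_measure M by (rule finite_measure_M)
  have C: "Ck_on (Suc 0) D \<phi>" by (rule test_function_Ck_on[OF assms])
  show ?thesis
    by (rule integrable_const_bound[of _ B, OF _ form_measurable[OF C C]], rule AE_I2)
      (use B D_half_space in auto)
qed

lemma integrable_mult_bounded:
  fixes f g :: "'n spacetime \<Rightarrow> real"
  assumes "integrable M f" "g \<in> borel_measurable M" "\<And>p. p \<in> D \<Longrightarrow> \<bar>g p\<bar> \<le> B"
  shows "integrable M (\<lambda>p. f p * g p)"
proof (rule Bochner_Integration.integrable_bound)
  show "integrable M (\<lambda>p. B * f p)" using assms(1) by simp
  show "AE p in M. norm (f p * g p) \<le> norm (B * f p)"
  proof (rule AE_I2)
    fix p assume "p \<in> space M"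
    then have "\<bar>g p\<bar> \<le> \<bar>B\<bar>" using assms(3)[of p] by simp
    then show "norm (f p * g p) \<le> norm (B * f p)"
      using mult_right_mono[of "\<bar>g p\<bar>" "\<bar>B\<bar>" "\<bar>f p\<bar>"] by (simp add: abs_mult mult.commute)
  qed
qed (use assms in measurable)

lemma approximates_eventually:
  assumes "approximates w wt F s" "0 < e"
  shows "\<forall>\<^sub>F k in sequentially. integrable M (\<lambda>p. \<bar>s k p - w p\<bar> powr q) \<and>
      (\<integral>p. \<bar>s k p - w p\<bar> powr q \<partial>M) < e"
    and "\<forall>\<^sub>F k in sequentially. integrable M (\<lambda>p. \<bar>dt (s k) p - wt p\<bar>) \<and>
      (\<integral>p. \<bar>dt (s k) p - wt p\<bar> \<partial>M) < e"
    and "test_function \<phi> \<Longrightarrow> \<forall>\<^sub>F k in sequentially.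
      integrable M (\<lambda>p. \<bar>coeff_form a p (grad \<phi> p) (grad (s k) p) - grad \<phi> p \<bullet> F p\<bar>) \<and>
      (\<integral>p. \<bar>coeff_form a p (grad \<phi> p) (grad (s k) p) - grad \<phi> p \<bullet> F p\<bar> \<partial>M) < e"
proof -
  note S = approximatesD[OF assms(1)]
  have C: "Ck_on m D (s k)" for k m
    using smooth_on_imp_Ck_on S(4) by blast
  have ms: "s k \<in> borel_measurable M" "dt (s k) \<in> borel_measurable M" for k
    using continuous_measurable[OF Ck_on_imp_continuous_on[OF C[of 0]]] S(5) by auto
  show "\<forall>\<^sub>F k in sequentially. integrable M (\<lambda>p. \<bar>s k p - w p\<bar> powr q) \<and>
      (\<integral>p. \<bar>s k p - w p\<bar> powr q \<partial>M) < e"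
    by (rule eventually_integral_less[OF _ _ S(9) assms(2)]) (use ms S(1) in simp_all)
  show "\<forall>\<^sub>F k in sequentially. integrable M (\<lambda>p. \<bar>dt (s k) p - wt p\<bar>) \<and>
      (\<integral>p. \<bar>dt (s k) p - wt p\<bar> \<partial>M) < e"
    by (rule eventually_integral_less[OF _ _ S(10) assms(2)]) (use ms S(2) in simp_all)
  assume \<phi>: "test_function \<phi>"
  have C\<phi>: "Ck_on (Suc 0) D \<phi>" by (rule test_function_Ck_on[OF \<phi>])
  have g\<phi>: "grad \<phi> \<in> borel_measurable M"
    by (rule continuous_measurable[OF continuous_on_grad[OF C\<phi>]])
  show "\<forall>\<^sub>F k in sequentially.
      integrable M (\<lambda>p. \<bar>coeff_form a p (grad \<phi> p) (grad (s k) p) - grad \<phi> p \<bullet> F p\<bar>) \<and>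
      (\<integral>p. \<bar>coeff_form a p (grad \<phi> p) (grad (s k) p) - grad \<phi> p \<bullet> F p\<bar> \<partial>M) < e"
    by (rule eventually_integral_less[OF _ _ S(11)[OF \<phi>] assms(2)])
      (use g\<phi> form_measurable[OF C\<phi> C] S(3) in simp_all)
qed

text \<open>One approximant at finite distance from the limit suffices, as it is integrable
  itself.\<close>

lemma approximates_integrable:
  assumes "approximates w wt F s"
  shows "integrable M (\<lambda>p. \<bar>w p\<bar> powr q)" and "integrable M wt"
    and "test_function \<phi> \<Longrightarrow> integrable M (\<lambda>p. grad \<phi> p \<bullet> F p)"
proof -
  note S = approximatesD[OF assms]
  have C: "Ck_on m D (s k)" for k m
    using smooth_on_imp_Ck_on S(4) by blast
  obtain k where k: "integrable M (\<lambda>p. \<bar>s k p - w p\<bar> powr q)"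
    using eventually_happens'[OF _ approximates_eventually(1)[OF assms zero_less_one]] by auto
  show "integrable M (\<lambda>p. \<bar>w p\<bar> powr q)"
  proof (rule Bochner_Integration.integrable_bound)
    show "integrable M (\<lambda>p. 2 powr q * (\<bar>s k p\<bar> powr q + \<bar>s k p - w p\<bar> powr q))"
      by (intro integrable_mult_right Bochner_Integration.integrable_add S k)
    have "\<bar>w p\<bar> powr q \<le> 2 powr q * (\<bar>s k p\<bar> powr q + \<bar>s k p - w p\<bar> powr q)" for p
      using abs_add_powr_le[of q "s k p" "w p - s k p"] q_gt_1 by (simp add: abs_minus_commute)
    then show "AE p in M. norm (\<bar>w p\<bar> powr q)
        \<le> norm (2 powr q * (\<bar>s k p\<bar> powr q + \<bar>s k p - w p\<bar> powr q))"
      by (intro AE_I2) simp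
  qed (use S(1) in measurable)
  obtain l where l: "integrable M (\<lambda>p. \<bar>dt (s l) p - wt p\<bar>)"
    using eventually_happens'[OF _ approximates_eventually(2)[OF assms zero_less_one]] by auto
  have "(\<lambda>p. dt (s l) p - wt p) \<in> borel_measurable M"
    using S(2) S(5)[of l] by measurable
  then have "integrable M (\<lambda>p. dt (s l) p - wt p)"
    using l by (simp add: integrable_abs_iff)
  from Bochner_Integration.integrable_diff[OF S(5)[of l] this] show "integrable M wt" by simp
  assume \<phi>: "test_function \<phi>"
  have C\<phi>: "Ck_on (Suc 0) D \<phi>" by (rule test_function_Ck_on[OF \<phi>])
  have g\<phi>: "grad \<phi> \<in> borel_measurable M"
    by (rule continuous_measurable[OF continuous_on_grad[OF C\<phi>]])
  obtain m where m: "integrable M (\<lambda>p. \<bar>coeff_form a p (grad \<phi> p) (grad (s m) p) - grad \<phi> p \<bullet> F p\<bar>)"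
    using eventually_happens'[OF _ approximates_eventually(3)[OF assms zero_less_one \<phi>]] by auto
  have "(\<lambda>p. coeff_form a p (grad \<phi> p) (grad (s m) p) - grad \<phi> p \<bullet> F p) \<in> borel_measurable M"
    using form_measurable[OF C\<phi> C] g\<phi> S(3) by measurable
  then have "integrable M (\<lambda>p. coeff_form a p (grad \<phi> p) (grad (s m) p) - grad \<phi> p \<bullet> F p)"
    using m by (simp add: integrable_abs_iff)
  from Bochner_Integration.integrable_diff[OF
      form_integrable[OF C\<phi> C test_function_energy_integrable[OF \<phi>] S(6)[of m]] this]
  show "integrable M (\<lambda>p. grad \<phi> p \<bullet> F p)" by simp
qed

text \<open>\<open>weak_form\<close> is one Bochner integral of a sum over the whole half-space.
  Splitting it is legitimate once each of the three terms is integrable; this is known on D, and off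
  K all of them vanish.\<close>

lemma weak_form_on_subdomain:
  assumes w: "approximates w wt F s" and \<phi>: "test_function \<phi>"
    and K: "compact K" "K \<subseteq> D" "\<And>p. p \<in> half_space - K \<Longrightarrow> \<phi> p = 0"
  shows "integrable M (\<lambda>p. wt p * \<phi> p)" "integrable M (\<lambda>p. \<bar>w p\<bar> powr (q - 1) * w p * \<phi> p)"
    and "weak_form q w wt F \<phi> = (\<integral>p. wt p * \<phi> p \<partial>M) + (\<integral>p. grad \<phi> p \<bullet> F p \<partial>M)
      - (\<integral>p. \<bar>w p\<bar> powr (q - 1) * w p * \<phi> p \<partial>M)"
proof -
  note S = approximatesD[OF w]
  have m\<phi>: "\<phi> \<in> borel_measurable M"
    by (rule continuous_measurable[OF Ck_on_imp_continuous_on[OF test_function_Ck_on[OF \<phi>, of 0]]])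
  obtain B where "\<forall>p\<in>half_space. \<bar>\<phi> p\<bar> \<le> B \<and> \<bar>energy \<phi> p\<bar> \<le> B"
    using test_function_bounded[OF \<phi>] ..
  then have B: "\<bar>\<phi> p\<bar> \<le> B" if "p \<in> D" for p using that D_half_space by auto
  show i1: "integrable M (\<lambda>p. wt p * \<phi> p)"
    by (rule integrable_mult_bounded[OF approximates_integrable(2)[OF w] m\<phi> B])
  have "integrable M (\<lambda>p. \<bar>w p\<bar> powr (q - 1) * w p)"
  proof (rule Bochner_Integration.integrable_bound[OF approximates_integrable(1)[OF w]])
    have "\<bar>w p\<bar> powr (q - 1) * \<bar>w p\<bar> = \<bar>w p\<bar> powr q" for p
      using powr_mult_base[of "\<bar>w p\<bar>" "q - 1"] by (simp add: mult.commute)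
    then show "AE p in M. norm (\<bar>w p\<bar> powr (q - 1) * w p) \<le> norm (\<bar>w p\<bar> powr q)"
      by (intro AE_I2) (simp add: abs_mult)
  qed (use S(1) in measurable)
  then show i2: "integrable M (\<lambda>p. \<bar>w p\<bar> powr (q - 1) * w p * \<phi> p)"
    by (rule integrable_mult_bounded[OF _ m\<phi> B])
  note i3 = approximates_integrable(3)[OF w \<phi>]
  have "closed K" using K(1) by (rule compact_imp_closed)
  then have "open (half_space - K)" using open_half_space by blast
  then have g0: "grad \<phi> p = 0" if "p \<in> half_space - K" for p
    using grad_eq_0 that K(3) by blast
  have "weak_form q w wt F \<phi>
      = (\<integral>p. wt p * \<phi> p + grad \<phi> p \<bullet> F p - \<bar>w p\<bar> powr (q - 1) * w p * \<phi> p \<partial>M)"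
    unfolding weak_form_def
  proof (rule integral_lebesgue_on_superset[OF D_half_space sets_D sets_half_space])
    fix p assume "p \<in> half_space - D"
    then have "p \<in> half_space - K" using K(2) by blast
    then show "wt p * \<phi> p + grad \<phi> p \<bullet> F p - \<bar>w p\<bar> powr (q - 1) * w p * \<phi> p = 0"
      using g0 K(3) by simp
  qed
  then show "weak_form q w wt F \<phi> = (\<integral>p. wt p * \<phi> p \<partial>M) + (\<integral>p. grad \<phi> p \<bullet> F p \<partial>M)
      - (\<integral>p. \<bar>w p\<bar> powr (q - 1) * w p * \<phi> p \<partial>M)"
    using i1 i2 i3 by simp
qed

text \<open>Subtract the two weak inequalities for the same \<phi> and bound the difference of the
  nonlinear terms from below where v <= u, via \<open>signed_powr_diff_ge\<close>.\<close>

lemma weak_difference_inequality: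
  assumes u: "approximates u ut Fu su" and v: "approximates v vt Fv sv"
    and "0 \<le> weak_form q u ut Fu \<phi>" "weak_form q v vt Fv \<phi> \<le> 0"
    and le: "AE p in M. v p \<le> u p"
    and \<phi>: "test_function \<phi>" "\<And>p. p \<in> half_space \<Longrightarrow> 0 \<le> \<phi> p"
    and K: "compact K" "K \<subseteq> D" "\<And>p. p \<in> half_space - K \<Longrightarrow> \<phi> p = 0"
  shows "2 powr (- q) * (\<integral>p. \<bar>u p - v p\<bar> powr q * \<phi> p \<partial>M)
    \<le> (\<integral>p. (ut p - vt p) * \<phi> p \<partial>M) + (\<integral>p. grad \<phi> p \<bullet> (Fu p - Fv p) \<partial>M)"
proof -
  note wu = weak_form_on_subdomain[OF u \<phi>(1) K] and wv = weak_form_on_subdomain[OF v \<phi>(1) K]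
  note fu = approximates_integrable(3)[OF u \<phi>(1)] and fv = approximates_integrable(3)[OF v \<phi>(1)]
  have m\<phi>: "\<phi> \<in> borel_measurable M"
    by (rule continuous_measurable[OF Ck_on_imp_continuous_on[OF test_function_Ck_on[OF \<phi>(1), of 0]]])
  obtain B where "\<forall>p\<in>half_space. \<bar>\<phi> p\<bar> \<le> B \<and> \<bar>energy \<phi> p\<bar> \<le> B"
    using test_function_bounded[OF \<phi>(1)] ..
  then have B: "\<bar>\<phi> p\<bar> \<le> B" if "p \<in> D" for p using that D_half_space by auto
  have iw: "integrable M (\<lambda>p. \<bar>u p - v p\<bar> powr q * \<phi> p)"
    by (rule integrable_mult_bounded[OF approximates_integrable(1)[OF approximates_diff[OF u v]] m\<phi> B])
  have "(\<integral>p. 2 powr (- q) * (\<bar>u p - v p\<bar> powr q * \<phi> p) \<partial>M)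
      \<le> (\<integral>p. \<bar>u p\<bar> powr (q - 1) * u p * \<phi> p - \<bar>v p\<bar> powr (q - 1) * v p * \<phi> p \<partial>M)"
  proof (rule integral_mono_AE)
    have "AE p in M. p \<in> D" by (rule AE_I2) simp
    with le show "AE p in M. 2 powr (- q) * (\<bar>u p - v p\<bar> powr q * \<phi> p)
        \<le> \<bar>u p\<bar> powr (q - 1) * u p * \<phi> p - \<bar>v p\<bar> powr (q - 1) * v p * \<phi> p"
    proof eventually_elim
      case (elim p)
      then have "0 \<le> \<phi> p" using \<phi>(2) D_half_space by blast
      from mult_right_mono[OF signed_powr_diff_ge[OF elim(1) q_gt_1] this] elim(1)
      show ?case by (simp add: algebra_simps)
    qed
  qed (use iw wu(2) wv(2) in simp_all)
  also have "\<dots> = (\<integral>p. \<bar>u p\<bar> powr (q - 1) * u p * \<phi> p \<partial>M) - (\<integral>p. \<bar>v p\<bar> powr (q - 1) * v p * \<phi> p \<partial>M)"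
    using wu(2) wv(2) by simp
  also have "\<dots> \<le> ((\<integral>p. ut p * \<phi> p \<partial>M) + (\<integral>p. grad \<phi> p \<bullet> Fu p \<partial>M))
      - ((\<integral>p. vt p * \<phi> p \<partial>M) + (\<integral>p. grad \<phi> p \<bullet> Fv p \<partial>M))"
    using assms(3,4) wu(3) wv(3) by simp
  also have "\<dots> = (\<integral>p. (ut p - vt p) * \<phi> p \<partial>M) + (\<integral>p. grad \<phi> p \<bullet> (Fu p - Fv p) \<partial>M)"
    using wu(1) wv(1) fu fv by (simp add: left_diff_distrib inner_diff_right)
  finally show ?thesis by simp
qed

end

section \<open>Testing with functions of the solution\<close>

text \<open>D and the complement of K are open and cover the space, and the extension is regular on
  each. Approximants are smooth only on D, so every product with a cutoff passes through this
  lemma.\<close>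

lemma smooth_extension_by_zero:
  fixes f :: "'a::real_normed_vector \<Rightarrow> real"
  assumes "open D" "closed K" "K \<subseteq> D" "Ck_on k D f" "\<And>p. p \<in> D - K \<Longrightarrow> f p = 0"
  shows "Ck_on k UNIV (\<lambda>p. if p \<in> D then f p else 0)"
proof -
  let ?f = "\<lambda>p. if p \<in> D then f p else 0"
  have "Ck_on k D ?f"
    by (rule Ck_on_cong[OF assms(1) _ assms(4)]) simp
  moreover have "Ck_on k (- K) ?f"
    by (rule Ck_on_cong[OF _ _ Ck_on_const[where c = 0]]) (use assms(2,5) in auto)
  moreover have "D \<union> - K = UNIV" using assms(3) by auto
  ultimately show ?thesis
    using Ck_on_Un[of D "- K" k ?f] assms(1,2) by (simp add: open_Compl)
qed

text \<open>The fundamental theorem on each line parallel to the time axis, followed by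
  Fubini.\<close>

lemma integral_dt_compact_support:
  fixes f :: "'n::finite spacetime \<Rightarrow> real"
  assumes "Ck_on (Suc 0) UNIV f" "compact K" "\<And>p. p \<notin> K \<Longrightarrow> f p = 0"
  shows "integral\<^sup>L lborel (dt f) = 0"
proof -
  have cont: "continuous_on UNIV (dt f)"
    by (rule Ck_on_imp_continuous_on[OF Ck_on_dt[OF assms(1)]])
  have "open (- K)" using assms(2) by (simp add: compact_imp_closed open_Compl)
  then have dt0: "dt f p = 0" if "p \<notin> K" for p
    by (rule dt_eq_0) (use that assms(3) in auto)
  have "(\<lambda>p. indicator K p *\<^sub>R dt f p) = dt f"
    using dt0 by (auto simp: indicator_def fun_eq_iff)
  then have int: "integrable lborel (dt f)"
    using borel_integrable_compact[OF assms(2) continuous_on_subset[OF cont]] by simp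
  have "bounded (fst ` K)"
    by (intro compact_imp_bounded compact_continuous_image assms(2) continuous_intros)
  then obtain T where T: "\<And>p. p \<in> K \<Longrightarrow> \<bar>fst p\<bar> \<le> T" "0 < T"
    unfolding bounded_pos real_norm_def by blast
  have inner: "(\<integral>t. dt f (t, x) \<partial>lborel) = 0" for x
  proof -
    \<comment> \<open>Times in K have modulus at most T, so both boundary values at T + 1 and -T - 1
      vanish.\<close>
    let ?F = "\<lambda>t. f (t, x)" and ?b = "T + 1"
    have out: "(t, x) \<notin> K" if "t \<notin> {- T .. T}" for t
      using T(1)[of "(t, x)"] that by (auto simp: abs_le_iff)
    have "(\<integral>t. dt f (t, x) * indicator {- ?b .. ?b} t \<partial>lborel) = ?F ?b - ?F (- ?b)"
    proof (rule integral_FTC_Icc_real)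
      fix t
      have lin: "linear (frechet_derivative f (at (t, x)))"
        using Ck_on_Suc_has_derivative[OF assms(1), of "(t, x)"] has_derivative_linear by blast
      have "((\<lambda>t. (t, x)) has_derivative (\<lambda>h. (h, 0))) (at t)"
        by (auto intro!: derivative_eq_intros)
      from has_derivative_compose[OF this Ck_on_Suc_has_derivative[OF assms(1)]]
      have "(?F has_derivative (\<lambda>h. frechet_derivative f (at (t, x)) (h, 0))) (at t)" by simp
      moreover have "frechet_derivative f (at (t, x)) (h, 0) = dt f (t, x) * h" for h
        using linear_scale[OF lin, of h "(1, 0)"] by (simp add: dt_def scaleR_Pair mult.commute)
      ultimately show "(?F has_real_derivative dt f (t, x)) (at t)"
        by (simp add: has_field_derivative_def)
      have "isCont (dt f) (t, x)" using cont by (simp add: continuous_on_eq_continuous_at)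
      then show "isCont (\<lambda>t. dt f (t, x)) t"
        by (intro isCont_o2[where g = "dt f" and f = "\<lambda>t. (t, x)"] continuous_intros)
    qed (use T in simp)
    also have "?F ?b - ?F (- ?b) = 0"
      using assms(3)[OF out, of ?b] assms(3)[OF out, of "- ?b"] T(2) by simp
    also have "(\<lambda>t. dt f (t, x) * indicator {- ?b .. ?b} t) = (\<lambda>t. dt f (t, x))"
    proof
      fix t
      show "dt f (t, x) * indicator {- ?b .. ?b} t = dt f (t, x)"
      proof (cases "t \<in> {- T .. T}")
        case False
        then show ?thesis using dt0[OF out] by simp
      qed (simp add: indicator_def)
    qed
    finally show ?thesis .
  qed
  have "integrable (lborel \<Otimes>\<^sub>M lborel) (case_prod (\<lambda>t x. dt f (t, x)))"
    using int by (simp add: lborel_prod)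
  from lborel_pair.integral_snd[OF this] inner
  show ?thesis by (simp add: lborel_prod)
qed

lemma lipschitz_of_derivative_bound:
  fixes G g :: "real \<Rightarrow> real"
  assumes "\<And>y. (G has_real_derivative g y) (at y)" "\<And>y. \<bar>g y\<bar> \<le> B"
  shows "\<bar>G x - G y\<bar> \<le> B * \<bar>x - y\<bar>"
proof -
  have "norm (G x - G y) \<le> B * norm (x - y)"
    by (rule field_differentiable_bound[where S = UNIV and f' = g])
      (use assms in \<open>auto intro: has_field_derivative_at_within\<close>)
  then show ?thesis by simp
qed

text \<open>The unscaled situation. The bound on the energy of \<zeta> by b \<zeta> is what allows
  the gradient of the cutoff to be absorbed. The growth condition on 1 / |g'| has exponent q here
  because it only serves integrability; the sharper exponent p enters after scaling.\<close>

locale test_setting = diffusion_domain a D q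
  for a :: "'n::finite \<Rightarrow> 'n \<Rightarrow> 'n spacetime \<Rightarrow> real" and D :: "'n spacetime set" and q :: real +
  fixes w wt :: "'n spacetime \<Rightarrow> real" and F :: "'n spacetime \<Rightarrow> real ^ 'n"
    and s :: "nat \<Rightarrow> 'n spacetime \<Rightarrow> real" and \<zeta> b :: "'n spacetime \<Rightarrow> real"
    and K :: "'n spacetime set" and g g' G :: "real \<Rightarrow> real" and B C :: real
  assumes approx: "approximates w wt F s"
    and \<zeta>_smooth: "\<And>k. Ck_on k UNIV \<zeta>" and \<zeta>_nonneg: "\<And>p. 0 \<le> \<zeta> p"
    and K: "compact K" "K \<subseteq> D" "\<And>p. p \<notin> K \<Longrightarrow> \<zeta> p = 0"
    and b_measurable: "b \<in> borel_measurable M" and b_bounds: "\<And>p. 0 \<le> b p" "\<And>p. b p \<le> B"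
    and energy_\<zeta>: "AE p in M. energy \<zeta> p \<le> b p * \<zeta> p"
    and g_smooth: "\<And>k. Ck_on k UNIV g" and g_deriv: "\<And>y. (g has_real_derivative g' y) (at y)"
    and G_deriv: "\<And>y. (G has_real_derivative g y) (at y)" and G_0: "G 0 = 0"
    and g_bounds: "\<And>y. 1 \<le> g y" "\<And>y. g y \<le> 2"
    and g'_neg: "\<And>y. g' y < 0" and g'_bound: "\<And>y. \<bar>g' y\<bar> \<le> C"
    and g'_lower: "\<And>y. 1 / \<bar>g' y\<bar> \<le> C * (1 + \<bar>y\<bar> powr q)"
    and g'_continuous: "continuous_on UNIV g'"
begin

lemmas S = approximatesD[OF approx]

lemma s_Ck: "Ck_on m D (s k)"
  by (rule smooth_on_imp_Ck_on[OF S(4)])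

lemma s_continuous: "continuous_on D (s k)"
  by (rule Ck_on_imp_continuous_on[OF s_Ck[of 0]])

lemma compose_s_measurable:
  assumes "continuous_on UNIV h"
  shows "(\<lambda>p. h (s k p)) \<in> borel_measurable M"
  by (rule continuous_measurable[OF continuous_on_compose2[OF assms s_continuous]]) simp

lemma closed_K: "closed K"
  by (rule compact_imp_closed[OF K(1)])

text \<open>Set to 0 outside D, where nothing is known about \<open>s k\<close>.\<close>

definition \<phi> :: "nat \<Rightarrow> 'n spacetime \<Rightarrow> real"
  where "\<phi> k p = (if p \<in> D then g (s k p) * \<zeta> p else 0)"

lemma \<phi>_nonneg: "0 \<le> \<phi> k p"
  using g_bounds(1)[of "s k p"] \<zeta>_nonneg[of p] by (simp add: \<phi>_def)

lemma \<phi>_eq_0: "p \<notin> K \<Longrightarrow> \<phi> k p = 0"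
  using K(3) by (simp add: \<phi>_def)

lemma test_functionI:
  assumes "\<And>k. Ck_on k UNIV f" "\<And>p. p \<notin> K \<Longrightarrow> f p = 0"
  shows "test_function f"
proof -
  have sub: "closure {p \<in> half_space. f p \<noteq> 0} \<subseteq> K"
    by (rule closure_minimal[OF _ closed_K]) (use assms(2) in auto)
  have "bounded (closure {p \<in> half_space. f p \<noteq> 0})"
    by (rule bounded_subset[OF compact_imp_bounded[OF K(1)] sub])
  then have "compact (closure {p \<in> half_space. f p \<noteq> 0})"
    by (simp add: compact_eq_bounded_closed)
  moreover have "smooth_on half_space f"
    unfolding smooth_on_def using Ck_on_subset[OF assms(1)] by simp
  ultimately show ?thesis
    using sub K(2) D_half_space by (auto simp: test_function_def)
qed

lemma \<phi>_test: "test_function (\<phi> k)"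
proof (rule test_functionI)
  show "Ck_on m UNIV (\<phi> k)" for m
    unfolding \<phi>_def[abs_def]
  proof (rule smooth_extension_by_zero[OF open_D closed_K K(2)])
    show "Ck_on m D (\<lambda>p. g (s k p) * \<zeta> p)"
      by (rule Ck_on_mult[OF open_D Ck_on_compose[OF open_D open_UNIV UNIV_I s_Ck g_smooth]
            Ck_on_subset[OF \<zeta>_smooth subset_UNIV]])
  qed (use K(3) in simp)
qed (rule \<phi>_eq_0)

lemma \<zeta>_test: "test_function \<zeta>"
  by (rule test_functionI[OF \<zeta>_smooth K(3)])

lemma \<zeta>_bounded:   "\<exists>Z>0. \<forall>p. \<zeta> p \<le> Z \<and> \<bar>dt \<zeta> p\<bar> \<le> Z"
proof -
  have c: "continuous_on UNIV \<zeta>" "continuous_on UNIV (dt \<zeta>)"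
    using Ck_on_imp_continuous_on[OF \<zeta>_smooth[of 0]]
      Ck_on_imp_continuous_on[OF Ck_on_dt[OF \<zeta>_smooth[of "Suc 0"]]] by blast+
  have "bounded (\<zeta> ` K)" "bounded (dt \<zeta> ` K)"
    by (intro compact_imp_bounded compact_continuous_image[OF continuous_on_subset[OF c(1) subset_UNIV] K(1)]
        compact_continuous_image[OF continuous_on_subset[OF c(2) subset_UNIV] K(1)])+
  then obtain Z1 Z2 where Z: "\<forall>p\<in>K. \<bar>\<zeta> p\<bar> \<le> Z1" "\<forall>p\<in>K. \<bar>dt \<zeta> p\<bar> \<le> Z2"
    unfolding bounded_iff by auto
  have d0: "dt \<zeta> p = 0" if "p \<notin> K" for p
    by (rule dt_eq_0[of "- K"]) (use that closed_K K(3) in auto)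
  let ?Z = "max 1 (max Z1 Z2)"
  have "\<zeta> p \<le> ?Z \<and> \<bar>dt \<zeta> p\<bar> \<le> ?Z" for p
  proof (cases "p \<in> K")
    case True
    then have "\<bar>\<zeta> p\<bar> \<le> Z1" "\<bar>dt \<zeta> p\<bar> \<le> Z2" using Z by blast+
    then show ?thesis by linarith
  qed (simp add: K(3) d0 le_max_iff_disj)
  then show ?thesis by (intro exI[of _ ?Z]) simp
qed

text \<open>Stated for general \<sigma> because it is applied to g, for the gradient of the test
  function, and to G, for the time term.\<close>

lemma
  assumes "p \<in> D" "(\<sigma> has_real_derivative \<sigma>') (at (s k p))"
  shows grad_compose: "grad (\<lambda>p. if p \<in> D then \<sigma> (s k p) * \<zeta> p else 0) p =
      (\<sigma>' * \<zeta> p) *\<^sub>R grad (s k) p + \<sigma> (s k p) *\<^sub>R grad \<zeta> p" (is "grad ?f p = _")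
    and dt_compose: "dt (\<lambda>p. if p \<in> D then \<sigma> (s k p) * \<zeta> p else 0) p =
      \<sigma>' * \<zeta> p * dt (s k) p + \<sigma> (s k p) * dt \<zeta> p"
proof -
  let ?s' = "frechet_derivative (s k) (at p)" and ?z' = "frechet_derivative \<zeta> (at p)"
  have ds: "(s k has_derivative ?s') (at p)"
    by (rule Ck_on_Suc_has_derivative[OF s_Ck[of "Suc 0"] assms(1)])
  have dz: "(\<zeta> has_derivative ?z') (at p)"
    by (rule Ck_on_Suc_has_derivative[OF \<zeta>_smooth[of "Suc 0"] UNIV_I])
  have "((\<lambda>x. \<sigma> (s k x)) has_derivative (\<lambda>h. \<sigma>' * ?s' h)) (at p)"
    by (rule has_derivative_compose[OF ds assms(2)[unfolded has_field_derivative_def]])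
  from has_derivative_mult[OF this dz]
  have "((\<lambda>x. \<sigma> (s k x) * \<zeta> x) has_derivative (\<lambda>h. \<sigma> (s k p) * ?z' h + \<sigma>' * ?s' h * \<zeta> p)) (at p)" .
  then have "(?f has_derivative (\<lambda>h. \<sigma> (s k p) * ?z' h + \<sigma>' * ?s' h * \<zeta> p)) (at p)"
    by (rule has_derivative_transform_within_open[OF _ open_D assms(1)]) simp
  from grad_eqI[OF this]
  show "grad ?f p = (\<sigma>' * \<zeta> p) *\<^sub>R grad (s k) p + \<sigma> (s k p) *\<^sub>R grad \<zeta> p"
    and "dt ?f p = \<sigma>' * \<zeta> p * dt (s k) p + \<sigma> (s k p) * dt \<zeta> p"
    by (simp_all add: grad_def dt_def vec_eq_iff)
qed

lemma \<phi>_grad: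
  "p \<in> D \<Longrightarrow> grad (\<phi> k) p = (g' (s k p) * \<zeta> p) *\<^sub>R grad (s k) p + g (s k p) *\<^sub>R grad \<zeta> p"
  unfolding \<phi>_def[abs_def] by (rule grad_compose[OF _ g_deriv])

lemma \<phi>_measurable: "\<phi> k \<in> borel_measurable M"
  by (rule continuous_measurable[OF Ck_on_imp_continuous_on[OF test_function_Ck_on[OF \<phi>_test, of 0]]])

lemma \<zeta>_measurable: "\<zeta> \<in> borel_measurable M" "dt \<zeta> \<in> borel_measurable M"
  by (intro continuous_measurable Ck_on_imp_continuous_on[of 0] Ck_on_dt test_function_Ck_on[OF \<zeta>_test])+

lemma \<phi>_le:
  assumes "\<zeta> p \<le> Z"
  shows "\<phi> k p \<le> 2 * Z"
proof -
  have "g (s k p) * \<zeta> p \<le> 2 * Z"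
    using \<zeta>_nonneg[of p] by (intro mult_mono g_bounds(2) assms) auto
  moreover have "0 \<le> 2 * Z" using \<zeta>_nonneg[of p] assms by linarith
  ultimately show ?thesis by (simp add: \<phi>_def)
qed

section \<open>Passage to the limit in the time, flux and elliptic terms\<close>

lemma L1_bound:
  assumes "f \<in> borel_measurable M" "integrable M (\<lambda>p. \<bar>f p\<bar> powr q)"
  shows "integrable M f"
proof (rule Bochner_Integration.integrable_bound)
  interpret finite_measure M by (rule finite_measure_M)
  show "integrable M (\<lambda>p. 1 + \<bar>f p\<bar> powr q)" using assms(2) by simp
  have "y \<le> 1 + y powr q" if "0 \<le> y" for y :: real
  proof (cases "y \<le> 1")
    case False
    then show ?thesis using powr_mono[of 1 q y] q_gt_1 by simp
  qed (simp add: add_increasing2)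
  then show "AE p in M. norm (f p) \<le> norm (1 + \<bar>f p\<bar> powr q)"
    by (intro AE_I2) (simp add: add_nonneg_nonneg)
qed (rule assms(1))

lemma s_measurable: "s k \<in> borel_measurable M"
  by (rule continuous_measurable[OF s_continuous])

lemma s_integrable: "integrable M (s k)" and w_integrable: "integrable M w"
  by (rule L1_bound[OF s_measurable S(7)], rule L1_bound[OF S(1) approximates_integrable(1)[OF approx]])

text \<open>D has finite measure. L^q smallness becomes L^1 smallness through the pointwise bound y
  <= h^(1-q) y^q + h, whose second term costs h V.\<close>

lemma eventually_L1:
  assumes "0 < e"
  shows "\<forall>\<^sub>F k in sequentially. (\<integral>p. \<bar>s k p - w p\<bar> \<partial>M) < e"
proof -
  interpret finite_measure M by (rule finite_measure_M)
  define V where "V = measure M (space M)"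
  \<comment> \<open>Makes h V < e / 2; V + 1 avoids division by zero. The L^q threshold e / 2 *
    h^(q-1) then yields the other half.\<close>
  define h where "h = e / (2 * (V + 1))"
  have V: "0 \<le> V" by (simp add: V_def)
  then have h: "0 < h" "h * V < e / 2"
    using assms by (auto simp: h_def field_simps)
  have "0 < e / 2 * h powr (q - 1)" using assms h by simp
  from approximates_eventually(1)[OF approx this]
  show ?thesis
  proof (rule eventually_mono)
    fix k assume k: "integrable M (\<lambda>p. \<bar>s k p - w p\<bar> powr q) \<and>
      (\<integral>p. \<bar>s k p - w p\<bar> powr q \<partial>M) < e / 2 * h powr (q - 1)"
    have pt: "y \<le> h powr (1 - q) * y powr q + h" if "0 \<le> y" for y
    proof (cases "y \<le> h")
      case False
      then have "h powr (q - 1) \<le> y powr (q - 1)" using h q_gt_1 by (intro powr_mono2) auto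
      then have "y * h powr (q - 1) \<le> y powr q"
        using that powr_mult_base[of y "q - 1"] mult_left_mono[of "h powr (q - 1)" "y powr (q - 1)" y]
        by simp
      then have "y \<le> y powr q / h powr (q - 1)" using h by (simp add: pos_le_divide_eq)
      also have "\<dots> = h powr (1 - q) * y powr q"
        using powr_minus_divide[of h "q - 1"] by simp
      finally show ?thesis using h by simp
    qed (simp add: add_increasing)
    have "(\<integral>p. \<bar>s k p - w p\<bar> \<partial>M) \<le> (\<integral>p. h powr (1 - q) * \<bar>s k p - w p\<bar> powr q + h \<partial>M)"
      by (rule integral_mono) (use k pt s_integrable w_integrable in auto)
    also have "\<dots> = h powr (1 - q) * (\<integral>p. \<bar>s k p - w p\<bar> powr q \<partial>M) + h * V"
      using k by (simp add: V_def mult.commute)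
    also have "h powr (1 - q) * (\<integral>p. \<bar>s k p - w p\<bar> powr q \<partial>M)
        \<le> h powr (1 - q) * (e / 2 * h powr (q - 1))"
      using k by (intro mult_left_mono) auto
    also have "\<dots> = e / 2" using h powr_add[of h "1 - q" "q - 1"] by simp
    finally show "(\<integral>p. \<bar>s k p - w p\<bar> \<partial>M) < e" using h(2) by linarith
  qed
qed

lemma G_lipschitz: "\<bar>G x - G y\<bar> \<le> 2 * \<bar>x - y\<bar>"
proof (rule lipschitz_of_derivative_bound[OF G_deriv])
  show "\<bar>g y\<bar> \<le> 2" for y using g_bounds[of y] by simp
qed

lemma G_continuous: "continuous_on UNIV G"
  using G_deriv DERIV_isCont by (blast intro: continuous_at_imp_continuous_on)

lemma G_integrable:
  assumes "integrable M f"
  shows "integrable M (\<lambda>p. G (f p) * dt \<zeta> p)"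
proof -
  obtain Z where Z: "\<And>p. \<bar>dt \<zeta> p\<bar> \<le> Z" using \<zeta>_bounded by blast
  have "integrable M (\<lambda>p. G (f p))"
  proof (rule Bochner_Integration.integrable_bound)
    show "integrable M (\<lambda>p. 2 * f p)" using assms by simp
    show "(\<lambda>p. G (f p)) \<in> borel_measurable M"
      by (rule measurable_compose[OF borel_measurable_integrable[OF assms]
            borel_measurable_continuous_onI[OF G_continuous]])
    show "AE p in M. norm (G (f p)) \<le> norm (2 * f p)"
      using G_lipschitz[of _ 0] G_0 by (intro AE_I2) (simp add: abs_mult)
  qed
  then show ?thesis by (rule integrable_mult_bounded[OF _ \<zeta>_measurable(2) Z])
qed

text \<open>G(s) \<zeta> is compactly supported in D, so its time derivative, g(s) \<zeta> dt s +
  G(s) dt \<zeta>, integrates to 0.\<close>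

lemma integral_dt_s: "(\<integral>p. dt (s k) p * \<phi> k p \<partial>M) = - (\<integral>p. G (s k p) * dt \<zeta> p \<partial>M)"
proof -
  obtain Z where Z: "\<And>p. \<zeta> p \<le> Z" using \<zeta>_bounded by blast
  let ?f = "\<lambda>p. if p \<in> D then G (s k p) * \<zeta> p else 0"
  have "Ck_on (Suc 0) UNIV G"
    by (rule Ck_on_SucI_real[OF open_UNIV G_deriv g_smooth])
  then have "Ck_on (Suc 0) D (\<lambda>p. G (s k p) * \<zeta> p)"
    by (intro Ck_on_mult[OF open_D Ck_on_compose[OF open_D open_UNIV UNIV_I s_Ck]
            Ck_on_subset[OF \<zeta>_smooth subset_UNIV]])
  then have f: "Ck_on (Suc 0) UNIV ?f"
    by (rule smooth_extension_by_zero[OF open_D closed_K K(2)]) (use K(3) in simp)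
  have cont: "continuous_on UNIV (dt ?f)"
    by (rule Ck_on_imp_continuous_on[OF Ck_on_dt[OF f]])
  have f0: "?f p = 0" if "p \<notin> K" for p using that K(3) by simp
  have dt0: "dt ?f p = 0" if "p \<notin> K" for p
    by (rule dt_eq_0[of "- K"]) (use that closed_K f0 in auto)
  have "0 = integral\<^sup>L lborel (dt ?f)"
    by (rule integral_dt_compact_support[OF f K(1) f0, symmetric])
  also have "\<dots> = integral\<^sup>L lebesgue (dt ?f)"
    by (rule integral_completion[symmetric]) (use borel_measurable_continuous_onI[OF cont] in simp)
  also have "\<dots> = integral\<^sup>L M (dt ?f)"
  proof -
    have "integral\<^sup>L (lebesgue_on UNIV) (dt ?f) = integral\<^sup>L M (dt ?f)"
    proof (rule integral_lebesgue_on_superset[OF subset_UNIV sets_D])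
      show "UNIV \<in> sets lebesgue" using sets.top[of lebesgue] by simp
      show "dt ?f p = 0" if "p \<in> UNIV - D" for p
        by (rule dt0) (use that K(2) in blast)
    qed
    then show ?thesis by (simp only: lebesgue_on_UNIV_eq)
  qed
  also have "\<dots> = (\<integral>p. dt (s k) p * \<phi> k p + G (s k p) * dt \<zeta> p \<partial>M)"
    by (rule Bochner_Integration.integral_cong[OF refl])
      (simp add: dt_compose[OF _ G_deriv] \<phi>_def)
  also have "\<dots> = (\<integral>p. dt (s k) p * \<phi> k p \<partial>M) + (\<integral>p. G (s k p) * dt \<zeta> p \<partial>M)"
  proof (rule Bochner_Integration.integral_add[OF _ G_integrable[OF s_integrable]])
    show "integrable M (\<lambda>p. dt (s k) p * \<phi> k p)"
      by (rule integrable_mult_bounded[OF S(5) \<phi>_measurable, of _ "2 * Z"])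
        (simp add: \<phi>_nonneg \<phi>_le[OF Z])
  qed
  finally show ?thesis by simp
qed

text \<open>The limit wt is exchanged for the derivative of the approximant, then integration by
  parts is exact, then G of the approximant is exchanged for G(w). The first exchange uses \<phi> <=
  2 Z, the second that G has Lipschitz constant 2; both need only L^1 convergence.\<close>

lemma time_term:
  assumes "0 < e"
  shows "\<forall>\<^sub>F k in sequentially. (\<integral>p. wt p * \<phi> k p \<partial>M) \<le> - (\<integral>p. G (w p) * dt \<zeta> p \<partial>M) + e"
proof -
  obtain Z where Z: "0 < Z" "\<And>p. \<zeta> p \<le> Z" "\<And>p. \<bar>dt \<zeta> p\<bar> \<le> Z"
    using \<zeta>_bounded by blast
  \<comment> \<open>Each exchange costs 2 Z times this, i.e. e / 2.\<close>
  have "0 < e / (4 * Z)" using assms Z by simp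
  from approximates_eventually(2)[OF approx this] eventually_L1[OF this]
  show ?thesis
  proof eventually_elim
    case (elim k)
    have b: "\<bar>\<phi> k p\<bar> \<le> 2 * Z" for p by (simp add: \<phi>_nonneg \<phi>_le[OF Z(2)])
    have i1: "integrable M (\<lambda>p. wt p * \<phi> k p)" "integrable M (\<lambda>p. dt (s k) p * \<phi> k p)"
      by (intro integrable_mult_bounded[OF _ \<phi>_measurable b] approximates_integrable(2)[OF approx] S(5))+
    have "(\<integral>p. wt p * \<phi> k p \<partial>M) - (\<integral>p. dt (s k) p * \<phi> k p \<partial>M)
        = (\<integral>p. wt p * \<phi> k p - dt (s k) p * \<phi> k p \<partial>M)" using i1 by simp
    also have "\<dots> \<le> (\<integral>p. 2 * Z * \<bar>dt (s k) p - wt p\<bar> \<partial>M)"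
    proof (rule integral_mono)
      fix p
      have "wt p * \<phi> k p - dt (s k) p * \<phi> k p \<le> \<bar>dt (s k) p - wt p\<bar> * \<bar>\<phi> k p\<bar>"
        unfolding abs_mult[symmetric] by (simp add: left_diff_distrib)
      also have "\<dots> \<le> \<bar>dt (s k) p - wt p\<bar> * (2 * Z)" by (intro mult_left_mono b) simp
      finally show "wt p * \<phi> k p - dt (s k) p * \<phi> k p \<le> 2 * Z * \<bar>dt (s k) p - wt p\<bar>"
        by (simp add: mult.commute)
    qed (use i1 elim in auto)
    also have "\<dots> \<le> 2 * Z * (e / (4 * Z))"
      using elim Z by (simp only: integral_mult_right_zero) (intro mult_left_mono, auto)
    also have "\<dots> = e / 2" using Z by simp
    finally have 1: "(\<integral>p. wt p * \<phi> k p \<partial>M) \<le> (\<integral>p. dt (s k) p * \<phi> k p \<partial>M) + e / 2" by simp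
    note i2 = G_integrable[OF w_integrable] G_integrable[OF s_integrable[of k]]
    have "(\<integral>p. G (w p) * dt \<zeta> p \<partial>M) - (\<integral>p. G (s k p) * dt \<zeta> p \<partial>M)
        = (\<integral>p. G (w p) * dt \<zeta> p - G (s k p) * dt \<zeta> p \<partial>M)" using i2 by simp
    also have "\<dots> \<le> (\<integral>p. 2 * Z * \<bar>s k p - w p\<bar> \<partial>M)"
    proof (rule integral_mono)
      fix p
      have "G (w p) * dt \<zeta> p - G (s k p) * dt \<zeta> p \<le> \<bar>G (w p) - G (s k p)\<bar> * \<bar>dt \<zeta> p\<bar>"
        unfolding abs_mult[symmetric] by (simp add: left_diff_distrib)
      also have "\<dots> \<le> (2 * \<bar>w p - s k p\<bar>) * Z"
        by (intro mult_mono G_lipschitz Z(3)) auto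
      finally show "G (w p) * dt \<zeta> p - G (s k p) * dt \<zeta> p \<le> 2 * Z * \<bar>s k p - w p\<bar>"
        by (simp add: abs_minus_commute mult.commute mult.left_commute)
    qed (use i2 s_integrable w_integrable in auto)
    also have "\<dots> \<le> 2 * Z * (e / (4 * Z))"
      using elim Z by (simp only: integral_mult_right_zero) (intro mult_left_mono, auto)
    also have "\<dots> = e / 2" using Z by simp
    finally show ?case using 1 integral_dt_s[of k] by simp
  qed
qed

text \<open>The test functions change with k, so a bound uniform in k is required for
  Cauchy-Schwarz. It holds because g' and \<zeta> are bounded and the energies of a Cauchy sequence
  stay bounded.\<close>

lemma energy_\<phi>_bound:
  "\<exists>E>0. \<exists>N. \<forall>k\<ge>N. integral\<^sup>L M (energy (\<phi> k)) \<le> E"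
proof -
  interpret finite_measure M by (rule finite_measure_M)
  obtain Z where Z: "0 < Z" "\<And>p. \<zeta> p \<le> Z" using \<zeta>_bounded by blast
  obtain N where N: "\<forall>k\<ge>N. \<forall>m\<ge>N. integral\<^sup>L M (energy (\<lambda>p. s k p - s m p)) < 1"
    using S(8)[of 1] by auto
  have C0: "0 \<le> C" by (rule order_trans[OF abs_ge_zero g'_bound])
  \<comment> \<open>The 8 is the factor 2 of the parallelogram bound times g^2 <= 4; the energy of
    \<zeta> is at most B Z.\<close>
  let ?c1 = "2 * (C * Z)\<^sup>2" and ?c2 = "8 * (B * Z)"
  let ?E = "?c1 * (2 * integral\<^sup>L M (energy (s N)) + 2) + ?c2 * measure M (space M)"
  have "integral\<^sup>L M (energy (\<phi> k)) \<le> max 1 ?E" if k: "N \<le> k" for k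
  proof -
    have ae: "AE p in M. energy (\<phi> k) p \<le> ?c1 * energy (s k) p + ?c2"
    proof -
      have "AE p in M. p \<in> D" by (rule AE_I2) simp
      then show ?thesis using AE_psd energy_\<zeta>
      proof eventually_elim
        case (elim p)
        let ?x = "g' (s k p) * \<zeta> p" and ?y = "g (s k p)"
        have "energy (\<phi> k) p \<le> 2 * (?x\<^sup>2 * energy (s k) p) + 2 * (?y\<^sup>2 * energy \<zeta> p)"
          using coeff_form_add_le[OF elim(2), of "?x *\<^sub>R grad (s k) p" "?y *\<^sub>R grad \<zeta> p"]
          unfolding \<phi>_grad[OF elim(1)] by (simp add: coeff_form_simps power2_eq_square mult.assoc)
        moreover have "?x\<^sup>2 \<le> (C * Z)\<^sup>2"
        proof -
          have "\<bar>?x\<bar> \<le> C * Z"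
            unfolding abs_mult using \<zeta>_nonneg[of p] Z(2)[of p] g'_bound C0 by (intro mult_mono) auto
          then show ?thesis by (metis abs_ge_zero power2_abs power_mono)
        qed
        then have "?x\<^sup>2 * energy (s k) p \<le> (C * Z)\<^sup>2 * energy (s k) p"
          by (rule mult_right_mono[OF _ coeff_form_nonneg[OF elim(2)]])
        moreover have "?y\<^sup>2 * energy \<zeta> p \<le> 2\<^sup>2 * (B * Z)"
        proof (rule mult_mono)
          show "?y\<^sup>2 \<le> 2\<^sup>2" using g_bounds[of "s k p"] by (intro power_mono) auto
          have "b p * \<zeta> p \<le> B * Z"
            using b_bounds[of p] \<zeta>_nonneg[of p] Z(2)[of p] by (intro mult_mono) auto
          then show "energy \<zeta> p \<le> B * Z" using elim(3) by simp
        qed (simp_all add: coeff_form_nonneg[OF elim(2)])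
        ultimately show ?case by simp
      qed
    qed
    have i: "integrable M (\<lambda>p. ?c1 * energy (s k) p + ?c2)"
      using S(6) by simp
    have "integral\<^sup>L M (energy (\<phi> k)) \<le> (\<integral>p. ?c1 * energy (s k) p + ?c2 \<partial>M)"
      by (rule integral_mono_AE[OF test_function_energy_integrable[OF \<phi>_test] i ae])
    also have "\<dots> = ?c1 * integral\<^sup>L M (energy (s k)) + ?c2 * measure M (space M)"
      using S(6) by (simp add: mult.commute)
    also have "integral\<^sup>L M (energy (s k)) \<le> 2 * integral\<^sup>L M (energy (s N)) + 2"
    proof -
      have "s k = (\<lambda>p. s N p - (s N p - s k p))" by simp
      then have "integral\<^sup>L M (energy (s k)) \<le> 2 * integral\<^sup>L M (energy (s N))
          + 2 * integral\<^sup>L M (energy (\<lambda>p. s N p - s k p))"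
        using energy_diff(2)[OF s_Ck Ck_on_diff[OF open_D s_Ck s_Ck] S(6) energy_diff(1)[OF s_Ck s_Ck S(6) S(6)],
            of N N k] by simp
      moreover have "integral\<^sup>L M (energy (\<lambda>p. s N p - s k p)) < 1"
        using N k by blast
      ultimately show ?thesis by linarith
    qed
    finally have "integral\<^sup>L M (energy (\<phi> k)) \<le> ?E" by (simp add: mult_left_mono)
    then show ?thesis by simp
  qed
  then show ?thesis by (intro exI[of _ "max 1 ?E"] conjI exI[of _ N]) auto
qed

text \<open>
  The flux is only known through its pairings, so \<open>F\<close> is compared with the flux of \<open>s m\<close> for
  \<open>m\<close> large, and the latter with the flux of \<open>s k\<close> by Cauchy-Schwarz, uniformly in \<open>m\<close>.
\<close>

lemma flux_term:
  assumes "0 < e"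
  shows "\<forall>\<^sub>F k in sequentially. (\<integral>p. grad (\<phi> k) p \<bullet> F p \<partial>M)
    \<le> (\<integral>p. coeff_form a p (grad (\<phi> k) p) (grad (s k) p) \<partial>M) + e"
proof -
  obtain E N1 where E: "0 < E" "\<And>k. N1 \<le> k \<Longrightarrow> integral\<^sup>L M (energy (\<phi> k)) \<le> E"
    using energy_\<phi>_bound by blast
  have "0 < e\<^sup>2 / E" using assms E(1) by simp
  then obtain N2 where N2: "\<forall>k\<ge>N2. \<forall>m\<ge>N2. integral\<^sup>L M (energy (\<lambda>p. s k p - s m p)) < e\<^sup>2 / E"
    using S(8) by blast
  have "(\<integral>p. grad (\<phi> k) p \<bullet> F p \<partial>M)
    \<le> (\<integral>p. coeff_form a p (grad (\<phi> k) p) (grad (s k) p) \<partial>M) + e" if k: "max N1 N2 \<le> k" for k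
  proof (rule field_le_epsilon)
    \<comment> \<open>k is fixed at this point while m is sent to infinity: e2 is the error between
      the flux of \<open>s m\<close> and F, tested with this one function.\<close>
    fix e2 :: real assume "0 < e2"
    from approximates_eventually(3)[OF approx this \<phi>_test[of k]] eventually_ge_at_top[of N2]
    obtain m where m: "(\<integral>p. \<bar>coeff_form a p (grad (\<phi> k) p) (grad (s m) p) - grad (\<phi> k) p \<bullet> F p\<bar> \<partial>M) < e2"
        "integrable M (\<lambda>p. \<bar>coeff_form a p (grad (\<phi> k) p) (grad (s m) p) - grad (\<phi> k) p \<bullet> F p\<bar>)"
        "N2 \<le> m"
      using eventually_happens'[OF sequentially_bot eventually_conj] by blast
    have C\<phi>: "Ck_on (Suc 0) D (\<phi> k)" by (rule test_function_Ck_on[OF \<phi>_test])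
    note e\<phi> = test_function_energy_integrable[OF \<phi>_test[of k]]
    note i = form_integrable[OF C\<phi> s_Ck e\<phi> S(6)] and f = approximates_integrable(3)[OF approx \<phi>_test[of k]]
    note ed = energy_diff(1)[OF s_Ck s_Ck S(6) S(6), of m k]
    \<comment> \<open>Balances Young's inequality: with energies at most E and e^2 / E, both terms
      become e / 2.\<close>
    let ?\<delta> = "e / E"
    have \<delta>: "0 < ?\<delta>" using assms E(1) by simp
    have "(\<integral>p. grad (\<phi> k) p \<bullet> F p \<partial>M)
        \<le> (\<integral>p. coeff_form a p (grad (\<phi> k) p) (grad (s m) p)
          + \<bar>coeff_form a p (grad (\<phi> k) p) (grad (s m) p) - grad (\<phi> k) p \<bullet> F p\<bar> \<partial>M)"
      by (rule integral_mono) (use i f m(2) in auto)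
    also have "\<dots> \<le> (\<integral>p. coeff_form a p (grad (\<phi> k) p) (grad (s m) p) \<partial>M) + e2"
      using i m by simp
    also have "(\<integral>p. coeff_form a p (grad (\<phi> k) p) (grad (s m) p) \<partial>M)
        \<le> (\<integral>p. coeff_form a p (grad (\<phi> k) p) (grad (s k) p)
          + (?\<delta> / 2 * energy (\<phi> k) p + energy (\<lambda>p. s m p - s k p) p / (2 * ?\<delta>)) \<partial>M)"
    proof (rule integral_mono_AE)
      have "AE p in M. p \<in> D" by (rule AE_I2) simp
      then show "AE p in M. coeff_form a p (grad (\<phi> k) p) (grad (s m) p)
          \<le> coeff_form a p (grad (\<phi> k) p) (grad (s k) p)
          + (?\<delta> / 2 * energy (\<phi> k) p + energy (\<lambda>p. s m p - s k p) p / (2 * ?\<delta>))"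
        using AE_psd
      proof eventually_elim
        case (elim p)
        have "coeff_form a p (grad (\<phi> k) p) (grad (s m) p) - coeff_form a p (grad (\<phi> k) p) (grad (s k) p)
            = coeff_form a p (grad (\<phi> k) p) (grad (\<lambda>p. s m p - s k p) p)"
          unfolding grad_diff[OF s_Ck s_Ck elim(1)] by (simp add: coeff_form_simps)
        also have "\<dots> \<le> ?\<delta> / 2 * energy (\<phi> k) p + energy (\<lambda>p. s m p - s k p) p / (2 * ?\<delta>)"
          by (rule order_trans[OF abs_ge_self coeff_form_young[OF elim(2) \<delta>]])
        finally show ?case by linarith
      qed
      show "integrable M (\<lambda>p. coeff_form a p (grad (\<phi> k) p) (grad (s m) p))" by (rule i)
      show "integrable M (\<lambda>p. coeff_form a p (grad (\<phi> k) p) (grad (s k) p)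
          + (?\<delta> / 2 * energy (\<phi> k) p + energy (\<lambda>p. s m p - s k p) p / (2 * ?\<delta>)))"
        by (intro Bochner_Integration.integrable_add integrable_mult_right integrable_divide i e\<phi> ed)
    qed
    also have "\<dots> = (\<integral>p. coeff_form a p (grad (\<phi> k) p) (grad (s k) p) \<partial>M)
        + (?\<delta> / 2 * integral\<^sup>L M (energy (\<phi> k)) + integral\<^sup>L M (energy (\<lambda>p. s m p - s k p)) / (2 * ?\<delta>))"
    proof -
      have "integrable M (\<lambda>p. ?\<delta> / 2 * energy (\<phi> k) p)" "integrable M (\<lambda>p. energy (\<lambda>p. s m p - s k p) p / (2 * ?\<delta>))"
        by (intro integrable_mult_right integrable_divide e\<phi> ed)+
      then show ?thesis
        using i[of k] by (simp only: Bochner_Integration.integral_add Bochner_Integration.integrable_add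
            integral_mult_right_zero integral_divide_zero)
    qed
    also have "?\<delta> / 2 * integral\<^sup>L M (energy (\<phi> k)) \<le> ?\<delta> / 2 * E"
      using E(2)[of k] k \<delta> by (intro mult_left_mono) auto
    also have "integral\<^sup>L M (energy (\<lambda>p. s m p - s k p)) / (2 * ?\<delta>) \<le> (e\<^sup>2 / E) / (2 * ?\<delta>)"
    proof (rule divide_right_mono)
      show "integral\<^sup>L M (energy (\<lambda>p. s m p - s k p)) \<le> e\<^sup>2 / E"
        using N2 m(3) k by (intro less_imp_le) auto
    qed (use \<delta> in simp)
    also have "?\<delta> / 2 * E + (e\<^sup>2 / E) / (2 * ?\<delta>) = e"
      using assms E(1) by (simp add: field_simps power2_eq_square)
    finally show "(\<integral>p. grad (\<phi> k) p \<bullet> F p \<partial>M)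
        \<le> (\<integral>p. coeff_form a p (grad (\<phi> k) p) (grad (s k) p) \<partial>M) + e + e2"
      by simp
  qed
  then show ?thesis by (rule eventually_sequentiallyI)
qed

lemma b_g'_integrable: "integrable M (\<lambda>p. b p / \<bar>g' (s k p)\<bar>)"
proof (rule Bochner_Integration.integrable_bound)
  interpret finite_measure M by (rule finite_measure_M)
  have C0: "0 \<le> C" by (rule order_trans[OF abs_ge_zero g'_bound])
  show "integrable M (\<lambda>p. B * (C * (1 + \<bar>s k p\<bar> powr q)))"
    using S(7) by simp
  have "(\<lambda>p. g' (s k p)) \<in> borel_measurable M"
    by (rule compose_s_measurable[OF g'_continuous])
  then show "(\<lambda>p. b p / \<bar>g' (s k p)\<bar>) \<in> borel_measurable M"
    using b_measurable by measurable
  show "AE p in M. norm (b p / \<bar>g' (s k p)\<bar>) \<le> norm (B * (C * (1 + \<bar>s k p\<bar> powr q)))"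
  proof (rule AE_I2)
    fix p
    have "b p * (1 / \<bar>g' (s k p)\<bar>) \<le> B * (C * (1 + \<bar>s k p\<bar> powr q))"
      using b_bounds[of p] by (intro mult_mono g'_lower) auto
    then show "norm (b p / \<bar>g' (s k p)\<bar>) \<le> norm (B * (C * (1 + \<bar>s k p\<bar> powr q)))"
      using b_bounds(1)[of p] by simp
  qed
qed

text \<open>The gradient of \<phi> contributes g' \<zeta> times the energy of the approximant, which
  is negative, plus g times the mixed form; \<open>coeff_form_absorb\<close> with \<gamma> = -g'
  leaves only b / |g'|.\<close>

lemma elliptic_term:
  "(\<integral>p. coeff_form a p (grad (\<phi> k) p) (grad (s k) p) \<partial>M) \<le> (\<integral>p. b p / \<bar>g' (s k p)\<bar> \<partial>M)"
proof (rule integral_mono_AE)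
  show "integrable M (\<lambda>p. coeff_form a p (grad (\<phi> k) p) (grad (s k) p))"
    by (rule form_integrable[OF test_function_Ck_on[OF \<phi>_test] s_Ck
          test_function_energy_integrable[OF \<phi>_test] S(6)])
  have "AE p in M. p \<in> D" by (rule AE_I2) simp
  then show "AE p in M. coeff_form a p (grad (\<phi> k) p) (grad (s k) p) \<le> b p / \<bar>g' (s k p)\<bar>"
    using AE_psd energy_\<zeta>
  proof eventually_elim
    case (elim p)
    have "0 < - g' (s k p)" "0 \<le> g (s k p)" using g'_neg[of "s k p"] g_bounds(1)[of "s k p"] by auto
    from coeff_form_absorb[OF elim(2,3) b_bounds(1) \<zeta>_nonneg this g_bounds(2), of "grad (s k) p"]
    show ?case
      unfolding \<phi>_grad[OF elim(1)] using g'_neg[of "s k p"] by (simp add: coeff_form_simps)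
  qed
qed (rule b_g'_integrable)

text \<open>The lower bound g >= 1 replaces \<phi> by \<zeta> on the left. The last integral keeps
  \<open>s k\<close>; its exchange for w is postponed until the power bound on 1 / |g'| and the
  weights are at hand.\<close>

lemma test_inequality:
  assumes ineq: "\<And>\<phi>. test_function \<phi> \<Longrightarrow> (\<And>p. 0 \<le> \<phi> p) \<Longrightarrow> (\<And>p. p \<notin> K \<Longrightarrow> \<phi> p = 0) \<Longrightarrow>
      c * (\<integral>p. \<bar>w p\<bar> powr q * \<phi> p \<partial>M) \<le> (\<integral>p. wt p * \<phi> p \<partial>M) + (\<integral>p. grad \<phi> p \<bullet> F p \<partial>M)"
    and "0 \<le> c" "0 < e"
  shows "\<forall>\<^sub>F k in sequentially. c * (\<integral>p. \<bar>w p\<bar> powr q * \<zeta> p \<partial>M)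
    \<le> - (\<integral>p. G (w p) * dt \<zeta> p \<partial>M) + (\<integral>p. b p / \<bar>g' (s k p)\<bar> \<partial>M) + e"
proof -
  obtain Z where Z: "0 < Z" "\<And>p. \<zeta> p \<le> Z" using \<zeta>_bounded by blast
  have "0 < e / 2" using assms(3) by simp
  from time_term[OF this] flux_term[OF this] show ?thesis
  proof eventually_elim
    case (elim k)
    have "(\<integral>p. \<bar>w p\<bar> powr q * \<zeta> p \<partial>M) \<le> (\<integral>p. \<bar>w p\<bar> powr q * \<phi> k p \<partial>M)"
    proof (rule integral_mono)
      show "integrable M (\<lambda>p. \<bar>w p\<bar> powr q * \<zeta> p)"
        by (rule integrable_mult_bounded[OF approximates_integrable(1)[OF approx] \<zeta>_measurable(1), of Z])
          (simp add: \<zeta>_nonneg Z)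
      show "integrable M (\<lambda>p. \<bar>w p\<bar> powr q * \<phi> k p)"
        by (rule integrable_mult_bounded[OF approximates_integrable(1)[OF approx] \<phi>_measurable, of _ "2 * Z"])
          (simp add: \<phi>_nonneg \<phi>_le[OF Z(2)])
      fix p assume "p \<in> space M"
      then have "\<zeta> p \<le> \<phi> k p"
        using mult_right_mono[OF g_bounds(1)[of "s k p"] \<zeta>_nonneg[of p]] by (simp add: \<phi>_def)
      then show "\<bar>w p\<bar> powr q * \<zeta> p \<le> \<bar>w p\<bar> powr q * \<phi> k p" by (rule mult_left_mono) simp
    qed
    then have "c * (\<integral>p. \<bar>w p\<bar> powr q * \<zeta> p \<partial>M) \<le> c * (\<integral>p. \<bar>w p\<bar> powr q * \<phi> k p \<partial>M)"
      by (rule mult_left_mono[OF _ assms(2)])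
    also have "\<dots> \<le> (\<integral>p. wt p * \<phi> k p \<partial>M) + (\<integral>p. grad (\<phi> k) p \<bullet> F p \<partial>M)"
      by (rule ineq[OF \<phi>_test \<phi>_nonneg \<phi>_eq_0])
    finally show ?case using elim elliptic_term[of k] by linarith
  qed
qed

end

text \<open>
  The weight \<open>\<omega>\<close> controls the derivatives of the cutoff \<open>\<zeta>\<close>, and \<open>\<iota>\<close> is the part of \<open>\<zeta>\<close> on the region
  where these derivatives do not vanish; the factor \<open>\<beta>\<close> is of order \<open>R\<^sup>-\<^sup>\<alpha>\<close>.
\<close>

locale scaled_setting = diffusion_domain a D q
  for a :: "'n::finite \<Rightarrow> 'n \<Rightarrow> 'n spacetime \<Rightarrow> real" and D :: "'n spacetime set" and q :: real +
  fixes w wt :: "'n spacetime \<Rightarrow> real" and F :: "'n spacetime \<Rightarrow> real ^ 'n"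
    and s :: "nat \<Rightarrow> 'n spacetime \<Rightarrow> real" and \<zeta> \<omega> \<iota> :: "'n spacetime \<Rightarrow> real"
    and K :: "'n spacetime set" and g g' G :: "real \<Rightarrow> real" and C p \<beta> c :: real
  assumes approx: "approximates w wt F s" and w_nonneg: "AE x in M. 0 \<le> w x"
    and \<zeta>_smooth: "\<And>k. Ck_on k UNIV \<zeta>" and \<zeta>_nonneg: "\<And>x. 0 \<le> \<zeta> x"
    and K: "compact K" "K \<subseteq> D" "\<And>x. x \<notin> K \<Longrightarrow> \<zeta> x = 0"
    and \<omega>_measurable: "\<omega> \<in> borel_measurable M" and \<omega>_bounds: "\<And>x. 0 \<le> \<omega> x" "\<And>x. \<omega> x \<le> 1"
    and \<iota>_measurable: "\<iota> \<in> borel_measurable M" and \<iota>_bounds: "\<And>x. 0 \<le> \<iota> x" "\<And>x. \<iota> x \<le> 1"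
    and p: "1 < p" "p < q"
    and weights: "\<And>x y. 0 \<le> y \<Longrightarrow> y * \<omega> x \<le> y powr q * \<iota> x + 1"
      "\<And>x y. 0 \<le> y \<Longrightarrow> y powr p * \<omega> x \<le> y powr q * \<iota> x + 1"
    and \<beta>: "0 \<le> \<beta>"
    and energy_\<zeta>: "AE x in M. energy \<zeta> x \<le> \<beta> * \<omega> x * \<zeta> x"
    and dt_\<zeta>: "\<And>x. x \<in> D \<Longrightarrow> - dt \<zeta> x \<le> \<beta> * \<omega> x"
    and g_smooth: "\<And>k. Ck_on k UNIV g" and g_deriv: "\<And>y. (g has_real_derivative g' y) (at y)"
    and G_deriv: "\<And>y. (G has_real_derivative g y) (at y)" and G_0: "G 0 = 0"
    and g_bounds: "\<And>y. 1 \<le> g y" "\<And>y. g y \<le> 2"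
    and g'_neg: "\<And>y. g' y < 0" and g'_bound: "\<And>y. \<bar>g' y\<bar> \<le> C"
    and g'_lower: "\<And>y. 1 / \<bar>g' y\<bar> \<le> C * (1 + \<bar>y\<bar> powr p)" and C_pos: "0 < C"
    and g'_continuous: "continuous_on UNIV g'"
    and c_nonneg: "0 \<le> c"
    and ineq: "\<And>\<phi>. test_function \<phi> \<Longrightarrow> (\<And>x. 0 \<le> \<phi> x) \<Longrightarrow> (\<And>x. x \<notin> K \<Longrightarrow> \<phi> x = 0) \<Longrightarrow>
      c * (\<integral>x. \<bar>w x\<bar> powr q * \<phi> x \<partial>M) \<le> (\<integral>x. wt x * \<phi> x \<partial>M) + (\<integral>x. grad \<phi> x \<bullet> F x \<partial>M)"
begin

lemma scaled_lower:
  assumes "0 < \<kappa>"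
  shows "1 / \<bar>g' (y / \<kappa>) / \<kappa>\<bar> \<le> \<kappa> * C * (1 + \<bar>y / \<kappa>\<bar> powr p)"
proof -
  have "1 / \<bar>g' (y / \<kappa>) / \<kappa>\<bar> = \<kappa> * (1 / \<bar>g' (y / \<kappa>)\<bar>)" using assms by simp
  also have "\<dots> \<le> \<kappa> * (C * (1 + \<bar>y / \<kappa>\<bar> powr p))"
    using assms by (intro mult_left_mono g'_lower) auto
  finally show ?thesis by simp
qed

text \<open>The constant given by the maximum depends on \<kappa> but is purely qualitative: it
  secures integrability and does not appear in the final estimate, which goes back to
  \<open>scaled_lower\<close>.\<close>

lemma test_setting_scaled:
  assumes \<kappa>: "0 < \<kappa>"
  shows "test_setting a D q w wt F s \<zeta> (\<lambda>x. \<beta> * \<omega> x) K (\<lambda>y. g (y / \<kappa>)) (\<lambda>y. g' (y / \<kappa>) / \<kappa>)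
    (\<lambda>y. \<kappa> * G (y / \<kappa>)) \<beta> (max (C / \<kappa>) (\<kappa> * C * (1 + inverse \<kappa> powr p)))"
proof (unfold_locales)
  let ?C = "max (C / \<kappa>) (\<kappa> * C * (1 + inverse \<kappa> powr p))"
  have bl: "bounded_linear (\<lambda>y. y / \<kappa>)" by (rule bounded_linear_divide)
  have dl: "((\<lambda>y. y / \<kappa>) has_real_derivative 1 / \<kappa>) (at y)" for y
    by (rule DERIV_cdivide) (rule DERIV_ident)
  show "Ck_on k UNIV (\<lambda>y. g (y / \<kappa>))" for k
    by (rule Ck_on_compose[OF open_UNIV open_UNIV UNIV_I Ck_on_bounded_linear[OF open_UNIV bl] g_smooth])
  show "((\<lambda>y. g (y / \<kappa>)) has_real_derivative g' (y / \<kappa>) / \<kappa>) (at y)" for y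
    using DERIV_chain2[OF g_deriv dl, of y] by simp
  show "((\<lambda>y. \<kappa> * G (y / \<kappa>)) has_real_derivative g (y / \<kappa>)) (at y)" for y
    using DERIV_cmult[OF DERIV_chain2[OF G_deriv dl, of y], of \<kappa>] \<kappa> by simp
  show "(\<lambda>x. \<beta> * \<omega> x) \<in> borel_measurable M" using \<omega>_measurable by measurable
  show "0 \<le> \<beta> * \<omega> x" "\<beta> * \<omega> x \<le> \<beta>" for x
    using \<beta> \<omega>_bounds[of x] by (simp_all add: mult_left_le)
  show "g' (y / \<kappa>) / \<kappa> < 0" for y using g'_neg[of "y / \<kappa>"] \<kappa> by (simp add: divide_neg_pos)
  show "\<bar>g' (y / \<kappa>) / \<kappa>\<bar> \<le> ?C" for y
  proof -
    have "\<bar>g' (y / \<kappa>) / \<kappa>\<bar> \<le> C / \<kappa>"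
      using g'_bound[of "y / \<kappa>"] \<kappa> by (simp add: divide_right_mono)
    then show ?thesis by simp
  qed
  show "1 / \<bar>g' (y / \<kappa>) / \<kappa>\<bar> \<le> ?C * (1 + \<bar>y\<bar> powr q)" for y
  proof -
    have yq: "\<bar>y\<bar> powr p \<le> 1 + \<bar>y\<bar> powr q"
    proof (cases "\<bar>y\<bar> \<le> 1")
      case True
      then have "\<bar>y\<bar> powr p \<le> 1" using p by (intro powr_le1) auto
      then show ?thesis by (simp add: add_increasing2)
    next
      case False
      then have "\<bar>y\<bar> powr p \<le> \<bar>y\<bar> powr q" using p by (intro powr_mono) auto
      then show ?thesis by simp
    qed
    have "\<bar>y / \<kappa>\<bar> powr p = inverse \<kappa> powr p * \<bar>y\<bar> powr p"
      using \<kappa> by (simp add: divide_inverse powr_mult abs_mult mult.commute)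
    also have "\<dots> \<le> inverse \<kappa> powr p * (1 + \<bar>y\<bar> powr q)"
      by (intro mult_left_mono yq) simp
    finally have "\<bar>y / \<kappa>\<bar> powr p \<le> inverse \<kappa> powr p * (1 + \<bar>y\<bar> powr q)" .
    then have "1 + \<bar>y / \<kappa>\<bar> powr p \<le> (1 + inverse \<kappa> powr p) * (1 + \<bar>y\<bar> powr q)"
      unfolding distrib_right[of 1] by (rule add_mono[rotated]) simp
    then have "\<kappa> * C * (1 + \<bar>y / \<kappa>\<bar> powr p) \<le> \<kappa> * C * ((1 + inverse \<kappa> powr p) * (1 + \<bar>y\<bar> powr q))"
      using \<kappa> C_pos by (intro mult_left_mono) auto
    also have "\<dots> = \<kappa> * C * (1 + inverse \<kappa> powr p) * (1 + \<bar>y\<bar> powr q)" by simp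
    also have "\<dots> \<le> ?C * (1 + \<bar>y\<bar> powr q)"
      by (intro mult_right_mono) (auto intro: add_nonneg_nonneg)
    finally show ?thesis using scaled_lower[OF \<kappa>, of y] by linarith
  qed
  show "continuous_on UNIV (\<lambda>y. g' (y / \<kappa>) / \<kappa>)"
    using \<kappa> by (intro continuous_intros continuous_on_compose2[OF g'_continuous]) auto
  show "compact K" "K \<subseteq> D" by (fact K)+
qed (use approx \<zeta>_smooth \<zeta>_nonneg K(3) energy_\<zeta> g_bounds G_0 in simp_all)

text \<open>In the variable w / \<kappa> both the time term and the elliptic term carry the factor
  \<beta> \<kappa>, and the weight inequalities bound the rest by (w/\<kappa>)^q \<iota> + 1. This
  gives \<kappa>^(1-q) in front of the integral and \<kappa> in front of the volume.\<close>

lemma scaled_estimate: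
  assumes \<kappa>: "0 < \<kappa>"
  shows "c * (\<integral>x. \<bar>w x\<bar> powr q * \<zeta> x \<partial>M) \<le> (2 + 2 * C * 2 powr q) * \<beta> *
    (\<kappa> powr (1 - q) * (\<integral>x. \<bar>w x\<bar> powr q * \<iota> x \<partial>M) + \<kappa> * measure lebesgue D)"
proof -
  interpret finite_measure M by (rule finite_measure_M)
  interpret T: test_setting a D q w wt F s \<zeta> "\<lambda>x. \<beta> * \<omega> x" K "\<lambda>y. g (y / \<kappa>)" "\<lambda>y. g' (y / \<kappa>) / \<kappa>"
    "\<lambda>y. \<kappa> * G (y / \<kappa>)" \<beta> "max (C / \<kappa>) (\<kappa> * C * (1 + inverse \<kappa> powr p))"
    by (rule test_setting_scaled[OF \<kappa>])
  define V where "V = measure lebesgue D"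
  define J where "J = (\<integral>x. \<bar>w x\<bar> powr q * \<iota> x \<partial>M)"
  have V: "(\<integral>x. r \<partial>M) = r * V" for r :: real
    using sets_D by (simp add: V_def measure_restrict_space mult.commute)
  have V0: "0 \<le> V" by (simp add: V_def)
  have wq: "integrable M (\<lambda>x. \<bar>w x\<bar> powr q * \<iota> x)"
    by (rule integrable_mult_bounded[OF approximates_integrable(1)[OF approx] \<iota>_measurable, of 1])
      (simp add: \<iota>_bounds)
  have J0: "0 \<le> J" unfolding J_def by (rule integral_nonneg_AE) (simp add: \<iota>_bounds)
  have scale: "\<bar>y / \<kappa>\<bar> powr q = \<kappa> powr (- q) * \<bar>y\<bar> powr q" for y
    using \<kappa> by (simp add: abs_divide powr_divide powr_minus_divide)
  \<comment> \<open>For w >= 0 the antiderivative is nonnegative, so an upper bound on the negative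
    time derivative suffices; this is where the rise of the cutoff near t = 0 is discarded.\<close>
  have G_le: "- (\<kappa> * G (w x / \<kappa>) * dt \<zeta> x) \<le> 2 * \<beta> * \<kappa> * (\<kappa> powr (- q) * (\<bar>w x\<bar> powr q * \<iota> x) + 1)"
    if "x \<in> D" "0 \<le> w x" for x
  proof -
    have G0: "0 \<le> \<kappa> * G (w x / \<kappa>)"
    proof -
      have "G 0 \<le> G (w x / \<kappa>)"
        by (rule DERIV_nonneg_imp_nondecreasing)
          (use that \<kappa> G_deriv g_bounds(1) in \<open>auto intro: order_trans[OF zero_le_one]\<close>)
      then show ?thesis using G_0 \<kappa> by simp
    qed
    have "- (\<kappa> * G (w x / \<kappa>) * dt \<zeta> x) = \<kappa> * G (w x / \<kappa>) * (- dt \<zeta> x)" by simp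
    also have "\<dots> \<le> \<kappa> * G (w x / \<kappa>) * (\<beta> * \<omega> x)"
      by (rule mult_left_mono[OF dt_\<zeta>[OF that(1)] G0])
    also have "\<dots> \<le> (2 * w x) * (\<beta> * \<omega> x)"
      using T.G_lipschitz[of "w x" 0] that G_0 \<beta> \<omega>_bounds by (intro mult_right_mono) auto
    also have "\<dots> = 2 * \<beta> * \<kappa> * (\<bar>w x / \<kappa>\<bar> * \<omega> x)" using \<kappa> that by simp
    also have "\<dots> \<le> 2 * \<beta> * \<kappa> * (\<bar>w x / \<kappa>\<bar> powr q * \<iota> x + 1)"
      using \<beta> \<kappa> by (intro mult_left_mono weights(1)) auto
    finally show ?thesis unfolding scale by (simp add: mult.assoc)
  qed
  have time: "- (\<integral>x. \<kappa> * G (w x / \<kappa>) * dt \<zeta> x \<partial>M) \<le> 2 * \<beta> * \<kappa> * (\<kappa> powr (- q) * J + V)"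
  proof -
    have "- (\<integral>x. \<kappa> * G (w x / \<kappa>) * dt \<zeta> x \<partial>M) = (\<integral>x. - (\<kappa> * G (w x / \<kappa>) * dt \<zeta> x) \<partial>M)" by simp
    also have "\<dots> \<le> (\<integral>x. 2 * \<beta> * \<kappa> * (\<kappa> powr (- q) * (\<bar>w x\<bar> powr q * \<iota> x) + 1) \<partial>M)"
    proof (rule integral_mono_AE)
      show "integrable M (\<lambda>x. - (\<kappa> * G (w x / \<kappa>) * dt \<zeta> x))"
        using T.G_integrable[OF T.w_integrable] by simp
      show "integrable M (\<lambda>x. 2 * \<beta> * \<kappa> * (\<kappa> powr (- q) * (\<bar>w x\<bar> powr q * \<iota> x) + 1))"
        using wq by simp
      have "AE x in M. x \<in> D" by (rule AE_I2) simp
      with w_nonneg show "AE x in M. - (\<kappa> * G (w x / \<kappa>) * dt \<zeta> x)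
          \<le> 2 * \<beta> * \<kappa> * (\<kappa> powr (- q) * (\<bar>w x\<bar> powr q * \<iota> x) + 1)"
        by eventually_elim (rule G_le)
    qed
    also have "\<dots> = 2 * \<beta> * \<kappa> * (\<kappa> powr (- q) * J + V)"
      using wq V[of 1] by (simp add: J_def)
    finally show ?thesis .
  qed
  \<comment> \<open>Here w replaces the approximant, at the price of 2^q. The weight \<iota> <= 1 is
    kept on the power of w, as it localises the main term, and dropped from the error.\<close>
  have space: "(\<integral>x. \<beta> * \<omega> x / \<bar>g' (s k x / \<kappa>) / \<kappa>\<bar> \<partial>M)
      \<le> \<beta> * \<kappa> * C * (2 * V + 2 powr q * \<kappa> powr (- q) * (J + (\<integral>x. \<bar>s k x - w x\<bar> powr q \<partial>M)))"
    if k: "integrable M (\<lambda>x. \<bar>s k x - w x\<bar> powr q)" for k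
  proof -
    have pt: "\<beta> * \<omega> x / \<bar>g' (s k x / \<kappa>) / \<kappa>\<bar> \<le> \<beta> * \<kappa> * C *
        (2 + 2 powr q * \<kappa> powr (- q) * (\<bar>w x\<bar> powr q * \<iota> x + \<bar>s k x - w x\<bar> powr q))" for x
    proof -
      have "\<beta> * \<omega> x * (1 / \<bar>g' (s k x / \<kappa>) / \<kappa>\<bar>) \<le> \<beta> * \<omega> x * (\<kappa> * C * (1 + \<bar>s k x / \<kappa>\<bar> powr p))"
        using \<beta> \<omega>_bounds by (intro mult_left_mono scaled_lower[OF \<kappa>]) auto
      also have "\<dots> = \<beta> * \<kappa> * C * (\<omega> x + \<bar>s k x / \<kappa>\<bar> powr p * \<omega> x)" by (simp add: algebra_simps)
      also have "\<dots> \<le> \<beta> * \<kappa> * C * (1 + (\<bar>s k x / \<kappa>\<bar> powr q * \<iota> x + 1))"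
        using \<beta> \<kappa> C_pos by (intro mult_left_mono add_mono \<omega>_bounds weights(2)) auto
      also have "\<dots> \<le> \<beta> * \<kappa> * C *
        (2 + 2 powr q * \<kappa> powr (- q) * (\<bar>w x\<bar> powr q * \<iota> x + \<bar>s k x - w x\<bar> powr q))"
      proof (rule mult_left_mono)
        have "\<bar>s k x\<bar> powr q \<le> 2 powr q * (\<bar>w x\<bar> powr q + \<bar>s k x - w x\<bar> powr q)"
          using abs_add_powr_le[of q "w x" "s k x - w x"] q_gt_1 by simp
        then have "\<bar>s k x\<bar> powr q * \<iota> x \<le> 2 powr q * (\<bar>w x\<bar> powr q + \<bar>s k x - w x\<bar> powr q) * \<iota> x"
          using \<iota>_bounds by (intro mult_right_mono) auto
        also have "\<dots> = 2 powr q * (\<bar>w x\<bar> powr q * \<iota> x + \<bar>s k x - w x\<bar> powr q * \<iota> x)"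
          by (simp add: algebra_simps)
        also have "\<dots> \<le> 2 powr q * (\<bar>w x\<bar> powr q * \<iota> x + \<bar>s k x - w x\<bar> powr q)"
          using \<iota>_bounds[of x] by (intro mult_left_mono add_left_mono) (auto simp: mult_left_le)
        finally have "\<kappa> powr (- q) * (\<bar>s k x\<bar> powr q * \<iota> x)
            \<le> \<kappa> powr (- q) * (2 powr q * (\<bar>w x\<bar> powr q * \<iota> x + \<bar>s k x - w x\<bar> powr q))"
          by (rule mult_left_mono) simp
        then show "1 + (\<bar>s k x / \<kappa>\<bar> powr q * \<iota> x + 1)
            \<le> 2 + 2 powr q * \<kappa> powr (- q) * (\<bar>w x\<bar> powr q * \<iota> x + \<bar>s k x - w x\<bar> powr q)"
          unfolding scale by (simp add: mult.assoc mult.left_commute)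
      qed (use \<beta> \<kappa> C_pos in simp)
      finally show ?thesis by simp
    qed
    have "(\<integral>x. \<beta> * \<omega> x / \<bar>g' (s k x / \<kappa>) / \<kappa>\<bar> \<partial>M) \<le> (\<integral>x. \<beta> * \<kappa> * C *
        (2 + 2 powr q * \<kappa> powr (- q) * (\<bar>w x\<bar> powr q * \<iota> x + \<bar>s k x - w x\<bar> powr q)) \<partial>M)"
      by (rule integral_mono[OF T.b_g'_integrable _ pt]) (use wq k in simp)
    also have "\<dots> = \<beta> * \<kappa> * C * (2 * V + 2 powr q * \<kappa> powr (- q) * (J + (\<integral>x. \<bar>s k x - w x\<bar> powr q \<partial>M)))"
      using wq k V[of 2] by (simp add: J_def)
    finally show ?thesis .
  qed
  let ?Q = "2 * \<beta> * \<kappa> * (\<kappa> powr (- q) * J + V) + \<beta> * \<kappa> * C * (2 * V + 2 powr q * \<kappa> powr (- q) * J)"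
  have "c * (\<integral>x. \<bar>w x\<bar> powr q * \<zeta> x \<partial>M) \<le> ?Q"
  proof (rule field_le_epsilon)
    fix e :: real assume e: "0 < e"
    \<comment> \<open>Coefficient of the approximation error. With \<kappa> fixed it does not depend
      on k, so a late k makes the error at most e / 2; E + 1 avoids division by zero.\<close>
    define E where "E = \<beta> * \<kappa> * C * (2 powr q * \<kappa> powr (- q))"
    have E: "0 \<le> E" using \<beta> \<kappa> C_pos by (simp add: E_def)
    have e1: "0 < e / 2" "0 < e / (2 * (E + 1))" using e E by auto
    have "\<forall>\<^sub>F k in sequentially. c * (\<integral>x. \<bar>w x\<bar> powr q * \<zeta> x \<partial>M)
        \<le> - (\<integral>x. \<kappa> * G (w x / \<kappa>) * dt \<zeta> x \<partial>M) + (\<integral>x. \<beta> * \<omega> x / \<bar>g' (s k x / \<kappa>) / \<kappa>\<bar> \<partial>M) + e / 2"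
      by (rule T.test_inequality[OF _ c_nonneg e1(1)], rule ineq) simp_all
    then have "\<forall>\<^sub>F k in sequentially. c * (\<integral>x. \<bar>w x\<bar> powr q * \<zeta> x \<partial>M) \<le> ?Q + e"
      using approximates_eventually(1)[OF approx e1(2)]
    proof eventually_elim
      case (elim k)
      have "E * (\<integral>x. \<bar>s k x - w x\<bar> powr q \<partial>M) \<le> E * (e / (2 * (E + 1)))"
        using elim E by (intro mult_left_mono) auto
      also have "\<dots> \<le> e / 2" using E e by (simp add: field_simps)
      finally have "E * (\<integral>x. \<bar>s k x - w x\<bar> powr q \<partial>M) \<le> e / 2" .
      moreover have "\<beta> * \<kappa> * C * (2 * V + 2 powr q * \<kappa> powr (- q) * (J + (\<integral>x. \<bar>s k x - w x\<bar> powr q \<partial>M)))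
          = \<beta> * \<kappa> * C * (2 * V + 2 powr q * \<kappa> powr (- q) * J) + E * (\<integral>x. \<bar>s k x - w x\<bar> powr q \<partial>M)"
        by (simp add: E_def algebra_simps)
      ultimately show ?case using elim time space[of k] by linarith
    qed
    then show "c * (\<integral>x. \<bar>w x\<bar> powr q * \<zeta> x \<partial>M) \<le> ?Q + e" by simp
  qed
  also have "?Q \<le> (2 + 2 * C * 2 powr q) * \<beta> * (\<kappa> powr (1 - q) * J + \<kappa> * V)"
  proof -
    have "\<kappa> * \<kappa> powr (- q) = \<kappa> powr (1 - q)"
      using \<kappa> powr_add[of \<kappa> 1 "- q"] by simp
    then have "?Q = \<beta> * ((2 + C * 2 powr q) * (\<kappa> powr (1 - q) * J) + (2 + 2 * C) * (\<kappa> * V))"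
      by (simp add: algebra_simps) (simp flip: mult.assoc)
    also have "\<dots> \<le> \<beta> * ((2 + 2 * C * 2 powr q) * (\<kappa> powr (1 - q) * J) + (2 + 2 * C * 2 powr q) * (\<kappa> * V))"
    proof -
      \<comment> \<open>The coefficients 2 + C 2^q and 2 + 2 C are merged into 2 + 2 C 2^q.\<close>
      have "1 \<le> 2 powr q" using q_gt_1 by (simp add: ge_one_powr_ge_zero)
      then show ?thesis
        using C_pos \<beta> J0 V0 \<kappa> by (intro mult_left_mono add_mono mult_right_mono) auto
    qed
    finally show ?thesis by (simp add: algebra_simps)
  qed
  finally show ?thesis by (simp add: V_def J_def)
qed

end

section \<open>Cutoff functions\<close>

lemma Ck_on_inner_snd: "Ck_on k UNIV (\<lambda>p::'n::finite spacetime. snd p \<bullet> snd p)"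
proof (cases k)
  case 0
  then show ?thesis by (simp add: continuous_on_inner continuous_on_snd continuous_on_id)
next
  case (Suc l)
  have "((\<lambda>p::'n spacetime. snd p \<bullet> snd p) has_derivative (\<lambda>h. snd x \<bullet> snd h + snd h \<bullet> snd x)) (at x)" for x
    by (auto intro!: derivative_eq_intros)
  moreover have "bounded_linear (\<lambda>x::'n spacetime. snd x \<bullet> snd h + snd h \<bullet> snd x)" for h :: "'n spacetime"
    by (intro bounded_linear_add bounded_linear_inner_left_comp bounded_linear_inner_right_comp bounded_linear_snd)
  ultimately show ?thesis unfolding Suc
    by (intro Ck_on_SucI[OF open_UNIV] Ck_on_bounded_linear[OF open_UNIV])
qed

context
  fixes A Y :: "real \<Rightarrow> real"
begin

lemma Ck_on_separated:
  assumes "Ck_on k UNIV A" "Ck_on k UNIV Y"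
  shows "Ck_on k UNIV (\<lambda>p::'n::finite spacetime. A (fst p) * Y (snd p \<bullet> snd p))"
  by (rule Ck_on_mult[OF open_UNIV
        Ck_on_compose[OF open_UNIV open_UNIV UNIV_I Ck_on_bounded_linear[OF open_UNIV bounded_linear_fst] assms(1)]
        Ck_on_compose[OF open_UNIV open_UNIV UNIV_I Ck_on_inner_snd assms(2)]])

lemma
  fixes p :: "'n::finite spacetime"
  assumes "(A has_real_derivative A') (at (fst p))" "(Y has_real_derivative Y') (at (snd p \<bullet> snd p))"
  shows grad_separated: "grad (\<lambda>p. A (fst p) * Y (snd p \<bullet> snd p)) p = (2 * A (fst p) * Y') *\<^sub>R snd p"
    and dt_separated: "dt (\<lambda>p. A (fst p) * Y (snd p \<bullet> snd p)) p = A' * Y (snd p \<bullet> snd p)"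
proof -
  have "((\<lambda>p. A (fst p)) has_derivative (\<lambda>h. A' * fst h)) (at p)"
  proof (rule has_derivative_compose[where f = fst and f' = fst and g = A and g' = "(*) A'"])
    show "(fst has_derivative fst) (at p)"
      by (rule has_derivative_fst[OF has_derivative_ident])
    show "(A has_derivative (*) A') (at (fst p))"
      using assms(1) by (simp add: has_field_derivative_def)
  qed
  moreover have "((\<lambda>p. Y (snd p \<bullet> snd p)) has_derivative (\<lambda>h. Y' * (snd p \<bullet> snd h + snd h \<bullet> snd p))) (at p)"
  proof (rule has_derivative_compose[where f = "\<lambda>p. snd p \<bullet> snd p" and g = Y
        and f' = "\<lambda>h. snd p \<bullet> snd h + snd h \<bullet> snd p" and g' = "(*) Y'"])
    show "((\<lambda>p. snd p \<bullet> snd p) has_derivative (\<lambda>h. snd p \<bullet> snd h + snd h \<bullet> snd p)) (at p)"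
      by (auto intro!: derivative_eq_intros)
    show "(Y has_derivative (*) Y') (at (snd p \<bullet> snd p))"
      using assms(2) by (simp add: has_field_derivative_def)
  qed
  ultimately have "((\<lambda>p. A (fst p) * Y (snd p \<bullet> snd p)) has_derivative
      (\<lambda>h. A (fst p) * (Y' * (snd p \<bullet> snd h + snd h \<bullet> snd p)) + A' * fst h * Y (snd p \<bullet> snd p))) (at p)"
    by (rule has_derivative_mult)
  from grad_eqI[OF this]
  show "grad (\<lambda>p. A (fst p) * Y (snd p \<bullet> snd p)) p = (2 * A (fst p) * Y') *\<^sub>R snd p"
    and "dt (\<lambda>p. A (fst p) * Y (snd p \<bullet> snd p)) p = A' * Y (snd p \<bullet> snd p)"
    by (auto simp: vec_eq_iff inner_axis inner_axis' algebra_simps)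
qed

end

lemma borel_measurable_lebesgue_onI: "f \<in> borel_measurable borel \<Longrightarrow> f \<in> borel_measurable (lebesgue_on S)"
  by (intro measurable_restrict_space1 measurable_completion) simp

text \<open>Beside the hypotheses it fixes every auxiliary object, namely the time derivatives and
  fluxes of both solutions, the cutoff, the profile and the exponents p and s, so that the constants
  derived below visibly do not depend on R, \<tau> or h.\<close>

locale fujita_setting =
  fixes a :: "'n::finite \<Rightarrow> 'n \<Rightarrow> 'n spacetime \<Rightarrow> real"
    and A u v ut vt :: "'n spacetime \<Rightarrow> real" and Fu Fv :: "'n spacetime \<Rightarrow> real ^ 'n"
    and \<alpha> q c p B C :: real and \<psi> \<psi>' g g' G :: "real \<Rightarrow> real" and s :: nat
  assumes \<alpha>_pos: "0 < \<alpha>" and q_gt_1: "1 < q" and q_le: "q \<le> 1 + \<alpha> / real CARD('n)"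
    and a_measurable: "\<And>i j. a i j \<in> borel_measurable (lebesgue_on half_space)"
    and a_bounded: "\<And>i j. locally_bounded_on half_space (a i j)"
    and a_psd: "AE x in lebesgue_on half_space. psd_at a x"
    and a_le: "AE x in lebesgue_on half_space. \<forall>\<xi>. coeff_form a x \<xi> \<xi> \<le> A x * (norm \<xi>)\<^sup>2"
    and A_growth: "\<And>R. 1 < R \<Longrightarrow> AE x in lebesgue_on half_space.
      R / 2 < norm (snd x) \<and> norm (snd x) < R \<longrightarrow> A x \<le> c * R powr (2 - \<alpha>)"
    and c_pos: "0 < c"
    and u_loc: "W_loc a q u ut Fu" and v_loc: "W_loc a q v vt Fv"
    and super: "\<And>\<phi>. test_function \<phi> \<Longrightarrow> \<forall>x\<in>half_space. 0 \<le> \<phi> x \<Longrightarrow> 0 \<le> weak_form q u ut Fu \<phi>"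
    and sub: "\<And>\<phi>. test_function \<phi> \<Longrightarrow> \<forall>x\<in>half_space. 0 \<le> \<phi> x \<Longrightarrow> weak_form q v vt Fv \<phi> \<le> 0"
    and v_le_u: "AE x in lebesgue_on half_space. v x \<le> u x"
    and \<psi>_smooth: "\<And>k. Ck_on k UNIV \<psi>" and \<psi>_deriv: "\<And>r. (\<psi> has_real_derivative \<psi>' r) (at r)"
    and \<psi>_nonneg: "\<And>r. 0 \<le> \<psi> r" and \<psi>_le_1: "\<And>r. \<psi> r \<le> 1" and \<psi>'_nonpos: "\<And>r. \<psi>' r \<le> 0"
    and \<psi>'_bound: "\<And>r. \<bar>\<psi>' r\<bar> \<le> B"
    and \<psi>_eq_1: "\<And>r. r \<le> 1/4 \<Longrightarrow> \<psi> r = 1" and \<psi>_eq_0: "\<And>r. 1 \<le> r \<Longrightarrow> \<psi> r = 0"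
    and \<psi>'_eq_0: "\<And>r. r \<le> 1/4 \<or> 1 \<le> r \<Longrightarrow> \<psi>' r = 0"
    and g_smooth: "\<And>k. Ck_on k UNIV g" and g_deriv: "\<And>y. (g has_real_derivative g' y) (at y)"
    and G_deriv: "\<And>y. (G has_real_derivative g y) (at y)" and G_0: "G 0 = 0"
    and g_bounds: "\<And>y. 1 \<le> g y" "\<And>y. g y \<le> 2"
    and g'_neg: "\<And>y. g' y < 0" and g'_bound: "\<And>y. \<bar>g' y\<bar> \<le> C"
    and g'_lower: "\<And>y. 1 / \<bar>g' y\<bar> \<le> C * (1 + \<bar>y\<bar> powr p)" and C_pos: "0 < C"
    and g'_continuous: "continuous_on UNIV g'"
    and p: "1 < p" "p < q" and s: "2 * q / (q - p) \<le> real s"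
begin

section \<open>The cutoff, its weights and the geometry of the cylinders\<close>

definition \<rho> :: "real \<Rightarrow> real \<Rightarrow> real" where "\<rho> \<tau> t = 1 - \<psi> (t / \<tau>)"
text \<open>Time is measured in units of R^\<alpha>, matching the growth R^(2-\<alpha>) of the
  coefficients on |x| ~ R. Using |x|^2 instead of |x| keeps the function smooth at x = 0.\<close>

definition W :: "real \<Rightarrow> 'n spacetime \<Rightarrow> real"
  where "W R x = \<psi> (fst x / R powr \<alpha>) * \<psi> (snd x \<bullet> snd x / R\<^sup>2)"
definition \<zeta> :: "real \<Rightarrow> real \<Rightarrow> 'n spacetime \<Rightarrow> real"
  where "\<zeta> R \<tau> x = \<rho> \<tau> (fst x) * W R x ^ s"
definition N :: "real \<Rightarrow> 'n spacetime set"
  where "N R = {x. R powr \<alpha> / 4 < fst x \<or> R / 2 < norm (snd x)}"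
text \<open>Two powers of W fewer than in \<zeta>: this is what the derivatives lose. The factor
  \<open>\<rho> \<tau> (fst x)\<close> keeps power one, so that it can be cancelled against the one
  in \<iota>.\<close>

definition \<omega> :: "real \<Rightarrow> real \<Rightarrow> 'n spacetime \<Rightarrow> real"
  where "\<omega> R \<tau> x = indicator (N R) x * (\<rho> \<tau> (fst x) * W R x ^ (s - 2))"
definition \<iota> :: "real \<Rightarrow> real \<Rightarrow> 'n spacetime \<Rightarrow> real"
  where "\<iota> R \<tau> x = indicator (N R) x * \<zeta> R \<tau> x"
text \<open>Twice the size of the support, which leaves an open margin around the compact set
  \<open>K R \<tau>\<close>.\<close>

definition D :: "real \<Rightarrow> 'n spacetime set"
  where "D R = {0<..<2 * R powr \<alpha>} \<times> ball 0 (2 * R)"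
definition K :: "real \<Rightarrow> real \<Rightarrow> 'n spacetime set"
  where "K R \<tau> = {\<tau> / 4 .. R powr \<alpha>} \<times> cball 0 R"
text \<open>The first summand comes from the time derivative of W^s, the second from the energy,
  with 4 = 2^2 from the gradient of |x|^2.\<close>

definition \<beta>\<^sub>0 :: real where "\<beta>\<^sub>0 = real s * B + 4 * c * (real s)\<^sup>2 * B\<^sup>2"
definition \<beta> :: "real \<Rightarrow> real" where "\<beta> R = \<beta>\<^sub>0 * R powr - \<alpha>"
definition w :: "'n spacetime \<Rightarrow> real" where "w x = u x - v x"

lemma s_gt_2: "2 < s"
proof -
  have "2 < 2 * q / (q - p)" using p by (simp add: field_simps)
  then show ?thesis using s by linarith
qed

lemma B_nonneg: "0 \<le> B"
  by (rule order_trans[OF abs_ge_zero \<psi>'_bound])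

lemma \<beta>\<^sub>0_nonneg: "0 \<le> \<beta>\<^sub>0"
  using B_nonneg c_pos by (simp add: \<beta>\<^sub>0_def)

lemma \<rho>_bounds: "0 \<le> \<rho> \<tau> t" "\<rho> \<tau> t \<le> 1"
  using \<psi>_nonneg \<psi>_le_1 by (simp_all add: \<rho>_def)

lemma W_bounds: "0 \<le> W R x" "W R x \<le> 1"
  using \<psi>_nonneg \<psi>_le_1 by (simp_all add: W_def mult_le_one)

lemma \<zeta>_bounds: "0 \<le> \<zeta> R \<tau> x" "\<zeta> R \<tau> x \<le> 1"
  using \<rho>_bounds W_bounds by (simp_all add: \<zeta>_def mult_le_one power_le_one)

lemma \<omega>_bounds: "0 \<le> \<omega> R \<tau> x" "\<omega> R \<tau> x \<le> 1"
  using \<rho>_bounds W_bounds by (simp_all add: \<omega>_def indicator_def mult_le_one power_le_one)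

lemma \<iota>_bounds: "0 \<le> \<iota> R \<tau> x" "\<iota> R \<tau> x \<le> 1"
  using \<zeta>_bounds by (simp_all add: \<iota>_def indicator_def)

lemma \<psi>_scaled_Ck: "Ck_on k UNIV (\<lambda>t. \<psi> (t / r))"
  by (rule Ck_on_compose[OF open_UNIV open_UNIV UNIV_I
        Ck_on_bounded_linear[OF open_UNIV bounded_linear_divide] \<psi>_smooth])

lemma \<psi>_scaled_deriv: "((\<lambda>t. \<psi> (t / r)) has_real_derivative \<psi>' (t / r) / r) (at t)"
  using DERIV_chain2[OF \<psi>_deriv DERIV_cdivide[OF DERIV_ident], of r t] by simp

definition time_cutoff :: "real \<Rightarrow> real \<Rightarrow> real \<Rightarrow> real"
  where "time_cutoff R \<tau> t = \<rho> \<tau> t * \<psi> (t / R powr \<alpha>) ^ s"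
definition space_cutoff :: "real \<Rightarrow> real \<Rightarrow> real"
  where "space_cutoff R r = \<psi> (r / R\<^sup>2) ^ s"

lemma \<zeta>_separated: "\<zeta> R \<tau> = (\<lambda>x. time_cutoff R \<tau> (fst x) * space_cutoff R (snd x \<bullet> snd x))"
  by (simp add: fun_eq_iff \<zeta>_def W_def time_cutoff_def space_cutoff_def power_mult_distrib)

lemma \<zeta>_smooth: "Ck_on k UNIV (\<zeta> R \<tau>)"
proof -
  have "Ck_on k UNIV (time_cutoff R \<tau>)"
    unfolding time_cutoff_def[abs_def] \<rho>_def
    by (rule Ck_on_mult[OF open_UNIV Ck_on_diff[OF open_UNIV Ck_on_const[OF open_UNIV] \<psi>_scaled_Ck]
          Ck_on_power[OF open_UNIV \<psi>_scaled_Ck]])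
  moreover have "Ck_on k UNIV (space_cutoff R)"
    unfolding space_cutoff_def[abs_def] by (rule Ck_on_power[OF open_UNIV \<psi>_scaled_Ck])
  ultimately show ?thesis unfolding \<zeta>_separated by (rule Ck_on_separated)
qed

lemma time_cutoff_deriv:
  "(time_cutoff R \<tau> has_real_derivative - (\<psi>' (t / \<tau>) / \<tau>) * \<psi> (t / R powr \<alpha>) ^ s
    + \<rho> \<tau> t * (real s * \<psi> (t / R powr \<alpha>) ^ (s - 1) * (\<psi>' (t / R powr \<alpha>) / R powr \<alpha>))) (at t)"
proof -
  have "((\<lambda>t. \<psi> (t / R powr \<alpha>) ^ s) has_real_derivative
      real s * (\<psi>' (t / R powr \<alpha>) / R powr \<alpha> * \<psi> (t / R powr \<alpha>) ^ (s - Suc 0))) (at t)"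
    by (rule DERIV_power[OF \<psi>_scaled_deriv])
  moreover have "(\<rho> \<tau> has_real_derivative 0 - \<psi>' (t / \<tau>) / \<tau>) (at t)"
    unfolding \<rho>_def[abs_def] by (rule DERIV_diff[OF DERIV_const \<psi>_scaled_deriv])
  ultimately have "(time_cutoff R \<tau> has_real_derivative
      (0 - \<psi>' (t / \<tau>) / \<tau>) * \<psi> (t / R powr \<alpha>) ^ s
      + real s * (\<psi>' (t / R powr \<alpha>) / R powr \<alpha> * \<psi> (t / R powr \<alpha>) ^ (s - Suc 0)) * \<rho> \<tau> t) (at t)"
    unfolding time_cutoff_def[abs_def] by (intro DERIV_mult)
  then show ?thesis by (simp add: mult_ac)
qed

lemma space_cutoff_deriv:
  "(space_cutoff R has_real_derivative real s * \<psi> (r / R\<^sup>2) ^ (s - 1) * (\<psi>' (r / R\<^sup>2) / R\<^sup>2)) (at r)"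
  using DERIV_power[OF \<psi>_scaled_deriv[of "R\<^sup>2" r], of s] unfolding space_cutoff_def[abs_def]
  by (simp add: mult_ac)

lemma grad_\<zeta>: "grad (\<zeta> R \<tau>) x = (2 * time_cutoff R \<tau> (fst x) *
    (real s * \<psi> (snd x \<bullet> snd x / R\<^sup>2) ^ (s - 1) * (\<psi>' (snd x \<bullet> snd x / R\<^sup>2) / R\<^sup>2))) *\<^sub>R snd x"
  unfolding \<zeta>_separated by (rule grad_separated[OF time_cutoff_deriv space_cutoff_deriv])

lemma dt_\<zeta>: "dt (\<zeta> R \<tau>) x = (- (\<psi>' (fst x / \<tau>) / \<tau>) * \<psi> (fst x / R powr \<alpha>) ^ s
    + \<rho> \<tau> (fst x) * (real s * \<psi> (fst x / R powr \<alpha>) ^ (s - 1) * (\<psi>' (fst x / R powr \<alpha>) / R powr \<alpha>)))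
    * space_cutoff R (snd x \<bullet> snd x)"
  unfolding \<zeta>_separated by (rule dt_separated[OF time_cutoff_deriv space_cutoff_deriv])

text \<open>\<open>weighted_powr_le\<close> with W, multiplied by the common factor of \<omega> and
  \<iota>, which lies between 0 and 1. The exponents r = 1 and r = p serve the time term and the
  elliptic term.\<close>

lemma weights:
  assumes "0 \<le> y" "1 \<le> r" "r \<le> p"
  shows "y powr r * \<omega> R \<tau> x \<le> y powr q * \<iota> R \<tau> x + 1"
proof -
  have "2 * q / (q - r) \<le> 2 * q / (q - p)"
    using assms p by (intro divide_left_mono) auto
  then have "2 * q / (q - r) \<le> real s" using s by linarith
  then have *: "y powr r * W R x ^ (s - 2) \<le> y powr q * W R x ^ s + 1"
    using assms p by (intro weighted_powr_le W_bounds) auto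
  let ?i = "indicator (N R) x * \<rho> \<tau> (fst x)"
  have i: "0 \<le> ?i" "?i \<le> 1" using \<rho>_bounds by (simp_all add: indicator_def)
  have "y powr r * \<omega> R \<tau> x = ?i * (y powr r * W R x ^ (s - 2))"
    by (simp add: \<omega>_def)
  also have "\<dots> \<le> ?i * (y powr q * W R x ^ s + 1)"
    by (rule mult_left_mono[OF * i(1)])
  also have "\<dots> = y powr q * \<iota> R \<tau> x + ?i"
    by (simp add: \<iota>_def \<zeta>_def algebra_simps)
  finally show ?thesis using i(2) by simp
qed

context
  fixes R \<tau> :: real
  assumes R: "1 < R" and \<tau>: "0 < \<tau>"
begin

lemma R_powr_pos: "0 < R powr \<alpha>"
  using R by simp

lemma domain_D: "open (D R)" "bounded (D R)" "D R \<subseteq> half_space" "bounded_domain (D R)"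
proof -
  show 1: "open (D R)" "bounded (D R)" "D R \<subseteq> half_space"
    unfolding D_def half_space_def by (auto intro!: open_Times bounded_Times)
  have "connected (D R)"
    unfolding D_def by (intro connected_Times convex_connected) auto
  moreover have "D R \<noteq> {}"
  proof -
    have "(R powr \<alpha>, 0) \<in> D R" using R_powr_pos R by (simp add: D_def)
    then show ?thesis by blast
  qed
  ultimately show "bounded_domain (D R)" using 1 by (simp add: bounded_domain_def)
qed

lemma compact_K: "compact (K R \<tau>)" "K R \<tau> \<subseteq> D R"
  using R_powr_pos R \<tau> unfolding K_def D_def by (auto intro!: compact_Times)

lemma \<zeta>_eq_0:
  assumes "x \<notin> K R \<tau>"
  shows "\<zeta> R \<tau> x = 0"
proof -
  consider "fst x < \<tau> / 4" | "R powr \<alpha> < fst x" | "R < norm (snd x)"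
    using assms by (cases x) (auto simp: K_def not_le)
  then show ?thesis
  proof cases
    case 1
    then have "fst x / \<tau> \<le> 1 / 4" using \<tau> by (simp add: field_simps)
    then show ?thesis by (simp add: \<zeta>_def \<rho>_def \<psi>_eq_1)
  next
    case 2
    then have "1 \<le> fst x / R powr \<alpha>" using R_powr_pos by (simp add: field_simps)
    then show ?thesis using s_gt_2 by (simp add: \<zeta>_def W_def \<psi>_eq_0)
  next
    case 3
    then have "R\<^sup>2 \<le> snd x \<bullet> snd x"
      unfolding power2_norm_eq_inner[symmetric] using R by (intro power_mono) auto
    then have "1 \<le> snd x \<bullet> snd x / R\<^sup>2" using R by simp
    then show ?thesis using s_gt_2 by (simp add: \<zeta>_def W_def \<psi>_eq_0)
  qed
qed

text \<open>The derivative of the initial rise is of order 1 / \<tau>, but has a favourable sign and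
  is dropped; hence the bound is uniform in \<tau>. The decay in time takes place inside
  \<open>N R\<close> and costs one power of W, and at most two are given away.\<close>

lemma dt_\<zeta>_ge: "- dt (\<zeta> R \<tau>) x \<le> \<beta> R * \<omega> R \<tau> x"
proof -
  let ?T = "R powr \<alpha>"
  let ?p1 = "\<psi> (fst x / ?T)" and ?p2 = "\<psi> (snd x \<bullet> snd x / R\<^sup>2)" and ?d = "\<psi>' (fst x / ?T)"
  let ?X = "\<rho> \<tau> (fst x)"
  have "- dt (\<zeta> R \<tau>) x = (\<psi>' (fst x / \<tau>) / \<tau>) * ?p1 ^ s * ?p2 ^ s
      + ?X * (real s * ?p1 ^ (s - 1) * (- ?d / ?T)) * ?p2 ^ s"
    unfolding dt_\<zeta> space_cutoff_def by (simp add: algebra_simps)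
  also have "(\<psi>' (fst x / \<tau>) / \<tau>) * ?p1 ^ s * ?p2 ^ s \<le> 0"
    using \<psi>'_nonpos[of "fst x / \<tau>"] \<tau> \<psi>_nonneg
    by (intro mult_nonpos_nonneg divide_nonpos_pos) auto
  also have "0 + ?X * (real s * ?p1 ^ (s - 1) * (- ?d / ?T)) * ?p2 ^ s \<le> \<beta> R * \<omega> R \<tau> x"
  proof (cases "fst x \<le> ?T / 4")
    case True
    then have "fst x / ?T \<le> 1/4" using R_powr_pos by (simp add: field_simps)
    then have "?d = 0" by (simp add: \<psi>'_eq_0)
    then show ?thesis
      using \<beta>\<^sub>0_nonneg \<omega>_bounds(1) by (simp add: \<beta>_def)
  next
    case False
    then have N: "x \<in> N R" by (simp add: N_def)
    have "real s * ?p1 ^ (s - 1) * (- ?d / ?T) * ?p2 ^ s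
        \<le> real s * ?p1 ^ (s - 2) * (B / ?T) * ?p2 ^ (s - 2)"
    proof (intro mult_mono)
      show "?p1 ^ (s - 1) \<le> ?p1 ^ (s - 2)" "?p2 ^ s \<le> ?p2 ^ (s - 2)"
        using \<psi>_nonneg \<psi>_le_1 by (auto intro!: power_decreasing)
      show "- ?d / ?T \<le> B / ?T"
        using \<psi>'_bound[of "fst x / ?T"] R_powr_pos by (intro divide_right_mono) auto
    qed (use \<psi>_nonneg B_nonneg \<psi>'_nonpos R_powr_pos in \<open>auto intro!: mult_nonneg_nonneg divide_nonpos_nonneg\<close>)
    also have "\<dots> = (real s * B * R powr - \<alpha>) * W R x ^ (s - 2)"
      using R by (simp add: W_def power_mult_distrib powr_minus divide_inverse)
    also have "\<dots> \<le> \<beta> R * W R x ^ (s - 2)"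
      unfolding \<beta>_def \<beta>\<^sub>0_def using c_pos W_bounds by (intro mult_right_mono) auto
    finally have "?X * (real s * ?p1 ^ (s - 1) * (- ?d / ?T) * ?p2 ^ s) \<le> ?X * (\<beta> R * W R x ^ (s - 2))"
      by (rule mult_left_mono) (rule \<rho>_bounds)
    then show ?thesis using N by (simp add: \<omega>_def mult_ac)
  qed
  finally show ?thesis by simp
qed

text \<open>The spatial gradient lives in the annulus where A <= c R^(2-\<alpha>), and its square is
  of order R^(-2), which gives R^(-\<alpha>). The squared cutoff splits into one factor \<omega> and
  one factor \<zeta>.\<close>

lemma energy_\<zeta>_le:
  assumes "\<And>\<xi>. coeff_form a x \<xi> \<xi> \<le> A x * (norm \<xi>)\<^sup>2"
    and "R / 2 < norm (snd x) \<and> norm (snd x) < R \<Longrightarrow> A x \<le> c * R powr (2 - \<alpha>)"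
  shows "coeff_form a x (grad (\<zeta> R \<tau>) x) (grad (\<zeta> R \<tau>) x) \<le> \<beta> R * \<omega> R \<tau> x * \<zeta> R \<tau> x"
proof -
  let ?r = "snd x \<bullet> snd x / R\<^sup>2"
  let ?p1 = "\<psi> (fst x / R powr \<alpha>)" and ?p2 = "\<psi> ?r" and ?X = "\<rho> \<tau> (fst x)"
  let ?Y = "real s * ?p2 ^ (s - 1) * (\<psi>' ?r / R\<^sup>2)"
  have gr: "grad (\<zeta> R \<tau>) x = (2 * (?X * ?p1 ^ s) * ?Y) *\<^sub>R snd x"
    by (simp add: grad_\<zeta> time_cutoff_def)
  have rhs: "0 \<le> \<beta> R * \<omega> R \<tau> x * \<zeta> R \<tau> x"
    using \<beta>\<^sub>0_nonneg \<omega>_bounds \<zeta>_bounds by (simp add: \<beta>_def)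
  show ?thesis
  proof (cases "?r \<le> 1/4 \<or> 1 \<le> ?r")
    case True
    then have "\<psi>' ?r = 0" by (rule \<psi>'_eq_0)
    then have "grad (\<zeta> R \<tau>) x = 0" unfolding gr by simp
    then show ?thesis using rhs by (simp add: coeff_form_simps)
  next
    case False
    then have "(R / 2)\<^sup>2 < (norm (snd x))\<^sup>2" "(norm (snd x))\<^sup>2 < R\<^sup>2"
      using R unfolding power2_norm_eq_inner by (simp_all add: field_simps power2_eq_square)
    then have n: "R / 2 < norm (snd x)" "norm (snd x) < R"
      using R power2_less_imp_less[of "R / 2" "norm (snd x)"] power2_less_imp_less[of "norm (snd x)" R]
      by simp_all
    then have N: "x \<in> N R" by (simp add: N_def)
    \<comment> \<open>The spatial factor has been differentiated, so its exponents match exactly;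
      the temporal one has not, and two of its powers are simply given away.\<close>
    have s2: "?p2 ^ (s - 1) * ?p2 ^ (s - 1) = ?p2 ^ (s - 2) * ?p2 ^ s"
      "?p1 ^ s * ?p1 ^ s \<le> ?p1 ^ (s - 2) * ?p1 ^ s"
    proof -
      have "(s - 1) + (s - 1) = (s - 2) + s" using s_gt_2 by simp
      then show "?p2 ^ (s - 1) * ?p2 ^ (s - 1) = ?p2 ^ (s - 2) * ?p2 ^ s"
        by (simp only: power_add[symmetric])
      show "?p1 ^ s * ?p1 ^ s \<le> ?p1 ^ (s - 2) * ?p1 ^ s"
        using \<psi>_nonneg \<psi>_le_1 by (intro mult_right_mono power_decreasing) auto
    qed
    have "coeff_form a x (grad (\<zeta> R \<tau>) x) (grad (\<zeta> R \<tau>) x) \<le> A x * (norm (grad (\<zeta> R \<tau>) x))\<^sup>2"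
      by (rule assms(1))
    also have "\<dots> \<le> c * R powr (2 - \<alpha>) * (norm (grad (\<zeta> R \<tau>) x))\<^sup>2"
      using assms(2) n by (intro mult_right_mono) auto
    also have "(norm (grad (\<zeta> R \<tau>) x))\<^sup>2 = (2 * (?X * ?p1 ^ s) * ?Y)\<^sup>2 * (norm (snd x))\<^sup>2"
      by (simp only: gr norm_scaleR power_mult_distrib power2_abs)
    also have "\<dots> \<le> (2 * (?X * ?p1 ^ s) * ?Y)\<^sup>2 * R\<^sup>2"
      using n R by (intro mult_left_mono power_mono) auto
    also have "\<dots> = 4 * (real s)\<^sup>2 * (\<psi>' ?r)\<^sup>2 / R\<^sup>2 * (?X * ?X * ((?p1 ^ s * ?p1 ^ s) * (?p2 ^ (s - 1) * ?p2 ^ (s - 1))))"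
      using R by (simp add: power2_eq_square field_simps)
    also have "\<dots> \<le> 4 * (real s)\<^sup>2 * B\<^sup>2 / R\<^sup>2 * (?X * ?X * ((?p1 ^ (s - 2) * ?p1 ^ s) * (?p2 ^ (s - 2) * ?p2 ^ s)))"
    proof -
      have "(\<psi>' ?r)\<^sup>2 \<le> B\<^sup>2"
        using power_mono[OF \<psi>'_bound[of ?r] abs_ge_zero, of 2] by simp
      then have "4 * (real s)\<^sup>2 * (\<psi>' ?r)\<^sup>2 / R\<^sup>2 \<le> 4 * (real s)\<^sup>2 * B\<^sup>2 / R\<^sup>2"
        by (intro divide_right_mono mult_left_mono) auto
      moreover have "?X * ?X * ((?p1 ^ s * ?p1 ^ s) * (?p2 ^ (s - 1) * ?p2 ^ (s - 1)))
          \<le> ?X * ?X * ((?p1 ^ (s - 2) * ?p1 ^ s) * (?p2 ^ (s - 2) * ?p2 ^ s))"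
        unfolding s2(1) using \<rho>_bounds \<psi>_nonneg by (intro mult_left_mono mult_right_mono s2(2)) auto
      ultimately show ?thesis
        by (rule mult_mono) (use \<rho>_bounds \<psi>_nonneg in simp_all)
    qed
    also have "?X * ?X * ((?p1 ^ (s - 2) * ?p1 ^ s) * (?p2 ^ (s - 2) * ?p2 ^ s)) = \<omega> R \<tau> x * \<zeta> R \<tau> x"
      using N by (simp add: \<omega>_def \<zeta>_def W_def power_mult_distrib mult_ac)
    finally have "coeff_form a x (grad (\<zeta> R \<tau>) x) (grad (\<zeta> R \<tau>) x)
        \<le> c * R powr (2 - \<alpha>) * (4 * (real s)\<^sup>2 * B\<^sup>2 / R\<^sup>2 * (\<omega> R \<tau> x * \<zeta> R \<tau> x))"
      using c_pos by (simp add: mult_left_mono)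
    also have "\<dots> = (4 * c * (real s)\<^sup>2 * B\<^sup>2) * R powr - \<alpha> * (\<omega> R \<tau> x * \<zeta> R \<tau> x)"
    proof -
      have "R powr (2 - \<alpha>) = R powr - \<alpha> * R\<^sup>2"
        using R powr_add[of R "- \<alpha>" 2] by (simp add: powr_numeral)
      then show ?thesis using R by (simp add: field_simps)
    qed
    also have "\<dots> \<le> \<beta>\<^sub>0 * R powr - \<alpha> * (\<omega> R \<tau> x * \<zeta> R \<tau> x)"
      unfolding \<beta>\<^sub>0_def using B_nonneg \<omega>_bounds \<zeta>_bounds by (intro mult_right_mono) auto
    finally show ?thesis by (simp add: \<beta>_def mult.assoc)
  qed
qed

lemma diffusion_domain_D: "diffusion_domain a (D R) q"
  by unfold_locales (rule a_measurable a_bounded a_psd domain_D(1-3) q_gt_1)+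

lemma \<zeta>_continuous: "continuous_on UNIV (\<zeta> R \<tau>)"
  by (rule Ck_on_imp_continuous_on[OF \<zeta>_smooth[of 0]])

lemma open_N: "open (N R)"
proof -
  have eq: "N R = {x. R powr \<alpha> / 4 < fst x} \<union> {x. R / 2 < norm (snd x)}"
    by (auto simp: N_def)
  show ?thesis unfolding eq
    by (intro open_Un open_Collect_less continuous_intros)
qed

lemma \<zeta>_measurable: "\<zeta> R \<tau> \<in> borel_measurable (lebesgue_on S)"
  by (rule borel_measurable_lebesgue_onI[OF borel_measurable_continuous_onI[OF \<zeta>_continuous]])

lemma \<iota>_measurable: "\<iota> R \<tau> \<in> borel_measurable (lebesgue_on S)"
proof (rule borel_measurable_lebesgue_onI)
  have "indicator (N R) \<in> borel_measurable (borel :: 'n spacetime measure)"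
    using open_N by (simp add: borel_measurable_indicator borel_open)
  then show "\<iota> R \<tau> \<in> borel_measurable borel"
    unfolding \<iota>_def[abs_def] using borel_measurable_continuous_onI[OF \<zeta>_continuous]
    by (rule borel_measurable_times)
qed

lemma \<omega>_measurable: "\<omega> R \<tau> \<in> borel_measurable (lebesgue_on S)"
proof (rule borel_measurable_lebesgue_onI)
  have ind: "indicator (N R) \<in> borel_measurable (borel :: 'n spacetime measure)"
    using open_N by (simp add: borel_measurable_indicator borel_open)
  have c\<psi>: "continuous_on UNIV \<psi>"
    by (rule Ck_on_imp_continuous_on[OF \<psi>_smooth[of 0]])
  have "continuous_on UNIV (\<lambda>x::'n spacetime. \<rho> \<tau> (fst x) * W R x ^ (s - 2))"
    unfolding \<rho>_def W_def using R \<tau> R_powr_pos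
    by (intro continuous_intros continuous_on_compose2[OF c\<psi>]) auto
  from borel_measurable_times[OF ind borel_measurable_continuous_onI[OF this]]
  show "\<omega> R \<tau> \<in> borel_measurable borel" unfolding \<omega>_def[abs_def] .
qed

text \<open>The ball is enclosed in a cube of side 4 R; only the order R^(\<alpha>+n)
  matters.\<close>

lemma measure_D_le: "measure lebesgue (D R) \<le> 2 * R powr \<alpha> * (4 * R) ^ CARD('n)"
proof -
  let ?c = "cbox (0::real, (\<chi> i. - (2 * R)) :: real ^ 'n) (2 * R powr \<alpha>, (\<chi> i. 2 * R))"
  have "D R \<subseteq> ?c"
  proof
    fix x assume x: "x \<in> D R"
    have "\<bar>snd x $ i\<bar> \<le> 2 * R" for i
      using component_le_norm_cart[of "snd x" i] x by (auto simp: D_def)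
    then have "- (2 * R) \<le> snd x $ i \<and> snd x $ i \<le> 2 * R" for i
      by (simp add: abs_le_iff minus_le_iff)
    then show "x \<in> ?c" using x by (cases x) (auto simp: D_def cbox_Pair_eq mem_box_cart)
  qed
  then have "measure lebesgue (D R) \<le> measure lebesgue ?c"
    using domain_D(1,2) by (intro measure_mono_fmeasurable) (auto intro: fmeasurableD lmeasurable_open)
  also have "\<dots> = measure lborel (cbox 0 (2 * R powr \<alpha>)) * measure lborel (cbox ((\<chi> i. - (2 * R)) :: real ^ 'n) (\<chi> i. 2 * R))"
    by (simp add: content_Pair)
  also have "\<dots> = 2 * R powr \<alpha> * (4 * R) ^ CARD('n)"
  proof -
    have "cbox ((\<chi> i. - (2 * R)) :: real ^ 'n) (\<chi> i. 2 * R) \<noteq> {}"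
      using R by (simp add: interval_ne_empty_cart)
    then show ?thesis using R by (simp add: content_cbox_cart)
  qed
  finally show ?thesis .
qed

end

section \<open>The estimate on one cylinder and the choice of \<kappa>\<close>

abbreviation w_integral :: "('n spacetime \<Rightarrow> real) \<Rightarrow> real"
  where "w_integral f \<equiv> integral\<^sup>L (lebesgue_on half_space) (\<lambda>x. \<bar>w x\<bar> powr q * f x)"

lemma key_estimate_domain:
  assumes R: "1 < R" and \<tau>: "0 < \<tau>" and \<kappa>: "0 < \<kappa>"
  shows "2 powr (- q) * w_integral (\<zeta> R \<tau>) \<le> (2 + 2 * C * 2 powr q) * \<beta> R *
      (\<kappa> powr (1 - q) * w_integral (\<iota> R \<tau>) + \<kappa> * measure lebesgue (D R))"
    and "integrable (lebesgue_on half_space) (\<lambda>x. \<bar>w x\<bar> powr q * \<zeta> R \<tau> x)"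
proof -
  note dom = domain_D[OF R \<tau>]
  interpret diffusion_domain a "D R" q by (rule diffusion_domain_D[OF R \<tau>])
  \<comment> \<open>The approximants depend on R, while time derivatives and fluxes are common to
    all domains; the conclusion mentions only w, so different R remain comparable.\<close>
  obtain su where su: "approximates u ut Fu su"
    using W_element_approximates u_loc dom(4) unfolding W_loc_def by metis
  obtain sv where sv: "approximates v vt Fv sv"
    using W_element_approximates v_loc dom(4) unfolding W_loc_def by metis
  have w: "approximates w (\<lambda>x. ut x - vt x) (\<lambda>x. Fu x - Fv x) (\<lambda>k x. su k x - sv k x)"
    using approximates_diff[OF su sv] unfolding w_def[abs_def] .
  have le: "AE x in M. v x \<le> u x"
    by (rule AE_lebesgue_on_subset[OF v_le_u D_half_space sets_D sets_half_space])
  interpret S: scaled_setting a "D R" q w "\<lambda>x. ut x - vt x" "\<lambda>x. Fu x - Fv x" "\<lambda>k x. su k x - sv k x"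
    "\<zeta> R \<tau>" "\<omega> R \<tau>" "\<iota> R \<tau>" "K R \<tau>" g g' G C p "\<beta> R" "2 powr (- q)"
  proof (unfold_locales)
    show "AE x in M. 0 \<le> w x" using le by (rule eventually_mono) (simp add: w_def)
    show "Ck_on k UNIV (\<zeta> R \<tau>)" for k by (rule \<zeta>_smooth)
    show "y * \<omega> R \<tau> x \<le> y powr q * \<iota> R \<tau> x + 1" if "0 \<le> y" for x y
      using weights[OF that, of 1 R \<tau> x] p that by simp
    show "y powr p * \<omega> R \<tau> x \<le> y powr q * \<iota> R \<tau> x + 1" if "0 \<le> y" for x y
      using weights[OF that, of p R \<tau> x] p by simp
    show "0 \<le> \<beta> R" using \<beta>\<^sub>0_nonneg by (simp add: \<beta>_def)
    show "AE x in M. energy (\<zeta> R \<tau>) x \<le> \<beta> R * \<omega> R \<tau> x * \<zeta> R \<tau> x"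
    proof -
      have "AE x in M. \<forall>\<xi>. coeff_form a x \<xi> \<xi> \<le> A x * (norm \<xi>)\<^sup>2"
        by (rule AE_lebesgue_on_subset[OF a_le D_half_space sets_D sets_half_space])
      moreover have "AE x in M. R / 2 < norm (snd x) \<and> norm (snd x) < R \<longrightarrow> A x \<le> c * R powr (2 - \<alpha>)"
        by (rule AE_lebesgue_on_subset[OF A_growth[OF R] D_half_space sets_D sets_half_space])
      ultimately show ?thesis
        by eventually_elim (rule energy_\<zeta>_le[OF R \<tau>], auto)
    qed
    show "- dt (\<zeta> R \<tau>) x \<le> \<beta> R * \<omega> R \<tau> x" for x by (rule dt_\<zeta>_ge[OF R \<tau>])
    show "2 powr (- q) * (\<integral>x. \<bar>w x\<bar> powr q * \<phi> x \<partial>M)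
        \<le> (\<integral>x. (ut x - vt x) * \<phi> x \<partial>M) + (\<integral>x. grad \<phi> x \<bullet> (Fu x - Fv x) \<partial>M)"
      if "test_function \<phi>" "\<And>x. 0 \<le> \<phi> x" "\<And>x. x \<notin> K R \<tau> \<Longrightarrow> \<phi> x = 0" for \<phi>
      unfolding w_def
      by (rule weak_difference_inequality[OF su sv super[OF that(1)] sub[OF that(1)] le that(1) _
            compact_K[OF R \<tau>]]) (use that in simp_all)
  qed (use w \<zeta>_bounds \<zeta>_eq_0[OF R \<tau>] compact_K[OF R \<tau>] \<omega>_measurable[OF R \<tau>] \<omega>_bounds \<iota>_measurable[OF R \<tau>]
      \<iota>_bounds p g_smooth g_deriv G_deriv G_0 g_bounds g'_neg g'_bound g'_lower C_pos g'_continuous in simp_all)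
  \<comment> \<open>\<zeta> and \<iota> vanish off the cylinder, so integrals over it are integrals
    over the half-space, independent of R as a domain.\<close>
  have out: "\<zeta> R \<tau> x = 0" if "x \<notin> D R" for x
    using \<zeta>_eq_0[OF R \<tau>] compact_K(2)[OF R \<tau>] that by blast
  have "w_integral f = (\<integral>x. \<bar>w x\<bar> powr q * f x \<partial>M)" if "\<And>x. x \<notin> D R \<Longrightarrow> f x = 0" for f
    by (rule integral_lebesgue_on_superset[OF D_half_space sets_D sets_half_space]) (use that in simp)
  from this[of "\<zeta> R \<tau>"] this[of "\<iota> R \<tau>"]
  show "2 powr (- q) * w_integral (\<zeta> R \<tau>) \<le> (2 + 2 * C * 2 powr q) * \<beta> R *
      (\<kappa> powr (1 - q) * w_integral (\<iota> R \<tau>) + \<kappa> * measure lebesgue (D R))"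
    using S.scaled_estimate[OF \<kappa>] out by (simp add: \<iota>_def)
  have "integrable M (\<lambda>x. \<bar>w x\<bar> powr q * \<zeta> R \<tau> x)"
    by (rule integrable_mult_bounded[OF approximates_integrable(1)[OF w] \<zeta>_measurable[OF R \<tau>], of 1])
      (simp add: \<zeta>_bounds)
  then have "integrable lebesgue (\<lambda>x. indicator (D R) x *\<^sub>R (\<bar>w x\<bar> powr q * \<zeta> R \<tau> x))"
    using sets_D by (simp add: integrable_restrict_space)
  also have "(\<lambda>x. indicator (D R) x *\<^sub>R (\<bar>w x\<bar> powr q * \<zeta> R \<tau> x))
      = (\<lambda>x. indicator half_space x *\<^sub>R (\<bar>w x\<bar> powr q * \<zeta> R \<tau> x))"
    using out D_half_space by (auto simp: fun_eq_iff indicator_def)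
  finally show "integrable (lebesgue_on half_space) (\<lambda>x. \<bar>w x\<bar> powr q * \<zeta> R \<tau> x)"
    using sets_half_space by (simp add: integrable_restrict_space)
qed

lemma key_estimate:
  "\<exists>L>0. \<forall>R \<tau> h. 1 < R \<longrightarrow> 0 < \<tau> \<longrightarrow> 0 < h \<longrightarrow>
    w_integral (\<zeta> R \<tau>) \<le> L * (h powr (1 - q) * w_integral (\<iota> R \<tau>) + h)"
proof -
  let ?n = "CARD('n)"
  \<comment> \<open>2^q undoes the constant on the left of the estimate; + 1 makes the product
    positive, as \<open>\<beta>\<^sub>0\<close> is only known to be nonnegative. \<open>?V\<close>
    is the constant of \<open>measure_D_le\<close>.\<close>
  let ?L0 = "2 powr q * (2 + 2 * C * 2 powr q) * (\<beta>\<^sub>0 + 1)" and ?V = "2 * 4 ^ ?n :: real"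
  have L0: "0 < ?L0"
    using C_pos \<beta>\<^sub>0_nonneg by (intro mult_pos_pos) (auto intro: add_pos_nonneg)
  have V: "1 \<le> ?V" using one_le_power[of "4::real" ?n] by linarith
  show ?thesis
  proof (intro exI[of _ "?L0 * ?V"] conjI allI impI)
    show "0 < ?L0 * ?V" using L0 V by simp
    fix R \<tau> h :: real assume R: "1 < R" and \<tau>: "0 < \<tau>" and h: "0 < h"
    \<comment> \<open>Cancels the R^n that remains of the volume after multiplication by
      R^(-\<alpha>).\<close>
    define \<kappa> where "\<kappa> = h * R powr - real ?n"
    have \<kappa>: "0 < \<kappa>" using h R by (simp add: \<kappa>_def)
    define J where "J = w_integral (\<iota> R \<tau>)"
    have J: "0 \<le> J" unfolding J_def by (intro integral_nonneg_AE) (simp add: \<iota>_bounds)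
    have e1: "R powr - \<alpha> * \<kappa> powr (1 - q) \<le> h powr (1 - q)"
    proof -
      have "\<kappa> powr (1 - q) = h powr (1 - q) * R powr (real ?n * (q - 1))"
      proof -
        have "\<kappa> powr (1 - q) = h powr (1 - q) * R powr (- real ?n * (1 - q))"
          unfolding \<kappa>_def using h R by (simp only: powr_mult powr_powr)
        moreover have "- real ?n * (1 - q) = real ?n * (q - 1)" by algebra
        ultimately show ?thesis by simp
      qed
      then have "R powr - \<alpha> * \<kappa> powr (1 - q) = h powr (1 - q) * (R powr (real ?n * (q - 1)) * R powr - \<alpha>)"
        by simp
      then have "R powr - \<alpha> * \<kappa> powr (1 - q) = h powr (1 - q) * R powr (real ?n * (q - 1) - \<alpha>)"
        unfolding powr_add[symmetric] by simp
      \<comment> \<open>The one place where the bound on q is used: the exponent n (q - 1) -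
        \<alpha> is at most 0.\<close>
      moreover have "R powr (real ?n * (q - 1) - \<alpha>) \<le> 1"
      proof -
        have "q - 1 \<le> \<alpha> / real ?n" using q_le by simp
        then have "real ?n * (q - 1) - \<alpha> \<le> 0" by (simp add: field_simps)
        then show ?thesis using R powr_mono[of "real ?n * (q - 1) - \<alpha>" 0 R] by simp
      qed
      ultimately show ?thesis by (simp add: mult_left_le)
    qed
    have e2: "R powr - \<alpha> * (\<kappa> * measure lebesgue (D R)) \<le> ?V * h"
    proof -
      have "R powr - \<alpha> * (\<kappa> * measure lebesgue (D R)) \<le> R powr - \<alpha> * (\<kappa> * (2 * R powr \<alpha> * (4 * R) ^ ?n))"
        using \<kappa> by (intro mult_left_mono measure_D_le[OF R \<tau>]) auto
      also have "\<dots> = ?V * h"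
      proof -
        have "R powr - real ?n * R ^ ?n = 1" "R powr - \<alpha> * R powr \<alpha> = 1"
          using R by (simp_all add: powr_minus powr_realpow)
        then have "(R powr - \<alpha> * R powr \<alpha>) * (R powr - real ?n * R ^ ?n) * (h * ?V) = ?V * h"
          by simp
        then show ?thesis by (simp add: \<kappa>_def power_mult_distrib mult_ac)
      qed
      finally show ?thesis .
    qed
    have "w_integral (\<zeta> R \<tau>) = 2 powr q * (2 powr (- q) * w_integral (\<zeta> R \<tau>))"
      by (simp add: powr_minus)
    also have "\<dots> \<le> 2 powr q * ((2 + 2 * C * 2 powr q) * \<beta> R *
        (\<kappa> powr (1 - q) * J + \<kappa> * measure lebesgue (D R)))"
      unfolding J_def by (intro mult_left_mono key_estimate_domain(1)[OF R \<tau> \<kappa>]) simp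
    also have "\<dots> = 2 powr q * (2 + 2 * C * 2 powr q) * \<beta>\<^sub>0 *
        (R powr - \<alpha> * \<kappa> powr (1 - q) * J + R powr - \<alpha> * (\<kappa> * measure lebesgue (D R)))"
      by (simp add: \<beta>_def algebra_simps)
    also have "\<dots> \<le> ?L0 * (?V * (h powr (1 - q) * J + h))"
    proof (rule mult_mono)
      have "R powr - \<alpha> * \<kappa> powr (1 - q) * J \<le> h powr (1 - q) * J"
        by (rule mult_right_mono[OF e1 J])
      also have "\<dots> \<le> ?V * (h powr (1 - q) * J)"
        using mult_right_mono[OF V, of "h powr (1 - q) * J"] J by simp
      finally show "R powr - \<alpha> * \<kappa> powr (1 - q) * J + R powr - \<alpha> * (\<kappa> * measure lebesgue (D R))
          \<le> ?V * (h powr (1 - q) * J + h)"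
        unfolding distrib_left by (rule add_mono[OF _ e2])
      show "2 powr q * (2 + 2 * C * 2 powr q) * \<beta>\<^sub>0 \<le> ?L0"
        using C_pos by (intro mult_left_mono) auto
    qed (use J \<kappa> L0 in \<open>auto intro!: add_nonneg_nonneg\<close>)
    finally show "w_integral (\<zeta> R \<tau>) \<le> ?L0 * ?V * (h powr (1 - q) * w_integral (\<iota> R \<tau>) + h)"
      by (simp add: J_def mult.assoc)
  qed
qed

end

section \<open>The limit of expanding cylinders\<close>

context fujita_setting
begin

abbreviation H where "H \<equiv> lebesgue_on (half_space :: 'n spacetime set)"

text \<open>A single index drives both limits, R to infinity and \<tau> to 0; the shifts by 2 and 1
  keep R > 1 and \<tau> finite at k = 0.\<close>

definition R\<^sub>n :: "nat \<Rightarrow> real" where "R\<^sub>n k = real k + 2"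
definition \<tau>\<^sub>n :: "nat \<Rightarrow> real" where "\<tau>\<^sub>n k = 1 / (real k + 1)"

lemma R\<^sub>n_gt_1: "1 < R\<^sub>n k" and \<tau>\<^sub>n_pos: "0 < \<tau>\<^sub>n k"
  by (simp_all add: R\<^sub>n_def \<tau>\<^sub>n_def)

text \<open>At a fixed point the cutoffs do not merely converge but become constant, as soon as
  \<tau> <= t, |x| <= R/2 and 4 t <= R^\<alpha>.\<close>

lemma cutoffs_eventually:
  assumes x: "x \<in> half_space"
  shows "\<forall>\<^sub>F k in sequentially. \<zeta> (R\<^sub>n k) (\<tau>\<^sub>n k) x = 1 \<and> \<iota> (R\<^sub>n k) (\<tau>\<^sub>n k) x = 0"
proof -
  have t: "0 < fst x" using x by (auto simp: half_space_def)
  have l1: "filterlim (\<lambda>k. real k + 2) at_top sequentially" by real_asymp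
  have l2: "filterlim (\<lambda>k. (real k + 2) powr \<alpha>) at_top sequentially"
    using \<alpha>_pos by real_asymp
  have "\<forall>\<^sub>F k in sequentially. 2 * norm (snd x) + 1 / fst x + 2 \<le> real k + 2"
    using l1 by (simp only: filterlim_at_top)
  moreover have "\<forall>\<^sub>F k in sequentially. 4 * fst x \<le> (real k + 2) powr \<alpha>"
    using l2 by (simp only: filterlim_at_top)
  ultimately show ?thesis
  proof eventually_elim
    case (elim k)
    let ?R = "R\<^sub>n k"
    have "1 / fst x \<le> real k + 1" using elim(1) by (smt (verit) norm_ge_zero)
    then have "1 \<le> fst x / \<tau>\<^sub>n k" using t by (simp add: \<tau>\<^sub>n_def field_simps)
    then have \<rho>: "\<rho> (\<tau>\<^sub>n k) (fst x) = 1" by (simp add: \<rho>_def \<psi>_eq_0)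
    have n: "norm (snd x) \<le> ?R / 2"
    proof -
      have "0 < 1 / fst x" using t by simp
      moreover have "y \<le> (m + 2) / 2" if "0 < z" "2 * y + z + 2 \<le> m + 2" for y z m :: real
        using that by (simp add: field_simps)
      ultimately show ?thesis using elim(1) unfolding R\<^sub>n_def by blast
    qed
    have T: "fst x \<le> ?R powr \<alpha> / 4" using elim(2) by (simp add: R\<^sub>n_def)
    have "0 < ?R powr \<alpha>" using R\<^sub>n_gt_1[of k] by simp
    then have "fst x / ?R powr \<alpha> \<le> 1/4" using T by (simp add: field_simps)
    moreover have "snd x \<bullet> snd x / ?R\<^sup>2 \<le> 1/4"
    proof -
      have "snd x \<bullet> snd x \<le> (?R / 2)\<^sup>2"
        unfolding power2_norm_eq_inner[symmetric] by (rule power_mono[OF n]) simp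
      then show ?thesis using R\<^sub>n_gt_1[of k] by (simp add: power2_eq_square field_simps)
    qed
    ultimately have "W ?R x = 1" by (simp add: W_def \<psi>_eq_1)
    moreover have "x \<notin> N ?R" using T n by (simp add: N_def)
    ultimately show ?case using \<rho> by (simp add: \<zeta>_def \<iota>_def)
  qed
qed

lemma w_measurable: "w \<in> borel_measurable H"
  using u_loc v_loc unfolding W_loc_def w_def[abs_def] by (intro borel_measurable_diff) auto

lemmas weighted_integrable = key_estimate_domain(2)[OF R\<^sub>n_gt_1 \<tau>\<^sub>n_pos zero_less_one]

text \<open>Integrability of |w|^q over the half-space is not yet known at the first use, hence the
  nonnegative integral. The bound is asked only eventually, because at the second use it holds only
  for large k.\<close>

lemma fatou:
  assumes "\<forall>\<^sub>F k in sequentially. w_integral (\<zeta> (R\<^sub>n k) (\<tau>\<^sub>n k)) \<le> b"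
  shows "(\<integral>\<^sup>+x. ennreal (\<bar>w x\<bar> powr q) \<partial>H) \<le> ennreal b"
proof -
  let ?f = "\<lambda>k x. \<bar>w x\<bar> powr q * \<zeta> (R\<^sub>n k) (\<tau>\<^sub>n k) x"
  have "liminf (\<lambda>k. ennreal (?f k x)) = ennreal (\<bar>w x\<bar> powr q)" if "x \<in> space H" for x
  proof (rule lim_imp_Liminf[OF sequentially_bot tendsto_eventually])
    show "\<forall>\<^sub>F k in sequentially. ennreal (?f k x) = ennreal (\<bar>w x\<bar> powr q)"
      by (rule eventually_mono[OF cutoffs_eventually]) (use that in auto)
  qed
  then have "(\<integral>\<^sup>+x. ennreal (\<bar>w x\<bar> powr q) \<partial>H) = (\<integral>\<^sup>+x. liminf (\<lambda>k. ennreal (?f k x)) \<partial>H)"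
    by (intro nn_integral_cong) simp
  also have "\<dots> \<le> liminf (\<lambda>k. \<integral>\<^sup>+x. ennreal (?f k x) \<partial>H)"
    by (rule nn_integral_liminf)
      (intro measurable_compose[OF _ measurable_ennreal] borel_measurable_integrable[OF weighted_integrable])
  also have "\<dots> \<le> ennreal b"
  proof (rule order_trans[OF Liminf_le_Limsup[OF sequentially_bot] Limsup_bounded])
    show "\<forall>\<^sub>F k in sequentially. (\<integral>\<^sup>+x. ennreal (?f k x) \<partial>H) \<le> ennreal b"
      using assms
    proof eventually_elim
      case (elim k)
      have "(\<integral>\<^sup>+x. ennreal (?f k x) \<partial>H) = ennreal (w_integral (\<zeta> (R\<^sub>n k) (\<tau>\<^sub>n k)))"
        by (rule nn_integral_eq_integral[OF weighted_integrable AE_I2]) (simp add: \<zeta>_bounds)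
      then show ?case using elim by (simp add: ennreal_leI)
    qed
  qed
  finally show ?thesis .
qed

lemma \<iota>_le_\<zeta>: "\<iota> R \<tau> x \<le> \<zeta> R \<tau> x"
  using \<zeta>_bounds by (simp add: \<iota>_def indicator_def)

lemma weighted_\<iota>_integrable:
  "integrable H (\<lambda>x. \<bar>w x\<bar> powr q * \<iota> (R\<^sub>n k) (\<tau>\<^sub>n k) x)"
proof (rule Bochner_Integration.integrable_bound[OF weighted_integrable[of k]])
  show "(\<lambda>x. \<bar>w x\<bar> powr q * \<iota> (R\<^sub>n k) (\<tau>\<^sub>n k) x) \<in> borel_measurable H"
    using w_measurable \<iota>_measurable[OF R\<^sub>n_gt_1 \<tau>\<^sub>n_pos] by measurable
  show "AE x in H. norm (\<bar>w x\<bar> powr q * \<iota> (R\<^sub>n k) (\<tau>\<^sub>n k) x) \<le> norm (\<bar>w x\<bar> powr q * \<zeta> (R\<^sub>n k) (\<tau>\<^sub>n k) x)"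
    using \<iota>_le_\<zeta> \<iota>_bounds \<zeta>_bounds by (intro AE_I2) (simp add: abs_mult mult_left_mono)
qed

text \<open>Absorption: \<iota> <= \<zeta>, so a large h moves half of the left side of the key
  estimate to the left. This is legitimate because the weighted integrals are finite for every
  k.\<close>

lemma w_integrable: "integrable H (\<lambda>x. \<bar>w x\<bar> powr q)"
proof -
  obtain L where L: "0 < L" and est: "\<forall>R \<tau> h. 1 < R \<longrightarrow> 0 < \<tau> \<longrightarrow> 0 < h \<longrightarrow>
      w_integral (\<zeta> R \<tau>) \<le> L * (h powr (1 - q) * w_integral (\<iota> R \<tau>) + h)"
    using key_estimate by blast
  \<comment> \<open>The solution of L h^(1-q) = 1/2.\<close>
  define h where "h = (2 * L) powr (1 / (q - 1))"
  have h: "0 < h" "L * h powr (1 - q) = 1 / 2"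
  proof -
    have "(1 / (q - 1)) * (1 - q) = -1" using q_gt_1 by (simp add: field_simps)
    then show "0 < h" "L * h powr (1 - q) = 1 / 2"
      unfolding h_def powr_powr using L by (simp_all add: powr_minus)
  qed
  have "w_integral (\<zeta> (R\<^sub>n k) (\<tau>\<^sub>n k)) \<le> 2 * L * h" for k
  proof -
    have "w_integral (\<iota> (R\<^sub>n k) (\<tau>\<^sub>n k)) \<le> w_integral (\<zeta> (R\<^sub>n k) (\<tau>\<^sub>n k))"
      by (rule integral_mono[OF weighted_\<iota>_integrable weighted_integrable])
        (intro mult_left_mono \<iota>_le_\<zeta>, simp)
    moreover have "w_integral (\<zeta> (R\<^sub>n k) (\<tau>\<^sub>n k))
        \<le> L * (h powr (1 - q) * w_integral (\<iota> (R\<^sub>n k) (\<tau>\<^sub>n k)) + h)"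
      using est R\<^sub>n_gt_1 \<tau>\<^sub>n_pos h(1) by blast
    then have "w_integral (\<zeta> (R\<^sub>n k) (\<tau>\<^sub>n k))
        \<le> (L * h powr (1 - q)) * w_integral (\<iota> (R\<^sub>n k) (\<tau>\<^sub>n k)) + L * h"
      by (simp only: distrib_left mult.assoc)
    ultimately show ?thesis unfolding h(2) by linarith
  qed
  then have "(\<integral>\<^sup>+x. ennreal (\<bar>w x\<bar> powr q) \<partial>H) \<le> ennreal (2 * L * h)"
    by (intro fatou) simp
  then have "(\<integral>\<^sup>+x. ennreal (\<bar>w x\<bar> powr q) \<partial>H) < \<infinity>"
    by (rule le_less_trans) simp
  then show ?thesis
    using w_measurable by (intro integrableI_nonneg) auto
qed

text \<open>With |w|^q as an integrable majorant, the integrals against \<iota> tend to 0 by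
  dominated convergence. The key estimate then bounds the total integral by a multiple of h for
  every h > 0.\<close>

lemma w_eq_0: "AE x in H. w x = 0"
proof -
  obtain L where L: "0 < L" and est: "\<forall>R \<tau> h. 1 < R \<longrightarrow> 0 < \<tau> \<longrightarrow> 0 < h \<longrightarrow>
      w_integral (\<zeta> R \<tau>) \<le> L * (h powr (1 - q) * w_integral (\<iota> R \<tau>) + h)"
    using key_estimate by blast
  have "(\<lambda>k. w_integral (\<iota> (R\<^sub>n k) (\<tau>\<^sub>n k))) \<longlonglongrightarrow> integral\<^sup>L H (\<lambda>x. 0)"
  proof (rule integral_dominated_convergence[OF _ _ w_integrable])
    show "AE x in H. (\<lambda>k. \<bar>w x\<bar> powr q * \<iota> (R\<^sub>n k) (\<tau>\<^sub>n k) x) \<longlonglongrightarrow> 0"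
    proof (rule AE_I2)
      fix x assume "x \<in> space H"
      then have "x \<in> half_space" by simp
      from cutoffs_eventually[OF this]
      show "(\<lambda>k. \<bar>w x\<bar> powr q * \<iota> (R\<^sub>n k) (\<tau>\<^sub>n k) x) \<longlonglongrightarrow> 0"
        by (intro tendsto_eventually, elim eventually_mono) simp
    qed
    show "AE x in H. norm (\<bar>w x\<bar> powr q * \<iota> (R\<^sub>n k) (\<tau>\<^sub>n k) x) \<le> \<bar>w x\<bar> powr q" for k
      using \<iota>_bounds by (intro AE_I2) (simp add: abs_mult mult_left_le)
    show "(\<lambda>x. \<bar>w x\<bar> powr q * \<iota> (R\<^sub>n k) (\<tau>\<^sub>n k) x) \<in> borel_measurable H" for k
      by (rule borel_measurable_integrable[OF weighted_\<iota>_integrable])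
  qed simp
  then have J: "(\<lambda>k. w_integral (\<iota> (R\<^sub>n k) (\<tau>\<^sub>n k))) \<longlonglongrightarrow> 0" by simp
  \<comment> \<open>The order of limits matters: h is fixed, then k is taken so large that h^(1-q)
    times the integral against \<iota> falls below h.\<close>
  have small: "(\<integral>\<^sup>+x. ennreal (\<bar>w x\<bar> powr q) \<partial>H) \<le> ennreal (2 * L * h)" if h: "0 < h" for h
  proof (rule fatou)
    have "(\<lambda>k. h powr (1 - q) * w_integral (\<iota> (R\<^sub>n k) (\<tau>\<^sub>n k))) \<longlonglongrightarrow> h powr (1 - q) * 0"
      by (intro tendsto_mult tendsto_const J)
    then have "\<forall>\<^sub>F k in sequentially. h powr (1 - q) * w_integral (\<iota> (R\<^sub>n k) (\<tau>\<^sub>n k)) < h"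
      using h by (intro order_tendstoD(2)) auto
    then show "\<forall>\<^sub>F k in sequentially. w_integral (\<zeta> (R\<^sub>n k) (\<tau>\<^sub>n k)) \<le> 2 * L * h"
    proof eventually_elim
      case (elim k)
      have "w_integral (\<zeta> (R\<^sub>n k) (\<tau>\<^sub>n k))
          \<le> L * (h powr (1 - q) * w_integral (\<iota> (R\<^sub>n k) (\<tau>\<^sub>n k)) + h)"
        using est R\<^sub>n_gt_1 \<tau>\<^sub>n_pos h by blast
      also have "\<dots> \<le> L * (h + h)" using elim L by (intro mult_left_mono) auto
      finally show ?case by simp
    qed
  qed
  have "(\<integral>\<^sup>+x. ennreal (\<bar>w x\<bar> powr q) \<partial>H) = 0"
  proof (rule antisym)
    show "(\<integral>\<^sup>+x. ennreal (\<bar>w x\<bar> powr q) \<partial>H) \<le> 0"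
    proof (rule ennreal_le_epsilon)
      fix e :: real assume "0 < e"
      then have "0 < e / (2 * L)" using L by simp
      from small[OF this] show "(\<integral>\<^sup>+x. ennreal (\<bar>w x\<bar> powr q) \<partial>H) \<le> 0 + ennreal e"
        using L by simp
    qed
  qed simp
  moreover have "(\<lambda>x. ennreal (\<bar>w x\<bar> powr q)) \<in> borel_measurable H"
    using w_measurable by measurable
  ultimately have "AE x in H. ennreal (\<bar>w x\<bar> powr q) = 0"
    using nn_integral_0_iff_AE by blast
  then show ?thesis by (rule eventually_mono) simp
qed

end

theorem theorem2:
  fixes \<alpha> q c :: real
    and a :: "'n::finite \<Rightarrow> 'n \<Rightarrow> 'n spacetime \<Rightarrow> real"
    and A u v :: "'n spacetime \<Rightarrow> real"
  assumes "0 < \<alpha>" and "1 < q" and "q \<le> 1 + \<alpha> / real CARD('n)"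
    and "\<And>i j. a i j \<in> borel_measurable (lebesgue_on half_space)"
    and "\<And>i j. locally_bounded_on half_space (a i j)"
    and "\<And>i j. AE p in lebesgue_on half_space. a i j p = a j i p"
    and "A \<in> borel_measurable (lebesgue_on half_space)"
    and "locally_bounded_on half_space A"
    and "\<And>p. p \<in> half_space \<Longrightarrow> 0 \<le> A p"
    and "AE p in lebesgue_on half_space. \<forall>\<xi>.
      0 \<le> coeff_form a p \<xi> \<xi> \<and> coeff_form a p \<xi> \<xi> \<le> A p * (norm \<xi>)\<^sup>2"
    and "0 < c"
    and "\<And>R. 1 < R \<Longrightarrow>
      esssup (lebesgue_on ({0<..} \<times> {x :: real ^ 'n. R / 2 < norm x \<and> norm x < R}))
        (\<lambda>p. ereal (A p)) \<le> ereal (c * R powr (2 - \<alpha>))"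
    and "entire_weak_supersolution a q u"
    and "entire_weak_subsolution a q v"
    and "AE p in lebesgue_on half_space. v p \<le> u p"
  shows "AE p in lebesgue_on half_space. u p = v p"
proof -
  \<comment> \<open>Any exponent strictly between 1 and q serves; this is the midpoint.\<close>
  let ?p = "(1 + q) / 2"
  have p: "1 < ?p" "?p < q" using assms(2) by simp_all
  obtain \<psi> \<psi>' B where \<psi>: "\<And>k. Ck_on k UNIV \<psi>" "\<And>r. (\<psi> has_real_derivative \<psi>' r) (at r)"
    "\<And>r. 0 \<le> \<psi> r" "\<And>r. \<psi> r \<le> 1" "\<And>r. \<psi>' r \<le> 0" "\<And>r. \<bar>\<psi>' r\<bar> \<le> B"
    "\<And>r. r \<le> 1/4 \<Longrightarrow> \<psi> r = 1" "\<And>r. 1 \<le> r \<Longrightarrow> \<psi> r = 0"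
    "\<And>r. r \<le> 1/4 \<or> 1 \<le> r \<Longrightarrow> \<psi>' r = 0"
    using smooth_cutoff_exists by metis
  obtain g g' G :: "real \<Rightarrow> real" and C where g: "\<And>k. Ck_on k UNIV g" "\<And>y. (g has_real_derivative g' y) (at y)"
    "\<And>y. (G has_real_derivative g y) (at y)" "G 0 = 0"
    "\<And>y. 1 \<le> g y" "\<And>y. g y \<le> 2" "\<And>y. g' y < 0" "\<And>y. \<bar>g' y\<bar> \<le> C"
    "\<And>y. 1 / \<bar>g' y\<bar> \<le> C * (1 + \<bar>y\<bar> powr ?p)" "0 < C" "continuous_on UNIV g'"
    using slowly_decreasing_profile[OF p(1)] by metis
  obtain s :: nat where s: "2 * q / (q - ?p) \<le> real s"
    using real_arch_simple by blast
  obtain ut Fu where u: "W_loc a q u ut Fu"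
    "\<And>\<phi>. test_function \<phi> \<Longrightarrow> \<forall>x\<in>half_space. 0 \<le> \<phi> x \<Longrightarrow> 0 \<le> weak_form q u ut Fu \<phi>"
    using assms(13) unfolding entire_weak_supersolution_def by blast
  obtain vt Fv where v: "W_loc a q v vt Fv"
    "\<And>\<phi>. test_function \<phi> \<Longrightarrow> \<forall>x\<in>half_space. 0 \<le> \<phi> x \<Longrightarrow> weak_form q v vt Fv \<phi> \<le> 0"
    using assms(14) unfolding entire_weak_subsolution_def by blast
  \<comment> \<open>There are finitely many index pairs, so the exceptional null sets can be
    united.\<close>
  have "AE x in lebesgue_on half_space. \<forall>i\<in>UNIV. \<forall>j\<in>UNIV. a i j x = a j i x"
    by (intro AE_finite_allI assms(6)) auto
  then have psd: "AE x in lebesgue_on half_space. psd_at a x"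
    using assms(10) by eventually_elim (simp add: psd_at_def)
  \<comment> \<open>The essential supremum is attained as an almost everywhere bound on the annular
    slab; null sets are carried over to the half-space through the ambient Lebesgue measure.\<close>
  have growth: "AE x in lebesgue_on half_space.
      R / 2 < norm (snd x) \<and> norm (snd x) < R \<longrightarrow> A x \<le> c * R powr (2 - \<alpha>)" if "1 < R" for R
  proof -
    let ?S = "{0::real<..} \<times> {x :: real ^ 'n. R / 2 < norm x \<and> norm x < R}"
    have "open ?S"
      by (intro open_Times open_greaterThan open_Collect_conj open_Collect_less continuous_intros)
    then have S: "?S \<in> sets lebesgue"
      by (intro sets_completionI_sets) (simp add: borel_open)
    have "AE x in lebesgue_on ?S. A x \<le> c * R powr (2 - \<alpha>)"
      using esssup_AE[of "\<lambda>x. ereal (A x)" "lebesgue_on ?S"]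
    proof (rule eventually_mono)
      fix x assume "ereal (A x) \<le> esssup (lebesgue_on ?S) (\<lambda>x. ereal (A x))"
      from order_trans[OF this assms(12)[OF that]] show "A x \<le> c * R powr (2 - \<alpha>)" by simp
    qed
    then have "AE x in lebesgue. x \<in> ?S \<longrightarrow> A x \<le> c * R powr (2 - \<alpha>)"
      using S by (simp add: AE_restrict_space_iff)
    moreover have H: "(half_space :: 'n spacetime set) \<in> sets lebesgue"
      by (intro sets_completionI_sets) (simp add: borel_open open_half_space)
    have "AE x in lebesgue. x \<in> (half_space :: 'n spacetime set) \<longrightarrow>
        R / 2 < norm (snd x) \<and> norm (snd x) < R \<longrightarrow> A x \<le> c * R powr (2 - \<alpha>)"
      using calculation by (rule eventually_mono) (auto simp: half_space_def)
    then show ?thesis using H by (simp add: AE_restrict_space_iff)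
  qed
  interpret fujita_setting a A u v ut vt Fu Fv \<alpha> q c ?p B C \<psi> \<psi>' g g' G s
  proof unfold_locales
    show "AE x in lebesgue_on half_space. \<forall>\<xi>. coeff_form a x \<xi> \<xi> \<le> A x * (norm \<xi>)\<^sup>2"
      using assms(10) by (rule eventually_mono) blast
  qed (fact assms(1-5,11,15) psd growth u v \<psi> g p s)+
  show ?thesis using w_eq_0 by (rule eventually_mono) (simp add: w_def)
qed

end
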